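(* Let $F=\mathbb{F}_q$ be the finite field with $q$ elements, let $n\geq 2$, and let $z\in M_n(F)$ be nonscalar. Put $t=\mathrm{Tr}(z)$ and suppose $(n,q,t)\neq(2,2,1)$. Then there exist conjugacy classes $X,Y\subset M_n(F)$ such that the characteristic polynomial of $X$ is irreducible of degree $n$ over $F$, the characteristic polynomial of $Y$ is of the form $(T-\lambda)h(T)$, where $\lambda\in F$, $h$ is an irreducible polynomial over $F$ of degree $n-1$ and $h(\lambda)\neq 0$ (so that if $n=2$ the two linear factors are distinct), $\mathrm{Tr}(z)=\mathrm{Tr}(X)+\mathrm{Tr}(Y)$, and $$\left|N_{X,Y}(z)-q^{(n-1)^2}\right|\leq 42\,q^{(n-1)^2-1}.$$
   Context: $q$ is an arbitrary prime power. A conjugacy class in $M_n(F)$ is an orbit of $M_n(F)$ under conjugation by $\mathrm{GL}_n(F)$; its characteristic polynomial and trace $\mathrm{Tr}(X)$ are those of any of its elements. For conjugacy classes $X,Y\subset M_n(F)$ and $z\in M_n(F)$, $N_{X,Y}(z):=\#\{(x,y)\in X\times Y : x+y=z\}$. *)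

theory Defs
  imports "Jordan_Normal_Form.Char_Poly" "HOL-Library.Cardinality"
begin

definition mat_trace :: "'a :: comm_monoid_add mat \<Rightarrow> 'a" where
  "mat_trace A = (\<Sum>i<dim_row A. A $$ (i, i))"

definition scalar_mat :: "nat \<Rightarrow> 'a :: semiring_1 mat \<Rightarrow> bool" where
  "scalar_mat n A \<longleftrightarrow> (\<exists>c. A = c \<cdot>\<^sub>m 1\<^sub>m n)"

text \<open>
  \<^const>\<open>similar_mat\<close> is conjugacy by an invertible matrix, so these are the orbits of
  the conjugation action of the general linear group on the square matrices of size \<open>n\<close>.
\<close>
definition conj_class :: "nat \<Rightarrow> 'a :: semiring_1 mat set \<Rightarrow> bool" where
  "conj_class n X \<longleftrightarrow> (\<exists>A \<in> carrier_mat n n. X = {B \<in> carrier_mat n n. similar_mat B A})"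

text \<open>
  The common value on the elements of the class; see \<open>class_char_poly_eq\<close> and
  \<open>class_trace_eq\<close> below.
\<close>
definition class_char_poly :: "'a :: comm_ring_1 mat set \<Rightarrow> 'a poly" where
  "class_char_poly X = (THE p. \<forall>x\<in>X. char_poly x = p)"

definition class_trace :: "'a :: comm_ring_1 mat set \<Rightarrow> 'a" where
  "class_trace X = (THE t. \<forall>x\<in>X. mat_trace x = t)"

text \<open>
  Over a finite field the set counted here is finite for conjugacy classes \<open>X\<close> and \<open>Y\<close>
  (see \<open>finite_conj_class\<close>), so \<^const>\<open>card\<close> is the true number of solutions.
\<close>
definition num_sum_reps :: "'a :: plus mat set \<Rightarrow> 'a mat set \<Rightarrow> 'a mat \<Rightarrow> nat" where
  "num_sum_reps X Y z = card {(x, y). x \<in> X \<and> y \<in> Y \<and> x + y = z}"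

lemma conj_class_nonempty:
  assumes "conj_class n X"
  shows "X \<noteq> {}"
proof -
  from assms obtain A where A: "A \<in> carrier_mat n n"
    and X: "X = {B \<in> carrier_mat n n. similar_mat B A}"
    unfolding conj_class_def by auto
  have "A \<in> X" unfolding X using A similar_mat_refl[OF A] by simp
  then show ?thesis by auto
qed

lemma conj_class_similar:
  assumes "conj_class n X" "x \<in> X" "y \<in> X"
  shows "similar_mat x y"
proof -
  from assms obtain A where "similar_mat x A" "similar_mat y A"
    unfolding conj_class_def by auto
  then show ?thesis
    using similar_mat_trans[OF _ similar_mat_sym] by blast
qed

lemma mat_trace_mult_comm:
  fixes A B :: "'a :: comm_ring_1 mat"
  assumes A: "A \<in> carrier_mat n n" and B: "B \<in> carrier_mat n n"
  shows "mat_trace (A * B) = mat_trace (B * A)"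
proof -
  have "mat_trace (A * B) = (\<Sum>i<n. \<Sum>j<n. A $$ (i, j) * B $$ (j, i))"
    using A B by (auto simp: mat_trace_def scalar_prod_def atLeast0LessThan intro!: sum.cong)
  also have "\<dots> = (\<Sum>j<n. \<Sum>i<n. A $$ (i, j) * B $$ (j, i))"
    by (rule sum.swap)
  also have "\<dots> = mat_trace (B * A)"
    using A B by (auto simp: mat_trace_def scalar_prod_def atLeast0LessThan mult.commute
        intro!: sum.cong)
  finally show ?thesis .
qed

lemma mat_trace_similar:
  fixes A B :: "'a :: comm_ring_1 mat"
  assumes "similar_mat A B"
  shows "mat_trace A = mat_trace B"
proof -
  from similar_matD[OF assms] obtain n P Q where
    sub: "{A, B, P, Q} \<subseteq> carrier_mat n n"
    and QP: "Q * P = 1\<^sub>m n" and A: "A = P * B * Q"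
    by (elim exE conjE)
  from sub have c: "B \<in> carrier_mat n n" "P \<in> carrier_mat n n" "Q \<in> carrier_mat n n"
    by simp_all
  have "mat_trace A = mat_trace (Q * (P * B))"
    unfolding A by (rule mat_trace_mult_comm[of _ n]) (use c in auto)
  also have "Q * (P * B) = Q * P * B"
    by (rule assoc_mult_mat[symmetric]) (use c in auto)
  also have "\<dots> = B"
    using c by (simp add: QP)
  finally show ?thesis .
qed

lemma class_char_poly_eq:
  assumes "conj_class n X" "x \<in> X"
  shows "class_char_poly X = char_poly x"
  unfolding class_char_poly_def
proof (rule the_equality)
  show "\<forall>y\<in>X. char_poly y = char_poly x"
    using conj_class_similar[OF assms(1) _ assms(2)] char_poly_similar by blast
qed (use assms(2) in simp)

lemma class_trace_eq:
  assumes "conj_class n X" "x \<in> X"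
  shows "class_trace X = mat_trace x"
  unfolding class_trace_def
proof (rule the_equality)
  show "\<forall>y\<in>X. mat_trace y = mat_trace x"
    using conj_class_similar[OF assms(1) _ assms(2)] mat_trace_similar by blast
qed (use assms(2) in simp)

lemma finite_carrier_mat: "finite (carrier_mat n m :: 'a :: finite mat set)"
proof -
  let ?S = "{..<n} \<times> {..<m}"
  have "carrier_mat n m \<subseteq> mat n m ` (?S \<rightarrow>\<^sub>E (UNIV :: 'a set))"
  proof
    fix A :: "'a mat" assume A: "A \<in> carrier_mat n m"
    have "A = mat n m (restrict (($$) A) ?S)"
      using A by (intro eq_matI) auto
    then show "A \<in> mat n m ` (?S \<rightarrow>\<^sub>E UNIV)"
      by (rule image_eqI[where f = "mat n m"]) simp
  qed
  then show ?thesis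
    by (rule finite_subset) (simp add: finite_PiE)
qed

lemma finite_conj_class:
  fixes X :: "'a :: {semiring_1, finite} mat set"
  assumes "conj_class n X"
  shows "finite X"
proof (rule finite_subset)
  show "X \<subseteq> carrier_mat n n"
    using assms unfolding conj_class_def by auto
qed (rule finite_carrier_mat)

end

theory Submission
  imports "HOL-Algebra.Algebraic_Closure_Type" Defs
begin

text \<open>
  Put \<open>m = n - 1\<close>. Let \<open>f\<close> and \<open>h\<close> be monic irreducible of degrees \<open>n\<close> and \<open>m\<close>, and let \<open>X\<close> and
  \<open>Y\<close> be the sets of all matrices with characteristic polynomials \<open>f\<close> and \<open>(T - l) h\<close>. Each
  \<open>y \<in> Y\<close> has exactly \<open>q - 1\<close> eigenvectors with eigenvalue \<open>l\<close>, so \<open>(q - 1) N\<close> is the number of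
  pairs \<open>(v, x)\<close> where \<open>v \<noteq> 0\<close>, \<open>x \<in> X\<close>, \<open>z - x \<in> Y\<close> and \<open>(z - x) v = l v\<close>. Fix \<open>v\<close> and choose
  a basis starting with \<open>v\<close>. Then \<open>z\<close>, \<open>z - x\<close>, \<open>x\<close> have first columns \<open>(a, c)\<close>, \<open>(l, 0)\<close>,
  \<open>(a - l, c)\<close> and lower right blocks \<open>d\<close>, \<open>y\<close>, \<open>d - y\<close>, where \<open>y\<close> has characteristic polynomial
  \<open>h\<close>. By pole placement there is at most one first row for which \<open>x\<close> has characteristic
  polynomial \<open>f\<close>, and there is one if \<open>c\<close> is a cyclic vector for \<open>d - y\<close>. It remains to observe
  that about \<open>q\<^bsup>m(m-1)\<^esup>\<close> matrices \<open>y\<close> have characteristic polynomial \<open>h\<close>, that \<open>c \<noteq> 0\<close> is cyclic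
  for \<open>d - y\<close> for all but a fraction \<open>O(1/q)\<close> of them, and that only a fraction \<open>O(1/q)\<close> of all
  vectors are eigenvectors of the nonscalar matrix \<open>z\<close>.
\<close>

text \<open>The matrices with a given characteristic polynomial form a single conjugacy class as
  soon as each of them has a cyclic vector, because all are then similar to one companion matrix.
  Irreducibility of \<open>f\<close> gives this for \<open>X\<close>; for \<open>Y\<close> it
  follows from \<open>h\<close> being irreducible with \<open>h(l)\<close> nonzero, and the same
  cyclic vector shows that the eigenspace of \<open>l\<close> is a line. The obstacle is the trace:
  with the corner and the lower right block fixed, no first row can change it, so pole placement
  reaches \<open>f\<close> only if Tr(z) = Tr(X) + Tr(Y). For n > 2 the eigenvalue \<open>l\<close>
  is free and absorbs the difference; for n = 2 it must avoid the root of \<open>h\<close>, which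
  can be arranged except in the excluded case. With R = q^((n-1)^2 - 1) the estimates amount to (q -
  4) R <= N <= (q + 2) R, so 42 is a roomy constant.\<close>

no_notation Polynomials.var (\<open>X\<index>\<close>)
no_notation fps_nth (infixl \<open>$\<close> 75)

section \<open>Irreducible polynomials over finite fields\<close>

lemma card_field_ge_2: "2 \<le> CARD('a :: {field, finite})"
proof -
  have "card {0, 1 :: 'a} \<le> CARD('a)" by (rule card_mono) auto
  then show ?thesis by simp
qed

text \<open>Multiplication by a nonzero \<open>x\<close> permutes the nonzero elements, so it leaves
  their product unchanged.\<close>

lemma field_power_card_eq_same:
  fixes x :: "'a :: {field, finite}"
  shows "x ^ CARD('a) = x"
proof (cases "x = 0")
  case True
  then show ?thesis using card_field_ge_2[where ?'a = 'a] by (simp add: power_0_left)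
next
  case False
  have "x * (\<Prod>y\<in>UNIV-{0}. x * y) = x * x ^ (CARD('a) - 1) * \<Prod>(UNIV-{0})"
    by (simp add: prod.distrib mult_ac)
  also have "x * x ^ (CARD('a) - 1) = x ^ Suc (CARD('a) - 1)"
    by (rule power_Suc [symmetric])
  also have "Suc (CARD('a) - 1) = CARD('a)"
    using card_field_ge_2[where ?'a = 'a] by simp
  also have "(\<Prod>y\<in>UNIV-{0}. x * y) = (\<Prod>y\<in>UNIV-{0}. y)"
    by (rule prod.reindex_bij_witness[of _ "\<lambda>y. y / x" "\<lambda>y. x * y"]) (use False in auto)
  finally show ?thesis by simp
qed

text \<open>Translation by 1 permutes the field, so adding 1 to every element does not change the
  sum of all of them.\<close>

lemma of_nat_card_eq_0: "of_nat CARD('a) = (0 :: 'a :: {field, finite})"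
proof -
  have "(\<Sum>x\<in>UNIV. x + 1 :: 'a) = (\<Sum>x\<in>UNIV. x)"
    by (rule sum.reindex_bij_witness[of _ "\<lambda>x. x - 1" "\<lambda>x. x + 1"]) auto
  then show ?thesis by (simp add: sum.distrib)
qed

text \<open>As a function on the field, the sum of the middle terms of \<open>(T + 1)^q\<close> is
  \<open>(a + 1)^q - a^q - 1 = 0\<close>. A polynomial of degree below q with q roots vanishes, so
  all its coefficients do; the characteristic never has to be mentioned.\<close>

lemma of_nat_card_choose_eq_0:
  assumes "0 < i" "i < CARD('a)"
  shows "of_nat (CARD('a) choose i) = (0 :: 'a :: {field, finite})"
proof -
  let ?q = "CARD('a)"
  define p :: "'a poly" where "p = (\<Sum>j = 1..<?q. monom (of_nat (?q choose j)) j)"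
  have deg: "degree p < ?q"
  proof -
    have "degree p \<le> ?q - 1"
      unfolding p_def by (rule degree_sum_le) (auto intro: order.trans[OF degree_monom_le])
    then show ?thesis using card_field_ge_2[where ?'a = 'a] by linarith
  qed
  have root: "poly p a = 0" for a
  proof -
    have "a + 1 = (a + 1) ^ ?q" by (simp only: field_power_card_eq_same)
    also have "\<dots> = (\<Sum>j\<le>?q. of_nat (?q choose j) * a ^ j)"
      by (simp add: binomial_ring)
    also have "{..?q} = insert 0 (insert ?q {1..<?q})"
      using card_field_ge_2[where ?'a = 'a] by auto
    also have "(\<Sum>j\<in>\<dots>. of_nat (?q choose j) * a ^ j) = 1 + (a ^ ?q + poly p a)"
      using card_field_ge_2[where ?'a = 'a]
      by (subst sum.insert, simp, simp, subst sum.insert) (auto simp: p_def poly_sum poly_monom)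
    finally show ?thesis by (simp add: field_power_card_eq_same)
  qed
  have "p = 0"
  proof (rule ccontr)
    assume "p \<noteq> 0"
    from card_poly_roots_bound[OF this] deg root show False by simp
  qed
  then have "coeff p i = 0" by simp
  moreover have "coeff p i = of_nat (?q choose i)"
    using assms by (simp add: p_def coeff_sum coeff_monom)
  ultimately show ?thesis by simp
qed

lemma alg_closure_power_card_add:
  fixes x y :: "'a :: {field, finite} alg_closure"
  shows "(x + y) ^ CARD('a) = x ^ CARD('a) + y ^ CARD('a)"
proof -
  let ?q = "CARD('a)"
  have *: "of_nat (?q choose j) = (0 :: 'a alg_closure)" if "0 < j" "j < ?q" for j
    using of_nat_card_choose_eq_0[OF that] by (metis to_ac_0 to_ac_of_nat)
  have "(x + y) ^ ?q = (\<Sum>j\<le>?q. of_nat (?q choose j) * x ^ j * y ^ (?q - j))"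
    by (simp add: binomial_ring)
  also have "\<dots> = (\<Sum>j\<in>{0, ?q}. of_nat (?q choose j) * x ^ j * y ^ (?q - j))"
    by (rule sum.mono_neutral_right) (auto simp: *)
  also have "\<dots> = x ^ ?q + y ^ ?q"
    using card_field_ge_2[where ?'a = 'a] by simp
  finally show ?thesis .
qed

lemma alg_closure_power_card_diff:
  fixes x y :: "'a :: {field, finite} alg_closure"
  shows "(x - y) ^ CARD('a) = x ^ CARD('a) - y ^ CARD('a)"
  using alg_closure_power_card_add[of "x - y" y] by (simp add: algebra_simps)

lemma alg_closure_power_card_inj:
  fixes x y :: "'a :: {field, finite} alg_closure"
  assumes "x ^ CARD('a) = y ^ CARD('a)"
  shows "x = y"
  using alg_closure_power_card_diff[of x y] assms by simp

lemma alg_closure_power_card_power_inj: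
  fixes x y :: "'a :: {field, finite} alg_closure"
  assumes "x ^ (CARD('a) ^ i) = y ^ (CARD('a) ^ i)"
  shows "x = y"
  using assms
proof (induction i)
  case (Suc i)
  from Suc.prems have "(x ^ (CARD('a) ^ i)) ^ CARD('a) = (y ^ (CARD('a) ^ i)) ^ CARD('a)"
    by (simp add: power_mult mult.commute flip: power_mult)
  from Suc.IH[OF alg_closure_power_card_inj[OF this]] show ?case .
qed simp

text \<open>The polynomial \<open>T^Q - T\<close> has derivative -1, hence no repeated root, and it
  splits over the algebraic closure.\<close>

lemma card_alg_closure_power_fixed:
  assumes "0 < i"
  shows "card {x :: 'a :: {field, finite} alg_closure. x ^ (CARD('a) ^ i) = x} = CARD('a) ^ i"
proof -
  let ?Q = "CARD('a) ^ i"
  have Q: "2 \<le> ?Q"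
    using card_field_ge_2[where ?'a = 'a] self_le_power[of "CARD('a)" i] assms by linarith
  define p :: "'a alg_closure poly" where "p = monom 1 ?Q - monom 1 1"
  have deg: "degree p = ?Q"
    unfolding p_def diff_conv_add_uminus
    using Q by (subst degree_add_eq_left) (auto simp: degree_monom_eq)
  have p0: "p \<noteq> 0" using deg Q by auto
  have roots: "{x. poly p x = 0} = {x. x ^ ?Q = x}"
    by (simp add: p_def poly_monom)
  have CARD0: "of_nat ?Q = (0 :: 'a alg_closure)"
    using of_nat_card_eq_0[where ?'a = 'a] assms
    by (metis of_nat_power to_ac_0 to_ac_of_nat zero_power)
  have pd: "pderiv p = -1"
    using CARD0 by (simp only: p_def pderiv_diff pderiv_monom) (simp add: one_pCons monom_0)
  obtain A where A: "size A = degree p" "p = Polynomial.smult (lead_coeff p) (\<Prod>x\<in>#A. [:-x, 1:])"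
    using alg_closed_imp_factorization[OF p0] by blast
  have count: "count A x \<le> 1" for x
  proof (rule ccontr)
    assume "\<not> count A x \<le> 1"
    then have "{#x, x#} \<subseteq># A" by (simp add: mset_subset_eqI subseteq_mset_def)
    then obtain B where B: "A = {#x, x#} + B" by (metis mset_subset_eq_exists_conv)
    define r where "r = Polynomial.smult (lead_coeff p) (\<Prod>x\<in>#B. [:-x, 1:])"
    have "p = [:-x, 1:] * ([:-x, 1:] * r)"
      by (subst A(2)) (simp add: B r_def)
    then have "pderiv p = [:-x, 1:] * pderiv ([:-x, 1:] * r) + ([:-x, 1:] * r) * pderiv [:-x, 1:]"
      by (simp only: pderiv_mult)
    then have "poly (pderiv p) x = 0" by simp
    with pd show False by simp
  qed
  have "size A = (\<Sum>x\<in>set_mset A. 1)"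
    unfolding size_multiset_overloaded_eq
    by (intro sum.cong refl) (use count in \<open>simp add: le_antisym flip: count_greater_zero_iff\<close>)
  then have "card (set_mset A) = size A" by simp
  moreover have "set_mset A = {x. poly p x = 0}"
    using p0 by (subst A(2)) (auto simp: poly_prod_mset prod_mset_zero_iff)
  ultimately show ?thesis using A(1) deg roots by simp
qed

text \<open>The image of the base field already supplies q fixed points of Frobenius, and there are
  only q.\<close>

lemma alg_closure_power_card_fixed:
  fixes x :: "'a :: {field, finite} alg_closure"
  assumes "x ^ CARD('a) = x"
  shows "x \<in> range to_ac"
proof -
  let ?S = "{x :: 'a alg_closure. x ^ CARD('a) = x}"
  have card: "card ?S = CARD('a)"
    using card_alg_closure_power_fixed[of 1, where ?'a = 'a] by simp
  have "range to_ac = ?S"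
  proof (rule card_subset_eq)
    show "finite ?S" using card card_field_ge_2[where ?'a = 'a] card.infinite by fastforce
    show "range to_ac \<subseteq> ?S" by (auto simp flip: to_ac_power simp: field_power_card_eq_same)
    show "card (range (to_ac :: 'a \<Rightarrow> _)) = card ?S"
      using card by (simp add: card_image inj_to_ac)
  qed
  with assms show ?thesis by blast
qed

lemma sum_powers_less:
  assumes "2 \<le> (q :: nat)"
  shows "(\<Sum>d<n. q ^ d) < q ^ n"
proof (induction n)
  case (Suc n)
  have "(\<Sum>d<Suc n. q ^ d) < q ^ n + q ^ n" using Suc by simp
  also have "\<dots> \<le> q ^ Suc n" using mult_le_mono1[OF assms, of "q ^ n"] by (simp only: power_Suc mult_2)
  finally show ?case .
qed simp

text \<open>The fixed sets of the smaller powers of Frobenius have together fewer than q^n elements,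
  by \<open>sum_powers_less\<close>, so they cannot cover the one of size q^n.\<close>

lemma exists_alg_closure_degree:
  assumes "0 < n"
  shows "\<exists>x :: 'a :: {field, finite} alg_closure. x ^ (CARD('a) ^ n) = x \<and>
           (\<forall>d. 0 < d \<longrightarrow> d < n \<longrightarrow> x ^ (CARD('a) ^ d) \<noteq> x)"
proof (rule ccontr)
  let ?q = "CARD('a)"
  let ?S = "\<lambda>d. {x :: 'a alg_closure. x ^ (?q ^ d) = x}"
  assume "\<not> ?thesis"
  then have sub: "?S n \<subseteq> (\<Union>d\<in>{0<..<n}. ?S d)" by fastforce
  have fin: "finite (?S d)" if "0 < d" for d
    using card_alg_closure_power_fixed[OF that, where ?'a = 'a] card_field_ge_2[where ?'a = 'a]
    by (metis card.infinite not_numeral_le_zero power_not_zero)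
  have "?q ^ n = card (?S n)" by (simp add: card_alg_closure_power_fixed assms)
  also have "\<dots> \<le> card (\<Union>d\<in>{0<..<n}. ?S d)" by (rule card_mono[OF _ sub]) (use fin in auto)
  also have "\<dots> \<le> (\<Sum>d\<in>{0<..<n}. card (?S d))" by (rule card_UN_le) simp
  also have "\<dots> = (\<Sum>d\<in>{0<..<n}. ?q ^ d)"
    by (rule sum.cong) (simp_all add: card_alg_closure_power_fixed)
  also have "\<dots> \<le> (\<Sum>d<n. ?q ^ d)" by (rule sum_mono2) auto
  also have "\<dots> < ?q ^ n" by (rule sum_powers_less) (rule card_field_ge_2)
  finally show False by simp
qed

lemma comm_ring_hom_power_card:
  "comm_ring_hom (\<lambda>x :: 'a :: {field, finite} alg_closure. x ^ CARD('a))"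
  using card_field_ge_2[where ?'a = 'a]
  by unfold_locales (auto simp: alg_closure_power_card_add power_mult_distrib)

text \<open>The roots of a polynomial over the base field are closed under Frobenius. If
  \<open>x\<close> has no period shorter than \<open>n\<close>, its conjugates
  \<open>x ^ (q ^ i)\<close> with \<open>i < n\<close> are distinct roots of
  \<open>a\<close>.\<close>

lemma alg_closure_root_degree:
  fixes x :: "'a :: {field, finite} alg_closure" and a :: "'a poly"
  assumes x: "\<And>d. 0 < d \<Longrightarrow> d < n \<Longrightarrow> x ^ (CARD('a) ^ d) \<noteq> x"
    and a: "a \<noteq> 0" "poly (map_poly to_ac a) x = 0"
  shows "n \<le> degree a"
proof -
  let ?q = "CARD('a)"
  interpret to_ac: inj_comm_ring_hom "to_ac :: 'a \<Rightarrow> 'a alg_closure"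
    by unfold_locales auto
  interpret frob: comm_ring_hom "\<lambda>x :: 'a alg_closure. x ^ ?q"
    by (rule comm_ring_hom_power_card)
  let ?A = "map_poly to_ac a :: 'a alg_closure poly"
  have fix_A: "map_poly (\<lambda>x. x ^ ?q) ?A = ?A"
    by (rule poly_eqI) (simp add: coeff_map_poly field_power_card_eq_same flip: to_ac_power)
  have step: "poly ?A (y ^ ?q) = poly ?A y ^ ?q" for y
    using frob.poly_map_poly[of ?A y] by (simp add: fix_A)
  have roots: "poly ?A (x ^ (?q ^ i)) = 0" for i
  proof (induction i)
    case (Suc i)
    then show ?case
      using step[of "x ^ (?q ^ i)"] card_field_ge_2[where ?'a = 'a]
      by (simp add: mult.commute flip: power_mult)
  qed (use a in simp)
  have neq: "x ^ (?q ^ i) \<noteq> x ^ (?q ^ j)" if "i < j" "j < n" for i j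
  proof
    assume "x ^ (?q ^ i) = x ^ (?q ^ j)"
    then have "(x ^ (?q ^ (j - i))) ^ (?q ^ i) = x ^ (?q ^ i)"
      using that by (simp flip: power_mult power_add)
    then show False
      using alg_closure_power_card_power_inj[of "x ^ (?q ^ (j - i))" i x] x[of "j - i"] that by auto
  qed
  have inj: "inj_on (\<lambda>i. x ^ (?q ^ i)) {..<n}"
    by (rule linorder_inj_onI') (use neq in auto)
  have "n = card ((\<lambda>i. x ^ (?q ^ i)) ` {..<n})" using inj by (simp add: card_image)
  also have "\<dots> \<le> card {y. poly ?A y = 0}"
    by (rule card_mono) (use a roots in \<open>auto intro: poly_roots_finite\<close>)
  also have "\<dots> \<le> degree ?A" by (rule card_poly_roots_bound) (use a in simp)
  finally show ?thesis by simp
qed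

text \<open>The roots of the polynomial are the Frobenius conjugates of an element of degree \<open>n\<close>.\<close>
theorem exists_monic_irreducible_poly:
  assumes "0 < n"
  shows "\<exists>p :: 'a :: {field, finite} poly. monic p \<and> degree p = n \<and> irreducible p"
proof -
  let ?q = "CARD('a)"
  interpret to_ac: inj_comm_ring_hom "to_ac :: 'a \<Rightarrow> 'a alg_closure"
    by unfold_locales auto
  interpret frob: comm_ring_hom "\<lambda>x :: 'a alg_closure. x ^ ?q"
    by (rule comm_ring_hom_power_card)
  interpret to_ac_poly: map_poly_comm_ring_hom "to_ac :: 'a \<Rightarrow> 'a alg_closure" ..
  interpret frob_poly: map_poly_comm_ring_hom "\<lambda>x :: 'a alg_closure. x ^ ?q" ..
  obtain x :: "'a alg_closure" where x: "x ^ (?q ^ n) = x"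
    and x': "\<And>d. 0 < d \<Longrightarrow> d < n \<Longrightarrow> x ^ (?q ^ d) \<noteq> x"
    using exists_alg_closure_degree[OF assms, where ?'a = 'a] by blast
  define P where "P = (\<Prod>i<n. [:- (x ^ (?q ^ i)), 1:])"
  \<comment> \<open>Frobenius moves each factor of \<open>P\<close> to the next one, and the last to
    the first since \<open>x ^ (q ^ n) = x\<close>. So the coefficients of \<open>P\<close> are
    fixed by Frobenius.\<close>
  have "map_poly (\<lambda>x. x ^ ?q) P = (\<Prod>i<n. [:- (x ^ (?q ^ Suc i)), 1:])"
    using card_field_ge_2[where ?'a = 'a] unfolding P_def frob_poly.hom_prod
    by (intro prod.cong refl) (simp add: frob.hom_uminus mult.commute flip: power_mult)
  also have "\<dots> = (\<Prod>i\<in>{1..n}. [:- (x ^ (?q ^ i)), 1:])"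
    by (rule prod.reindex_bij_witness[of _ "\<lambda>i. i - 1" Suc]) auto
  also have "\<dots> = (\<Prod>i\<in>{1..<n}. [:- (x ^ (?q ^ i)), 1:]) * [:- x, 1:]"
  proof -
    have "{1..n} = insert n {1..<n}" using assms by auto
    then show ?thesis by (simp add: x mult.commute)
  qed
  also have "\<dots> = P"
  proof -
    have "{..<n} = insert 0 {1..<n}" using assms by auto
    then show ?thesis by (simp add: P_def mult.commute)
  qed
  finally have "map_poly (\<lambda>x. x ^ ?q) P = P" .
  from arg_cong[OF this, of "\<lambda>P. coeff P i" for i] have "coeff P i ^ ?q = coeff P i" for i
    using card_field_ge_2[where ?'a = 'a] by (simp add: coeff_map_poly)
  then have "coeff P i \<in> range to_ac" for i by (rule alg_closure_power_card_fixed)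
  then have lift: "map_poly to_ac (map_poly of_ac P) = P"
    by (intro poly_eqI) (simp add: coeff_map_poly to_ac_of_ac)
  define p where "p = map_poly of_ac P"
  have P: "monic P" "degree P = n" "poly P x = 0"
  proof -
    show "monic P" unfolding P_def by (subst lead_coeff_prod) simp
    show "degree P = n" by (simp add: P_def degree_prod_eq_sum_degree)
    show "poly P x = 0" using assms by (auto simp: P_def poly_prod intro!: bexI[of _ 0])
  qed
  have p: "map_poly to_ac p = P" "degree p = n"
  proof -
    show *: "map_poly to_ac p = P" unfolding p_def by (rule lift)
    show "degree p = n" using P(2) unfolding *[symmetric] by simp
  qed
  have "to_ac (lead_coeff p) = 1" using P(1,2) p by (metis to_ac.coeff_map_poly_hom)
  then have monic: "monic p" by simp
  have "irreducible\<^sub>d p"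
  proof (rule irreducible\<^sub>dI)
    fix a b :: "'a poly"
    assume ab: "degree a < degree p" "degree b < degree p" "p = a * b"
    \<comment> \<open>One of the two factors has the root \<open>x\<close>, which forces its degree
      to be at least \<open>n\<close>.\<close>
    have "poly (map_poly to_ac a) x * poly (map_poly to_ac b) x = 0"
      using P(3) ab(3) p(1) by (simp add: to_ac_poly.hom_mult flip: poly_mult)
    moreover have "a \<noteq> 0" "b \<noteq> 0" using ab p(2) monic assms by auto
    ultimately show False
      using alg_closure_root_degree[OF x', of n a] alg_closure_root_degree[OF x', of n b] ab p(2)
      by auto
  qed (use p assms in simp)
  then show ?thesis using monic p(2) by auto
qed

section \<open>Krylov sequences and cyclic vectors\<close>

text \<open>A family of vectors is a function on the naturals of which only the first
  \<open>k\<close> values count. Its indices then agree with the powers of a matrix and with the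
  coefficients of a polynomial, and a family is extended by a function update.\<close>

definition lin_comb :: "nat \<Rightarrow> (nat \<Rightarrow> 'a :: comm_ring_1 vec) \<Rightarrow> (nat \<Rightarrow> 'a) \<Rightarrow> nat \<Rightarrow> 'a vec" where
  "lin_comb n p a k = vec n (\<lambda>i. \<Sum>j<k. a j * p j $ i)"

definition indep :: "nat \<Rightarrow> (nat \<Rightarrow> 'a :: comm_ring_1 vec) \<Rightarrow> nat \<Rightarrow> bool" where
  "indep n p k \<longleftrightarrow> (\<forall>a. lin_comb n p a k = 0\<^sub>v n \<longrightarrow> (\<forall>j<k. a j = 0))"

definition col_mat :: "nat \<Rightarrow> (nat \<Rightarrow> 'a vec) \<Rightarrow> 'a mat" where
  "col_mat n p = mat n n (\<lambda>(i, j). p j $ i)"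

definition krylov :: "'a :: comm_ring_1 mat \<Rightarrow> 'a vec \<Rightarrow> nat \<Rightarrow> 'a vec" where
  "krylov A v k = ((*\<^sub>v) A ^^ k) v"

definition cyclic :: "'a :: comm_ring_1 mat \<Rightarrow> 'a vec \<Rightarrow> bool" where
  "cyclic A v \<longleftrightarrow> indep (dim_row A) (krylov A v) (dim_row A)"

text \<open>This is the vector \<open>p(A) v\<close>. Vectors are acted on directly, so the matrix
  \<open>p(A)\<close> is never formed.\<close>

definition poly_act :: "'a :: comm_ring_1 mat \<Rightarrow> 'a poly \<Rightarrow> 'a vec \<Rightarrow> 'a vec" where
  "poly_act A p v = lin_comb (dim_row A) (krylov A v) (coeff p) (Suc (degree p))"

lemma mult_mat_vec_index_sum:
  assumes "A \<in> carrier_mat n m" "v \<in> carrier_vec m" "i < n"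
  shows "(A *\<^sub>v v) $ i = (\<Sum>j<m. A $$ (i, j) * v $ j)"
  using assms by (auto simp: scalar_prod_def atLeast0LessThan intro!: sum.cong)

lemma lin_comb_carrier [simp]: "lin_comb n p a k \<in> carrier_vec n"
  by (simp add: lin_comb_def)

lemma lin_comb_cong:
  assumes "\<And>j. j < k \<Longrightarrow> p j = p' j" "\<And>j. j < k \<Longrightarrow> a j = a' j"
  shows "lin_comb n p a k = lin_comb n p' a' k"
  using assms by (auto simp: lin_comb_def intro!: sum.cong)

lemma indep_cong:
  assumes "\<And>j. j < k \<Longrightarrow> p j = p' j"
  shows "indep n p k \<longleftrightarrow> indep n p' k"
  using lin_comb_cong[OF assms] by (simp add: indep_def)

lemma col_mat_carrier [simp]: "col_mat n p \<in> carrier_mat n n"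
  by (simp add: col_mat_def)

lemma dim_col_mat [simp]: "dim_row (col_mat n p) = n" "dim_col (col_mat n p) = n"
  by (simp_all add: col_mat_def)

lemma col_col_mat:
  assumes "p j \<in> carrier_vec n" "j < n"
  shows "col (col_mat n p) j = p j"
  using assms by (intro eq_vecI) (auto simp: col_mat_def)

lemma col_mat_mult_vec:
  assumes "v \<in> carrier_vec n"
  shows "col_mat n p *\<^sub>v v = lin_comb n p (($) v) n"
  using assms
  by (intro eq_vecI)
    (auto simp: lin_comb_def mult_mat_vec_index_sum[of _ n n] col_mat_def mult.commute
      simp del: index_mult_mat_vec intro!: sum.cong)

lemma mult_lin_comb:
  assumes "A \<in> carrier_mat m n" "\<And>j. j < k \<Longrightarrow> p j \<in> carrier_vec n"
  shows "A *\<^sub>v lin_comb n p a k = lin_comb m (\<lambda>j. A *\<^sub>v p j) a k"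
proof (intro eq_vecI)
  fix i assume "i < dim_vec (lin_comb m (\<lambda>j. A *\<^sub>v p j) a k)"
  then have i: "i < m" by (simp add: lin_comb_def)
  have "(A *\<^sub>v lin_comb n p a k) $ i = (\<Sum>l<n. A $$ (i, l) * (\<Sum>j<k. a j * p j $ l))"
    using assms i by (subst mult_mat_vec_index_sum[of _ m n]) (auto simp: lin_comb_def)
  also have "\<dots> = (\<Sum>l<n. \<Sum>j<k. a j * (A $$ (i, l) * p j $ l))"
    by (simp add: sum_distrib_left algebra_simps)
  also have "\<dots> = (\<Sum>j<k. a j * (\<Sum>l<n. A $$ (i, l) * p j $ l))"
    by (subst sum.swap) (simp add: sum_distrib_left)
  also have "\<dots> = lin_comb m (\<lambda>j. A *\<^sub>v p j) a k $ i"
    using assms i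
    by (auto simp: lin_comb_def mult_mat_vec_index_sum[of _ m n] simp del: index_mult_mat_vec
        intro!: sum.cong)
  finally show "(A *\<^sub>v lin_comb n p a k) $ i = lin_comb m (\<lambda>j. A *\<^sub>v p j) a k $ i" .
qed (use assms in \<open>simp add: lin_comb_def\<close>)

lemma indep_det:
  fixes p :: "nat \<Rightarrow> 'a :: field vec"
  shows "indep n p n \<longleftrightarrow> det (col_mat n p) \<noteq> 0"
proof -
  have "(\<exists>v \<in> carrier_vec n. v \<noteq> 0\<^sub>v n \<and> col_mat n p *\<^sub>v v = 0\<^sub>v n) \<longleftrightarrow> \<not> indep n p n"
  proof
    assume "\<exists>v \<in> carrier_vec n. v \<noteq> 0\<^sub>v n \<and> col_mat n p *\<^sub>v v = 0\<^sub>v n"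
    then obtain v where v: "v \<in> carrier_vec n" "v \<noteq> 0\<^sub>v n" "lin_comb n p (($) v) n = 0\<^sub>v n"
      by (auto simp: col_mat_mult_vec)
    from v(1,2) obtain j where "j < n" "v $ j \<noteq> 0"
      by (metis carrier_vecD eq_vecI index_zero_vec)
    with v show "\<not> indep n p n" unfolding indep_def by blast
  next
    assume "\<not> indep n p n"
    then obtain a j where a: "lin_comb n p a n = 0\<^sub>v n" "j < n" "a j \<noteq> 0"
      by (auto simp: indep_def)
    have "col_mat n p *\<^sub>v vec n a = 0\<^sub>v n"
      unfolding col_mat_mult_vec[OF vec_carrier] a(1)[symmetric] by (rule lin_comb_cong) auto
    moreover have "vec n a \<noteq> 0\<^sub>v n" using a(2,3) by (metis index_vec index_zero_vec(1))
    ultimately show "\<exists>v \<in> carrier_vec n. v \<noteq> 0\<^sub>v n \<and> col_mat n p *\<^sub>v v = 0\<^sub>v n"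
      by (intro bexI[of _ "vec n a"]) auto
  qed
  then show ?thesis using det_0_iff_vec_prod_zero[OF col_mat_carrier, of n p] by auto
qed

lemma det_nonzero_inverse:
  fixes A :: "'a :: field mat"
  assumes "A \<in> carrier_mat n n" "det A \<noteq> 0"
  obtains B where "B \<in> carrier_mat n n" "A * B = 1\<^sub>m n" "B * A = 1\<^sub>m n"
proof
  let ?B = "inverse (det A) \<cdot>\<^sub>m adj_mat A"
  note adj = adj_mat[OF assms(1)]
  show "?B \<in> carrier_mat n n" using adj by simp
  show "A * ?B = 1\<^sub>m n"
    using adj assms by (subst mult_smult_distrib[of _ n n _ n]) auto
  show "?B * A = 1\<^sub>m n"
    using adj assms by (subst mult_smult_assoc_mat[of _ n n _ n]) auto
qed

lemma lin_comb_Suc: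
  assumes "p k \<in> carrier_vec n"
  shows "lin_comb n p a (Suc k) = lin_comb n p a k + a k \<cdot>\<^sub>v p k"
proof (intro eq_vecI)
  fix i assume "i < dim_vec (lin_comb n p a k + a k \<cdot>\<^sub>v p k)"
  then have "i < n" using assms by simp
  then show "lin_comb n p a (Suc k) $ i = (lin_comb n p a k + a k \<cdot>\<^sub>v p k) $ i"
    using carrier_vecD[OF assms] by (simp add: lin_comb_def)
qed (use carrier_vecD[OF assms] in \<open>simp add: lin_comb_def\<close>)

lemma indep_Suc:
  fixes p :: "nat \<Rightarrow> 'a :: field vec"
  assumes "indep n p k" "p k \<in> carrier_vec n" "\<And>a. p k \<noteq> lin_comb n p a k"
  shows "indep n p (Suc k)"
  unfolding indep_def
proof (intro allI impI)
  fix a j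
  assume a: "lin_comb n p a (Suc k) = 0\<^sub>v n" and j: "j < Suc k"
  have eq: "(\<Sum>j<k. a j * p j $ i) + a k * p k $ i = 0" if "i < n" for i
    using arg_cong[OF a, of "\<lambda>v. v $ i"] that by (simp add: lin_comb_def)
  have "a k = 0"
  proof (rule ccontr)
    assume ak: "a k \<noteq> 0"
    have "p k = lin_comb n p (\<lambda>j. - a j / a k) k"
    proof (intro eq_vecI)
      fix i assume "i < dim_vec (lin_comb n p (\<lambda>j. - a j / a k) k)"
      then have i: "i < n" by (simp add: lin_comb_def)
      have "p k $ i = - (\<Sum>j<k. a j * p j $ i) / a k"
        using eq[OF i] ak by (simp add: field_simps eq_neg_iff_add_eq_0 add.commute)
      also have "\<dots> = (\<Sum>j<k. - a j / a k * p j $ i)"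
        by (simp add: sum_divide_distrib sum_negf)
      finally show "p k $ i = lin_comb n p (\<lambda>j. - a j / a k) k $ i"
        using i by (simp add: lin_comb_def)
    qed (use assms in \<open>simp add: lin_comb_def\<close>)
    with assms(3) show False by blast
  qed
  moreover from this a have "lin_comb n p a k = 0\<^sub>v n"
    by (simp add: lin_comb_def)
  ultimately show "a j = 0"
    using assms(1)[unfolded indep_def, rule_format, of a j] j by (cases "j = k") auto
qed

lemma krylov_0 [simp]: "krylov A v 0 = v"
  and krylov_Suc [simp]: "krylov A v (Suc k) = A *\<^sub>v krylov A v k"
  by (simp_all add: krylov_def)

lemma krylov_Suc2: "krylov A v (Suc k) = krylov A (A *\<^sub>v v) k"
  by (simp add: krylov_def funpow_swap1)

lemma krylov_carrier [simp]:
  assumes "A \<in> carrier_mat n n" "v \<in> carrier_vec n"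
  shows "krylov A v k \<in> carrier_vec n"
  using assms by (induction k) auto

lemma krylov_add:
  assumes "A \<in> carrier_mat n n" "v \<in> carrier_vec n" "w \<in> carrier_vec n"
  shows "krylov A (v + w) k = krylov A v k + krylov A w k"
  using assms by (induction k) (auto simp: mult_add_distrib_mat_vec[of _ n n])

lemma krylov_smult:
  assumes A: "A \<in> carrier_mat n n" and v: "v \<in> carrier_vec n"
  shows "krylov A (a \<cdot>\<^sub>v v) k = a \<cdot>\<^sub>v krylov A v k"
proof (induction k)
  case (Suc k)
  have w: "krylov A v k \<in> carrier_vec n" using A v by simp
  then have "A *\<^sub>v (a \<cdot>\<^sub>v krylov A v k) = a \<cdot>\<^sub>v (A *\<^sub>v krylov A v k)"
    using A carrier_vecD[OF w] by (intro eq_vecI) auto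
  then show ?case using Suc by simp
qed simp

lemma poly_act_carrier [simp]: "A \<in> carrier_mat n n \<Longrightarrow> poly_act A p v \<in> carrier_vec n"
  by (simp add: poly_act_def lin_comb_def)

lemma poly_act_eq_lin_comb:
  assumes "A \<in> carrier_mat n n" "degree p < k"
  shows "poly_act A p v = lin_comb n (krylov A v) (coeff p) k"
proof -
  have "(\<Sum>j<Suc (degree p). coeff p j * krylov A v j $ i) = (\<Sum>j<k. coeff p j * krylov A v j $ i)" for i
    by (rule sum.mono_neutral_left) (use assms in \<open>auto simp: coeff_eq_0 not_less\<close>)
  then show ?thesis using assms by (simp add: poly_act_def lin_comb_def del: sum.lessThan_Suc)
qed

lemma poly_act_add:
  assumes "A \<in> carrier_mat n n"
  shows "poly_act A (p + q) v = poly_act A p v + poly_act A q v"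
proof -
  let ?k = "Suc (max (degree p) (degree q))"
  have "degree (p + q) < ?k" "degree p < ?k" "degree q < ?k"
    by (auto simp: degree_add_le_max less_Suc_eq_le)
  then show ?thesis
    by (subst (1 2 3) poly_act_eq_lin_comb[OF assms, of _ ?k])
      (auto simp: lin_comb_def algebra_simps sum.distrib simp del: sum.lessThan_Suc intro!: eq_vecI)
qed

lemma poly_act_smult:
  assumes "A \<in> carrier_mat n n"
  shows "poly_act A (Polynomial.smult a p) v = a \<cdot>\<^sub>v poly_act A p v"
  using assms
  by (subst (1 2) poly_act_eq_lin_comb[OF assms, of _ "Suc (degree p)"])
    (auto simp: lin_comb_def algebra_simps sum_distrib_left less_Suc_eq_le degree_smult_le
      simp del: sum.lessThan_Suc intro!: eq_vecI)

lemma poly_act_0 [simp]: "A \<in> carrier_mat n n \<Longrightarrow> poly_act A 0 v = 0\<^sub>v n"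
  by (auto simp: poly_act_def lin_comb_def)

lemma poly_act_pCons:
  assumes "A \<in> carrier_mat n n" "v \<in> carrier_vec n"
  shows "poly_act A (pCons a p) v = a \<cdot>\<^sub>v v + A *\<^sub>v poly_act A p v"
proof -
  let ?k = "Suc (degree p)"
  have "degree (pCons a p) < Suc ?k" by (simp add: degree_pCons_eq_if)
  then have "poly_act A (pCons a p) v = lin_comb n (krylov A v) (coeff (pCons a p)) (Suc ?k)"
    by (rule poly_act_eq_lin_comb[OF assms(1)])
  also have "\<dots> = a \<cdot>\<^sub>v v + lin_comb n (\<lambda>j. A *\<^sub>v krylov A v j) (coeff p) ?k"
    using assms(2)
    by (intro eq_vecI)
      (auto simp: lin_comb_def sum.lessThan_Suc_shift simp del: sum.lessThan_Suc)
  also have "lin_comb n (\<lambda>j. A *\<^sub>v krylov A v j) (coeff p) ?k = A *\<^sub>v poly_act A p v"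
    using assms by (simp add: poly_act_def mult_lin_comb[of _ n n])
  finally show ?thesis .
qed

lemma mult_mat_zero_vec [simp]: "A \<in> carrier_mat m n \<Longrightarrow> A *\<^sub>v 0\<^sub>v n = (0\<^sub>v m :: 'a :: comm_ring_1 vec)"
  by (intro eq_vecI) auto

lemma poly_act_linear:
  assumes "A \<in> carrier_mat n n" "v \<in> carrier_vec n"
  shows "poly_act A [:a, 1:] v = A *\<^sub>v v + a \<cdot>\<^sub>v v"
proof -
  have "poly_act A [:a, 1:] v = a \<cdot>\<^sub>v v + A *\<^sub>v (1 \<cdot>\<^sub>v v + A *\<^sub>v 0\<^sub>v n)"
    using assms by (simp add: poly_act_pCons[of _ n] one_pCons)
  also have "1 \<cdot>\<^sub>v v + A *\<^sub>v 0\<^sub>v n = v" using assms by auto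
  finally show ?thesis using assms by (simp add: comm_add_vec[of _ n])
qed

lemma poly_act_mult:
  assumes "A \<in> carrier_mat n n" "v \<in> carrier_vec n"
  shows "poly_act A (p * q) v = poly_act A p (poly_act A q v)"
proof (induction p)
  case (pCons a p)
  have "poly_act A (pCons a p * q) v = a \<cdot>\<^sub>v poly_act A q v + poly_act A (pCons 0 (p * q)) v"
    using assms by (simp add: poly_act_add[of _ n] poly_act_smult[of _ n])
  also have "poly_act A (pCons 0 (p * q)) v = A *\<^sub>v poly_act A p (poly_act A q v)"
    using assms by (auto simp: poly_act_pCons pCons.IH intro!: eq_vecI)
  finally show ?case using assms by (simp add: poly_act_pCons[of _ n])
qed (use assms in simp)

lemma poly_act_add_vec:
  assumes "A \<in> carrier_mat n n" "v \<in> carrier_vec n" "w \<in> carrier_vec n"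
  shows "poly_act A p (v + w) = poly_act A p v + poly_act A p w"
  using assms
  by (auto simp: poly_act_def lin_comb_def krylov_add[of _ n] algebra_simps sum.distrib
      index_add_vec(1) carrier_vecD[OF krylov_carrier[of _ n]]
      simp del: sum.lessThan_Suc intro!: eq_vecI)

lemma poly_act_zero_vec:
  assumes "A \<in> carrier_mat n n"
  shows "poly_act A p (0\<^sub>v n) = 0\<^sub>v n"
proof -
  have "krylov A (0\<^sub>v n) k = 0\<^sub>v n" for k
    using assms by (induction k) auto
  then show ?thesis using assms by (auto simp: poly_act_def lin_comb_def intro!: eq_vecI)
qed

section \<open>Counting vectors and matrices; extension to a basis\<close>

lemma card_carrier_vec: "card (carrier_vec n :: 'a :: finite vec set) = CARD('a) ^ n"
proof -
  have "bij_betw (vec n) ({..<n} \<rightarrow>\<^sub>E (UNIV :: 'a set)) (carrier_vec n)"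
  proof (rule bij_betw_byWitness[where f' = "\<lambda>v. restrict (($) v) {..<n}"])
    show "\<forall>a\<in>{..<n} \<rightarrow>\<^sub>E UNIV. restrict (($) (vec n a)) {..<n} = (a :: nat \<Rightarrow> 'a)"
      by (simp add: restrict_def PiE_iff extensional_def fun_eq_iff)
    show "\<forall>v\<in>carrier_vec n. vec n (restrict (($) v) {..<n}) = (v :: 'a vec)"
      by (simp add: vec_eq_iff)
  qed (simp_all add: image_subset_iff)
  from bij_betw_same_card[OF this] show ?thesis by (simp add: card_PiE)
qed

lemma card_carrier_mat: "card (carrier_mat n m :: 'a :: finite mat set) = CARD('a) ^ (n * m)"
proof -
  let ?S = "{..<n} \<times> {..<m}"
  have "bij_betw (mat n m) (?S \<rightarrow>\<^sub>E (UNIV :: 'a set)) (carrier_mat n m)"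
  proof (rule bij_betw_byWitness[where f' = "\<lambda>A. restrict (($$) A) ?S"])
    show "\<forall>a\<in>?S \<rightarrow>\<^sub>E UNIV. restrict (($$) (mat n m a)) ?S = (a :: nat \<times> nat \<Rightarrow> 'a)"
      by (simp add: restrict_def PiE_iff extensional_def fun_eq_iff)
    show "\<forall>A\<in>carrier_mat n m. mat n m (restrict (($$) A) ?S) = (A :: 'a mat)"
      by (simp add: mat_eq_iff)
  qed (simp_all add: image_subset_iff)
  from bij_betw_same_card[OF this] show ?thesis by (simp add: card_PiE card_cartesian_product)
qed

lemma finite_carrier_vec [simp]: "finite (carrier_vec n :: 'a :: finite vec set)"
  by (rule card_ge_0_finite) (simp add: card_carrier_vec)

text \<open>There are only q^k choices of coefficients but q^n vectors; this count takes the place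
  of dimension theory.\<close>

lemma exists_not_lin_comb:
  fixes p :: "nat \<Rightarrow> 'a :: {field, finite} vec"
  assumes "k < n"
  shows "\<exists>u \<in> carrier_vec n. \<forall>a. u \<noteq> lin_comb n p a k"
proof (rule ccontr)
  assume *: "\<not> ?thesis"
  have "carrier_vec n \<subseteq> (\<lambda>a. lin_comb n p a k) ` ({..<k} \<rightarrow>\<^sub>E UNIV)"
  proof
    fix u :: "'a vec" assume "u \<in> carrier_vec n"
    with * obtain a where "u = lin_comb n p a k" by blast
    also have "\<dots> = lin_comb n p (restrict a {..<k}) k" by (rule lin_comb_cong) auto
    finally show "u \<in> (\<lambda>a. lin_comb n p a k) ` ({..<k} \<rightarrow>\<^sub>E UNIV)" by auto
  qed
  from surj_card_le[OF _ this] have "CARD('a) ^ n \<le> CARD('a) ^ k"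
    by (simp add: card_carrier_vec card_PiE finite_PiE)
  moreover have "1 < CARD('a)"
    using card_mono[of UNIV "{0, 1 :: 'a}"] by simp
  ultimately show False using assms by (simp add: not_le[symmetric])
qed

lemma exists_indep_extension:
  fixes p :: "nat \<Rightarrow> 'a :: {field, finite} vec"
  assumes "indep n p k" "k \<le> n" "\<And>j. j < k \<Longrightarrow> p j \<in> carrier_vec n"
  shows "\<exists>p'. (\<forall>j<k. p' j = p j) \<and> (\<forall>j<n. p' j \<in> carrier_vec n) \<and> indep n p' n"
  using assms
proof (induction "n - k" arbitrary: p k)
  case 0
  then show ?case by (intro exI[of _ p]) auto
next
  case (Suc l)
  then have "k < n" by simp
  from exists_not_lin_comb[OF this, of p] obtain u where
    u: "u \<in> carrier_vec n" "\<And>a. u \<noteq> lin_comb n p a k" by blast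
  let ?p = "p(k := u)"
  have "lin_comb n ?p a k = lin_comb n p a k" for a by (rule lin_comb_cong) auto
  moreover have "indep n ?p k" using indep_cong[of k ?p p n] Suc.prems(1) by simp
  ultimately have "indep n ?p (Suc k)" using u by (intro indep_Suc) auto
  moreover have "l = n - Suc k" "Suc k \<le> n" using Suc.hyps(2) by simp_all
  moreover have "?p j \<in> carrier_vec n" if "j < Suc k" for j
    using that u(1) Suc.prems(3) by (auto simp: less_Suc_eq)
  ultimately obtain p' where p': "\<forall>j<Suc k. p' j = ?p j"
    "\<forall>j<n. p' j \<in> carrier_vec n" "indep n p' n"
    using Suc.hyps(1) by blast
  then show ?case by (intro exI[of _ p']) auto
qed

lemma indep_span:
  fixes p :: "nat \<Rightarrow> 'a :: field vec"
  assumes "indep n p n" "u \<in> carrier_vec n"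
  shows "\<exists>a. u = lin_comb n p a n"
proof -
  from assms(1) have "det (col_mat n p) \<noteq> 0" by (simp add: indep_det)
  from det_nonzero_inverse[OF col_mat_carrier this] obtain B where
    B: "B \<in> carrier_mat n n" "col_mat n p * B = 1\<^sub>m n" by metis
  have "u = (col_mat n p * B) *\<^sub>v u" using assms(2) B by simp
  also have "\<dots> = col_mat n p *\<^sub>v (B *\<^sub>v u)"
    using B assms(2) by (intro assoc_mult_mat_vec[of _ n n _ n]) auto
  also have "\<dots> = lin_comb n p (($) (B *\<^sub>v u)) n"
    using B assms(2) by (simp add: col_mat_mult_vec)
  finally show ?thesis by blast
qed

section \<open>The Cayley-Hamilton theorem and annihilating polynomials\<close>

lemma dim_char_poly_matrix [simp]:
  "dim_row (char_poly_matrix A) = dim_row A" "dim_col (char_poly_matrix A) = dim_col A"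
  by (simp_all add: char_poly_matrix_def)

lemma char_poly_matrix_index:
  assumes "A \<in> carrier_mat n n" "i < n" "j < n"
  shows "char_poly_matrix A $$ (i, j) = (if i = j then [:0, 1:] else 0) - [:A $$ (i, j):]"
  using assms by (auto simp: char_poly_matrix_def)

text \<open>This is the entry (i, k) of \<open>(T - A) adj(T - A) = char_poly A\<close>, solved for
  the term with T. It serves both the Cayley-Hamilton theorem and pole placement.\<close>

lemma adj_char_poly_matrix:
  fixes A :: "'a :: comm_ring_1 mat"
  assumes A: "A \<in> carrier_mat n n" and ik: "i < n" "k < n"
  shows "[:0, 1:] * adj_mat (char_poly_matrix A) $$ (i, k) =
    (\<Sum>j<n. [:A $$ (i, j):] * adj_mat (char_poly_matrix A) $$ (j, k)) +
    (if i = k then char_poly A else 0)"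
proof -
  let ?M = "char_poly_matrix A" and ?T = "[:0, 1:] :: 'a poly"
  have M: "?M \<in> carrier_mat n n" using A by simp
  note adj = adj_mat[OF M]
  have "(if i = k then char_poly A else 0) = (?M * adj_mat ?M) $$ (i, k)"
    using ik by (simp add: adj char_poly_def)
  also have "\<dots> = (\<Sum>j<n. ?M $$ (i, j) * adj_mat ?M $$ (j, k))"
    using A adj(1) ik by (auto simp: scalar_prod_def atLeast0LessThan intro!: sum.cong)
  also have "\<dots> = (\<Sum>j<n. (if j = i then ?T * adj_mat ?M $$ (j, k) else 0)
      - [:A $$ (i, j):] * adj_mat ?M $$ (j, k))"
    using ik by (intro sum.cong refl) (auto simp: char_poly_matrix_index[OF A] algebra_simps)
  also have "\<dots> = ?T * adj_mat ?M $$ (i, k) - (\<Sum>j<n. [:A $$ (i, j):] * adj_mat ?M $$ (j, k))"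
    using ik by (simp add: sum_subtractf)
  finally show ?thesis by (simp add: algebra_simps)
qed

text \<open>
  The coefficient vectors \<open>U s\<close> of \<open>adj (T - A) c\<close> satisfy \<open>U (s - 1) - A (U s) = p\<^sub>s c\<close>, where \<open>p\<close> is
  the characteristic polynomial, so the sum of the \<open>p\<^sub>s A\<^bsup>s\<^esup> c\<close> telescopes.
\<close>
theorem cayley_hamilton:
  fixes A :: "'a :: comm_ring_1 mat"
  assumes A: "A \<in> carrier_mat n n" and c: "c \<in> carrier_vec n"
  shows "poly_act A (char_poly A) c = 0\<^sub>v n"
proof -
  define u where "u = (\<lambda>i k. adj_mat (char_poly_matrix A) $$ (i, k))"
  define U where "U s = vec n (\<lambda>i. \<Sum>k<n. coeff (u i k) s * c $ k)" for s
  have U: "U s \<in> carrier_vec n" for s by (simp add: U_def)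
  have AU: "(A *\<^sub>v U s) $ i = (\<Sum>k<n. coeff (\<Sum>j<n. [:A $$ (i, j):] * u j k) s * c $ k)"
    if i: "i < n" for s i
  proof -
    have "(A *\<^sub>v U s) $ i = (\<Sum>j<n. A $$ (i, j) * (\<Sum>k<n. coeff (u j k) s * c $ k))"
      using i by (subst mult_mat_vec_index_sum[OF A U]) (auto simp: U_def)
    also have "\<dots> = (\<Sum>j<n. \<Sum>k<n. A $$ (i, j) * coeff (u j k) s * c $ k)"
      by (simp add: sum_distrib_left mult.assoc)
    also have "\<dots> = (\<Sum>k<n. (\<Sum>j<n. A $$ (i, j) * coeff (u j k) s) * c $ k)"
      by (subst sum.swap) (simp add: sum_distrib_right)
    also have "\<dots> = (\<Sum>k<n. coeff (\<Sum>j<n. [:A $$ (i, j):] * u j k) s * c $ k)"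
      by (simp add: coeff_sum)
    finally show ?thesis .
  qed
  have main: "(\<Sum>k<n. coeff ([:0, 1:] * u i k) s * c $ k) = (A *\<^sub>v U s) $ i + coeff (char_poly A) s * c $ i"
    if i: "i < n" for i s
  proof -
    have coeff: "coeff ([:0, 1:] * u i k) s = coeff (\<Sum>j<n. [:A $$ (i, j):] * u j k) s
        + (if i = k then coeff (char_poly A) s else 0)" if k: "k < n" for k
      unfolding u_def adj_char_poly_matrix[OF A i k] coeff_add by simp
    have "(\<Sum>k<n. coeff ([:0, 1:] * u i k) s * c $ k) =
        (\<Sum>k<n. coeff (\<Sum>j<n. [:A $$ (i, j):] * u j k) s * c $ k
          + (if k = i then coeff (char_poly A) s * c $ k else 0))"
      by (intro sum.cong refl) (simp only: coeff lessThan_iff, simp add: algebra_simps)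
    also have "\<dots> = (A *\<^sub>v U s) $ i + coeff (char_poly A) s * c $ i"
      unfolding AU[OF i] sum.distrib using i by simp
    finally show ?thesis .
  qed
  have U0: "coeff (char_poly A) 0 \<cdot>\<^sub>v c = - (A *\<^sub>v U 0)"
  proof (rule eq_vecI)
    fix i assume "i < dim_vec (- (A *\<^sub>v U 0))"
    then have i: "i < n" using A by simp
    from main[OF i, of 0] have "coeff (char_poly A) 0 * c $ i = - (A *\<^sub>v U 0) $ i"
      by (simp add: eq_neg_iff_add_eq_0 add.commute)
    then show "(coeff (char_poly A) 0 \<cdot>\<^sub>v c) $ i = (- (A *\<^sub>v U 0)) $ i"
      using i c A carrier_vecD[OF c] by (simp del: index_mult_mat_vec)
  qed (use A c in auto)
  have US: "U s = A *\<^sub>v U (Suc s) + coeff (char_poly A) (Suc s) \<cdot>\<^sub>v c" for s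
  proof (rule eq_vecI)
    fix i assume "i < dim_vec (A *\<^sub>v U (Suc s) + coeff (char_poly A) (Suc s) \<cdot>\<^sub>v c)"
    then have i: "i < n" using A c by simp
    from main[OF i, of "Suc s"] show "U s $ i = (A *\<^sub>v U (Suc s) + coeff (char_poly A) (Suc s) \<cdot>\<^sub>v c) $ i"
      using i A carrier_vecD[OF c] by (simp add: U_def del: index_mult_mat_vec)
  qed (use A c in \<open>auto simp: U_def\<close>)
  have sum: "lin_comb n (krylov A c) (coeff (char_poly A)) (Suc s) = - krylov A (U s) (Suc s)" for s
  proof (induction s)
    case 0
    then show ?case using U0 c A
      by (subst lin_comb_Suc) (auto simp: lin_comb_def)
  next
    case (Suc s)
    have K: "krylov A v k \<in> carrier_vec n" if "v \<in> carrier_vec n" for v k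
      using A that by simp
    have "krylov A (U s) (Suc s) = krylov A (A *\<^sub>v U (Suc s)) (Suc s) +
       krylov A (coeff (char_poly A) (Suc s) \<cdot>\<^sub>v c) (Suc s)"
      by (subst US, rule krylov_add[of _ n]) (use A c U in auto)
    also have "krylov A (coeff (char_poly A) (Suc s) \<cdot>\<^sub>v c) (Suc s) =
       coeff (char_poly A) (Suc s) \<cdot>\<^sub>v krylov A c (Suc s)"
      by (rule krylov_smult) (use A c in auto)
    also have "krylov A (A *\<^sub>v U (Suc s)) (Suc s) = krylov A (U (Suc s)) (Suc (Suc s))"
      by (simp only: krylov_Suc2)
    finally have "krylov A (U s) (Suc s) = krylov A (U (Suc s)) (Suc (Suc s)) +
       coeff (char_poly A) (Suc s) \<cdot>\<^sub>v krylov A c (Suc s)" .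
    then show ?case
      using K[OF U, of "Suc s" "Suc (Suc s)"] K[OF c, of "Suc s"]
      by (subst lin_comb_Suc) (auto simp: Suc.IH simp del: krylov_Suc intro!: eq_vecI)
  qed
  \<comment> \<open>Beyond all degrees in the adjugate \<open>U N\<close> vanishes, and beyond the
    degree of the characteristic polynomial the partial sum is the whole one; \<open>N\<close>
    exceeds both. For \<open>n = 0\<close> the \<open>Max\<close> is unspecified, but then there is
    no degree to bound.\<close>
  define N where "N = Suc (Max ((\<lambda>(i, k). degree (u i k)) ` ({..<n} \<times> {..<n})) + degree (char_poly A))"
  have "degree (u i k) < N" if "i < n" "k < n" for i k
    unfolding N_def less_Suc_eq_le
    by (rule order.trans[OF Max_ge le_add1]) (use that in auto)
  then have "U N = 0\<^sub>v n"
    by (auto simp: U_def coeff_eq_0 intro!: eq_vecI sum.neutral)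
  moreover have "krylov A (0\<^sub>v n) k = 0\<^sub>v n" for k
    using A by (induction k) auto
  ultimately have "lin_comb n (krylov A c) (coeff (char_poly A)) (Suc N) = 0\<^sub>v n"
    using A by (simp add: sum del: krylov_Suc)
  then show ?thesis
    using poly_act_eq_lin_comb[OF A, of "char_poly A" "Suc N"] by (simp add: N_def)
qed

text \<open>The polynomials that annihilate \<open>u\<close> form an ideal. Its generator divides
  the irreducible \<open>s\<close> and is not a unit because \<open>u\<close> is nonzero, so it is
  \<open>s\<close> up to a unit.\<close>

lemma poly_act_eq_0_iff_dvd:
  fixes A :: "'a :: field mat"
  assumes A: "A \<in> carrier_mat n n" and u: "u \<in> carrier_vec n" "u \<noteq> 0\<^sub>v n"
    and s: "irreducible s" "poly_act A s u = 0\<^sub>v n"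
  shows "poly_act A r u = 0\<^sub>v n \<longleftrightarrow> s dvd r"
proof
  assume "s dvd r"
  then obtain t where "r = t * s" by (metis dvdE mult.commute)
  then show "poly_act A r u = 0\<^sub>v n"
    using A u s by (simp add: poly_act_mult[of _ n] poly_act_zero_vec)
next
  assume r: "poly_act A r u = 0\<^sub>v n"
  define Q where "Q p \<longleftrightarrow> p \<noteq> 0 \<and> poly_act A p u = 0\<^sub>v n" for p
  have "Q s" using s by (auto simp: Q_def)
  then obtain p where p: "Q p" "\<And>p'. Q p' \<Longrightarrow> degree p \<le> degree p'"
    using ex_has_least_nat[of Q s degree] by blast
  have dvd: "p dvd t" if "poly_act A t u = 0\<^sub>v n" for t
  proof -
    have "poly_act A t u = poly_act A (t div p) (poly_act A p u) + poly_act A (t mod p) u"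
      using A u by (simp flip: poly_act_mult poly_act_add)
    also have "\<dots> = poly_act A (t mod p) u"
      using p(1) A by (simp add: Q_def poly_act_zero_vec)
    finally have "poly_act A (t mod p) u = 0\<^sub>v n" using that by simp
    then have "t mod p = 0"
      using p(1) p(2)[of "t mod p"] degree_mod_less'[of p t] by (cases "t mod p = 0") (auto simp: Q_def)
    then show "p dvd t" by auto
  qed
  from dvd[OF s(2)] obtain t where t: "s = p * t" ..
  have "\<not> is_unit p"
  proof
    assume "is_unit p"
    then obtain a where a: "p = [:a:]" "a \<noteq> 0" by (auto simp: is_unit_poly_iff dest!: degree0_coeffs[of p] elim!: degree_eq_zeroE)
    then have "a \<cdot>\<^sub>v u = 0\<^sub>v n"
      using p(1) A u by (simp add: Q_def poly_act_pCons[of _ n])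
    then have "inverse a \<cdot>\<^sub>v (a \<cdot>\<^sub>v u) = inverse a \<cdot>\<^sub>v 0\<^sub>v n" by simp
    also have "\<dots> = 0\<^sub>v n" by (intro eq_vecI) auto
    finally have "inverse a \<cdot>\<^sub>v (a \<cdot>\<^sub>v u) = 0\<^sub>v n" .
    with a u show False by (simp add: smult_smult_assoc)
  qed
  with s(1) t have "is_unit t" using irreducibleD by blast
  then have "s dvd p" unfolding t by simp
  with dvd[OF r] show "s dvd r" by (rule dvd_trans[rotated])
qed

lemma cyclic_iff_poly_act:
  assumes A: "A \<in> carrier_mat n n" and n: "0 < n"
  shows "cyclic A v \<longleftrightarrow> (\<forall>p. degree p < n \<longrightarrow> poly_act A p v = 0\<^sub>v n \<longrightarrow> p = 0)"
proof
  assume c: "cyclic A v"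
  show "\<forall>p. degree p < n \<longrightarrow> poly_act A p v = 0\<^sub>v n \<longrightarrow> p = 0"
  proof (intro allI impI poly_eqI)
    fix p i assume p: "degree p < n" "poly_act A p v = 0\<^sub>v n"
    then have "\<forall>j<n. coeff p j = 0"
      using c A unfolding cyclic_def indep_def by (auto simp: poly_act_eq_lin_comb)
    then show "coeff p i = coeff 0 i"
      using p(1) by (cases "i < n") (auto simp: coeff_eq_0)
  qed
next
  assume *: "\<forall>p. degree p < n \<longrightarrow> poly_act A p v = 0\<^sub>v n \<longrightarrow> p = 0"
  show "cyclic A v"
    unfolding cyclic_def indep_def
  proof (intro allI impI)
    fix a j assume a: "lin_comb (dim_row A) (krylov A v) a (dim_row A) = 0\<^sub>v (dim_row A)" "j < dim_row A"
    define p where "p = (\<Sum>j<n. Polynomial.monom (a j) j)"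
    have coeff: "coeff p i = (if i < n then a i else 0)" for i
      by (simp add: p_def coeff_sum coeff_monom)
    have "degree p \<le> n - 1" by (rule degree_le) (auto simp: coeff)
    then have deg: "degree p < n" using n by simp
    have "poly_act A p v = lin_comb n (krylov A v) a n"
      unfolding poly_act_eq_lin_comb[OF A deg] by (rule lin_comb_cong) (auto simp: coeff)
    with a(1) A deg * have "p = 0" by auto
    then show "a j = 0" using coeff[of j] a(2) A by simp
  qed
qed

text \<open>By Cayley-Hamilton the characteristic polynomial annihilates \<open>v\<close>; being
  irreducible, it divides every polynomial that does, so no nonzero one has degree below
  \<open>n\<close>.\<close>

lemma irreducible_cyclic:
  fixes A :: "'a :: field mat"
  assumes A: "A \<in> carrier_mat n n" and v: "v \<in> carrier_vec n" "v \<noteq> 0\<^sub>v n"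
    and irr: "irreducible (char_poly A)"
  shows "cyclic A v"
proof -
  note deg = degree_monic_char_poly[OF A]
  have "0 < n" using v by (intro gr0I) auto
  moreover have "p = 0" if "degree p < n" "poly_act A p v = 0\<^sub>v n" for p
  proof (rule ccontr)
    assume "p \<noteq> 0"
    moreover have "char_poly A dvd p"
      using poly_act_eq_0_iff_dvd[OF A v irr cayley_hamilton[OF A v(1)]] that(2) by simp
    ultimately have "n \<le> degree p" using dvd_imp_degree_le deg by metis
    with that(1) show False by simp
  qed
  ultimately show ?thesis using cyclic_iff_poly_act[OF A] by blast
qed

lemma cyclic_span:
  fixes A :: "'a :: field mat"
  assumes A: "A \<in> carrier_mat n n" and "cyclic A v" "w \<in> carrier_vec n" "0 < n"
  shows "\<exists>p. degree p < n \<and> w = poly_act A p v"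
proof -
  from indep_span[of n "krylov A v" w] assms obtain a where
    a: "w = lin_comb n (krylov A v) a n" by (auto simp: cyclic_def)
  define p where "p = (\<Sum>j<n. Polynomial.monom (a j) j)"
  have coeff: "coeff p i = (if i < n then a i else 0)" for i
    by (simp add: p_def coeff_sum coeff_monom)
  have "degree p \<le> n - 1" by (rule degree_le) (auto simp: coeff)
  then have deg: "degree p < n" using assms(4) by simp
  have "w = poly_act A p v"
    unfolding poly_act_eq_lin_comb[OF A deg] a by (rule lin_comb_cong) (auto simp: coeff)
  with deg show ?thesis by blast
qed

section \<open>Pole placement\<close>

lemma scalar_prod_sum: "w \<in> carrier_vec n \<Longrightarrow> v \<bullet> w = (\<Sum>j<n. v $ j * w $ j)"
  by (simp add: scalar_prod_def atLeast0LessThan)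

lemma scalar_prod_lin_comb:
  assumes "\<And>j. j < k \<Longrightarrow> p j \<in> carrier_vec n"
  shows "x \<bullet> lin_comb n p a k = (\<Sum>j<k. a j * (x \<bullet> p j))"
proof -
  have "x \<bullet> lin_comb n p a k = (\<Sum>i<n. \<Sum>j<k. a j * (x $ i * p j $ i))"
    by (simp add: scalar_prod_sum[of _ n] lin_comb_def sum_distrib_left algebra_simps)
  also have "\<dots> = (\<Sum>j<k. a j * (x \<bullet> p j))"
    using assms by (subst sum.swap) (simp add: scalar_prod_sum[of _ n] sum_distrib_left)
  finally show ?thesis .
qed

lemma scalar_prod_unit: "(x :: 'a :: comm_ring_1 vec) \<in> carrier_vec n \<Longrightarrow> i < n \<Longrightarrow> x \<bullet> unit_vec n i = x $ i"
  by (subst scalar_prod_sum[of _ n]) (auto simp: unit_vec_def if_distrib cong: if_cong)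

lemma cyclic_orthogonal_eq_0:
  fixes A :: "'a :: field mat"
  assumes A: "A \<in> carrier_mat n n" and v: "v \<in> carrier_vec n" and c: "cyclic A v"
    and x: "x \<in> carrier_vec n" "\<And>k. x \<bullet> krylov A v k = 0"
  shows "x = 0\<^sub>v n"
proof (rule eq_vecI)
  fix i assume "i < dim_vec (0\<^sub>v n :: 'a vec)"
  then have i: "i < n" by simp
  from indep_span[of n "krylov A v" "unit_vec n i"] c A obtain a where
    a: "unit_vec n i = lin_comb n (krylov A v) a n" by (auto simp: cyclic_def)
  have "x $ i = x \<bullet> lin_comb n (krylov A v) a n"
    using scalar_prod_unit[OF x(1) i] a by simp
  also have "\<dots> = 0" using A v by (subst scalar_prod_lin_comb) (auto simp: x(2))
  finally show "x $ i = 0\<^sub>v n $ i" using i by simp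
qed (use x in simp)

lemma scalar_prod_transpose:
  fixes A :: "'a :: comm_ring_1 mat"
  assumes "A \<in> carrier_mat n n" "x \<in> carrier_vec n" "v \<in> carrier_vec n"
  shows "x \<bullet> (A *\<^sub>v v) = (transpose_mat A *\<^sub>v x) \<bullet> v"
proof -
  have "x \<bullet> (A *\<^sub>v v) = (\<Sum>i<n. \<Sum>j<n. x $ i * (A $$ (i, j) * v $ j))"
    using assms by (simp add: scalar_prod_sum[of "A *\<^sub>v v" n] mult_mat_vec_index_sum[of _ n n]
      sum_distrib_left del: index_mult_mat_vec)
  also have "\<dots> = (\<Sum>j<n. (\<Sum>i<n. A $$ (i, j) * x $ i) * v $ j)"
    by (subst sum.swap) (simp add: sum_distrib_left sum_distrib_right algebra_simps)
  also have "\<dots> = (transpose_mat A *\<^sub>v x) \<bullet> v"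
    using assms by (simp add: scalar_prod_sum[of v n] mult_mat_vec_index_sum[of _ n n]
      del: index_mult_mat_vec)
  finally show ?thesis .
qed

text \<open>
  Rows other than \<open>l\<close> fix the cofactors \<open>u\<^sub>j\<close> along row \<open>l\<close> of the characteristic matrix, so for
  the difference \<open>x\<close> of the two rows \<open>l\<close> we get \<open>\<Sum>\<^sub>j x\<^sub>j u\<^sub>j = 0\<close>. Multiplying by the
  indeterminate and comparing degrees shows that \<open>x\<^sub>l = 0\<close> and that the relation persists for
  \<open>x A\<close>.
\<close>
lemma eq_mat_if_char_poly_eq:
  fixes A B :: "'a :: field mat"
  assumes A: "A \<in> carrier_mat n n" and B: "B \<in> carrier_mat n n" and l: "l < n"
    and rows: "\<And>i j. i < n \<Longrightarrow> i \<noteq> l \<Longrightarrow> j < n \<Longrightarrow> A $$ (i, j) = B $$ (i, j)"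
    and cp: "char_poly A = char_poly B"
    and obs: "\<And>x. x \<in> carrier_vec n \<Longrightarrow> (\<And>k. x \<bullet> krylov A (unit_vec n l) k = 0) \<Longrightarrow> x = 0\<^sub>v n"
  shows "A = B"
proof -
  define u where "u j = cofactor (char_poly_matrix A) l j" for j
  have cof: "cofactor (char_poly_matrix B) l j = u j" if "j < n" for j
  proof -
    have "mat_delete (char_poly_matrix B) l j = mat_delete (char_poly_matrix A) l j"
      using A B that l rows
      by (intro eq_matI) (auto simp: mat_delete_def char_poly_matrix_index)
    then show ?thesis by (simp add: u_def cofactor_def)
  qed
  have deg: "degree (u j) < n" if "j < n" for j
  proof -
    have "degree (det (mat_delete (char_poly_matrix A) l j)) \<le> 1 * (n - 1)"
      using A that l
      by (intro degree_det_le) (auto simp: mat_delete_def char_poly_matrix_index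
          intro: degree_diff_le split: if_splits)
    moreover have "degree ((-1) ^ i * p) = degree p" for i and p :: "'a poly"
      by (cases "even i") auto
    ultimately show ?thesis using l unfolding u_def cofactor_def by simp
  qed
  have adj: "[:0, 1:] * u i = (\<Sum>j<n. [:A $$ (i, j):] * u j) + (if i = l then char_poly A else 0)"
    if i: "i < n" for i
  proof -
    have "adj_mat (char_poly_matrix A) $$ (j, l) = u j" if "j < n" for j
      using that l A by (simp add: adj_mat_def u_def)
    then show ?thesis using adj_char_poly_matrix[OF A i l] i by simp
  qed
  have step: "x $ l = 0 \<and> (\<Sum>j<n. [:(transpose_mat A *\<^sub>v x) $ j:] * u j) = 0"
    if x: "x \<in> carrier_vec n" "(\<Sum>j<n. [:x $ j:] * u j) = 0" for x
  proof -
    let ?y = "transpose_mat A *\<^sub>v x"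
    have "(\<Sum>j<n. [:?y $ j:] * u j) = (\<Sum>j<n. \<Sum>i<n. [:x $ i:] * ([:A $$ (i, j):] * u j))"
    proof (rule sum.cong)
      fix j assume "j \<in> {..<n}"
      then have "?y $ j = (\<Sum>i<n. A $$ (i, j) * x $ i)"
        using A x by (subst mult_mat_vec_index_sum[of _ n n]) auto
      then have "[:?y $ j:] = (\<Sum>i<n. [:x $ i:] * [:A $$ (i, j):])"
        by (intro poly_eqI) (simp add: coeff_sum coeff_pCons mult.commute split: nat.splits)
      then show "[:?y $ j:] * u j = (\<Sum>i<n. [:x $ i:] * ([:A $$ (i, j):] * u j))"
        by (simp only: sum_distrib_right mult.assoc)
    qed simp
    also have "\<dots> = (\<Sum>i<n. [:x $ i:] * (\<Sum>j<n. [:A $$ (i, j):] * u j))"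
      by (subst sum.swap) (simp only: sum_distrib_left)
    also have "\<dots> = (\<Sum>i<n. [:0, 1:] * ([:x $ i:] * u i) - (if i = l then [:x $ l:] * char_poly A else 0))"
    proof (rule sum.cong)
      fix i assume "i \<in> {..<n}"
      then have i: "i < n" by simp
      have "(\<Sum>j<n. [:A $$ (i, j):] * u j) = [:0, 1:] * u i - (if i = l then char_poly A else 0)"
        by (simp only: adj[OF i] add_diff_cancel_right')
      then show "[:x $ i:] * (\<Sum>j<n. [:A $$ (i, j):] * u j) =
          [:0, 1:] * ([:x $ i:] * u i) - (if i = l then [:x $ l:] * char_poly A else 0)"
        by (simp only:) (simp add: algebra_simps)
    qed simp
    also have "\<dots> = [:0, 1:] * (\<Sum>i<n. [:x $ i:] * u i) - [:x $ l:] * char_poly A"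
      using l by (simp only: sum_subtractf sum_distrib_left) simp
    finally have eq: "(\<Sum>j<n. [:?y $ j:] * u j) = - Polynomial.smult (x $ l) (char_poly A)"
      using x(2) by simp
    have "degree ([:a:] * u j) \<le> n - 1" if "j < n" for a j
      using deg[OF that] degree_smult_le[of a "u j"] by simp
    then have "degree (\<Sum>j<n. [:?y $ j:] * u j) \<le> n - 1"
      by (intro degree_sum_le) simp_all
    with eq l have "x $ l = 0"
      using degree_monic_char_poly[OF A] by (cases "x $ l = 0") auto
    with eq show ?thesis by simp
  qed
  have orth: "x \<bullet> krylov A (unit_vec n l) k = 0"
    if "x \<in> carrier_vec n" "(\<Sum>j<n. [:x $ j:] * u j) = 0" for x k
    using that
  proof (induction k arbitrary: x)
    case (0 x)
    then show ?case using step[of x] l by (simp add: scalar_prod_unit)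
  next
    case (Suc k x)
    have "x \<bullet> krylov A (unit_vec n l) (Suc k) = (transpose_mat A *\<^sub>v x) \<bullet> krylov A (unit_vec n l) k"
      using Suc.prems(1) A by (simp add: scalar_prod_transpose[of _ n])
    also have "\<dots> = 0"
      using Suc.prems step[of x] A by (intro Suc.IH) auto
    finally show ?case .
  qed
  \<comment> \<open>Expanding both characteristic determinants along row \<open>l\<close> uses the
    same cofactors, so the difference of the rows pairs with them to the difference of the
    polynomials, which is 0.\<close>
  let ?x = "vec n (\<lambda>j. B $$ (l, j) - A $$ (l, j))"
  have "(\<Sum>j<n. [:?x $ j:] * u j) = (\<Sum>j<n. char_poly_matrix A $$ (l, j) * u j -
      char_poly_matrix B $$ (l, j) * cofactor (char_poly_matrix B) l j)"
    using A B l by (intro sum.cong) (auto simp: char_poly_matrix_index cof algebra_simps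
        smult_diff_left simp flip: diff_pCons)
  also have "\<dots> = char_poly A - char_poly B"
    using A B l unfolding char_poly_def u_def sum_subtractf
    by (simp add: laplace_expansion_row[of _ n l])
  finally have "?x = 0\<^sub>v n" using orth by (intro obs) (simp_all add: cp)
  then have "A $$ (l, j) = B $$ (l, j)" if "j < n" for j
    using that by (auto simp: vec_eq_iff)
  with rows have "A $$ (i, j) = B $$ (i, j)" if "i < n" "j < n" for i j
    using that by (cases "i = l") auto
  with A B show ?thesis by (intro eq_matI) auto
qed

text \<open>In the basis of Krylov vectors of a cyclic vector, a matrix becomes the companion matrix
  \<open>C\<close> of its characteristic polynomial.\<close>

lemma similar_mat_if_cyclic:
  fixes A B :: "'a :: field mat"
  assumes A: "A \<in> carrier_mat n n" and B: "B \<in> carrier_mat n n" and n: "0 < n"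
    and v: "v \<in> carrier_vec n" "cyclic A v" and w: "w \<in> carrier_vec n" "cyclic B w"
    and cp: "char_poly A = char_poly B"
  shows "similar_mat A B"
proof -
  define p where "p = char_poly A"
  define C where "C = mat n n (\<lambda>(i, j). if Suc j < n then (if i = Suc j then 1 else 0) else - coeff p i)"
  have C: "C \<in> carrier_mat n n" by (simp add: C_def)
  have main: "M * col_mat n (krylov M c) = col_mat n (krylov M c) * C"
    if M: "M \<in> carrier_mat n n" and c: "c \<in> carrier_vec n" and Mp: "char_poly M = p" for M c
  proof (rule mat_col_eqI)
    let ?K = "col_mat n (krylov M c)"
    have kc: "krylov M c j \<in> carrier_vec n" for j using M c by simp
    fix j assume "j < dim_col (?K * C)"
    then have j: "j < n" using C by simp
    have "col (M * ?K) j = krylov M c (Suc j)"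
      using j M kc by (subst col_mult2[OF M col_mat_carrier j]) (simp add: col_col_mat)
    also have "\<dots> = lin_comb n (krylov M c) (($) (col C j)) n"
    proof (cases "Suc j < n")
      case True
      have "(\<Sum>k<n. col C j $ k * krylov M c k $ i) = krylov M c (Suc j) $ i" for i
        using True by (subst sum.remove[of _ "Suc j"]) (auto simp: C_def intro!: sum.neutral)
      then show ?thesis using kc[of "Suc j"]
        by (intro eq_vecI) (auto simp: lin_comb_def simp del: krylov_Suc)
    next
      case False
      \<comment> \<open>The last column of \<open>C\<close> expresses the Krylov vector of index
        \<open>n\<close> by the earlier ones, which is Cayley-Hamilton applied to
        \<open>c\<close>.\<close>
      then have jn: "Suc j = n" using j by simp
      note deg = degree_monic_char_poly[OF M]
      have "lin_comb n (krylov M c) (coeff p) (Suc n) = 0\<^sub>v n"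
        using cayley_hamilton[OF M c] poly_act_eq_lin_comb[OF M, of "char_poly M" "Suc n" c] deg Mp
        by simp
      then have eq: "(\<Sum>k<n. coeff p k * krylov M c k $ i) + krylov M c n $ i = 0" if "i < n" for i
        using deg Mp that by (auto simp: lin_comb_def vec_eq_iff)
      show ?thesis
      proof (intro eq_vecI)
        fix i assume "i < dim_vec (lin_comb n (krylov M c) (($) (col C j)) n)"
        then have i: "i < n" by (simp add: lin_comb_def)
        have "krylov M c (Suc j) $ i = - (\<Sum>k<n. coeff p k * krylov M c k $ i)"
          using eq[OF i] jn by (simp add: eq_neg_iff_add_eq_0 add.commute del: krylov_Suc)
        also have "\<dots> = lin_comb n (krylov M c) (($) (col C j)) n $ i"
          using i j False by (simp add: lin_comb_def C_def sum_negf)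
        finally show "krylov M c (Suc j) $ i = lin_comb n (krylov M c) (($) (col C j)) n $ i" .
      qed (use kc[of "Suc j"] in \<open>simp add: lin_comb_def del: krylov_Suc\<close>)
    qed
    also have "\<dots> = col (?K * C) j"
      using C j by (subst col_mult2[OF col_mat_carrier C j]) (simp add: col_mat_mult_vec)
    finally show "col (M * ?K) j = col (?K * C) j" .
  qed (use M C in auto)
  have sim: "similar_mat M C" if M: "M \<in> carrier_mat n n" and c: "c \<in> carrier_vec n" "cyclic M c"
    and Mp: "char_poly M = p" for M c
  proof -
    let ?K = "col_mat n (krylov M c)"
    have "det ?K \<noteq> 0" using c M by (simp add: cyclic_def indep_det)
    from det_nonzero_inverse[OF col_mat_carrier this] obtain L where
      L: "L \<in> carrier_mat n n" "?K * L = 1\<^sub>m n" "L * ?K = 1\<^sub>m n" by metis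
    have "M = M * (?K * L)" using L M by simp
    also have "\<dots> = M * ?K * L" using L(1) M by (intro assoc_mult_mat[symmetric]) auto
    finally have "M = ?K * C * L" by (simp only: main[OF M c(1) Mp])
    then show ?thesis using L M C by (intro similar_matI[of _ _ ?K L n]) auto
  qed
  show ?thesis
    using sim[OF A v] sim[OF B w] cp
    by (metis p_def similar_mat_sym similar_mat_trans)
qed

section \<open>The trace as a coefficient, and bordered matrices\<close>

lemma coeff_prod_linear:
  fixes a :: "nat \<Rightarrow> 'a :: comm_ring_1"
  shows "coeff (\<Prod>i<Suc n. [:- a i, 1:]) n = - (\<Sum>i<Suc n. a i)"
proof -
  have lead: "degree (\<Prod>i<n. [:- a i, 1:]) \<le> n \<and> coeff (\<Prod>i<n. [:- a i, 1:]) n = 1" for n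
  proof (induction n)
    case (Suc n)
    let ?P = "\<Prod>i<n. [:- a i, 1:]"
    have eq: "(\<Prod>i<Suc n. [:- a i, 1:]) = Polynomial.smult (- a n) ?P + pCons 0 ?P"
      by (simp add: mult.commute)
    have "coeff ?P (Suc n) = 0" using Suc by (auto intro: coeff_eq_0)
    moreover have "degree (Polynomial.smult (- a n) ?P + pCons 0 ?P) \<le> Suc n"
      using Suc degree_smult_le[of "- a n" ?P] degree_pCons_le[of 0 ?P]
      by (intro degree_add_le) auto
    ultimately show ?case using Suc unfolding eq by simp
  qed simp
  show "coeff (\<Prod>i<Suc n. [:- a i, 1:]) n = - (\<Sum>i<Suc n. a i)"
  proof (induction n)
    case (Suc n)
    let ?P = "\<Prod>i<Suc n. [:- a i, 1:]"
    have "(\<Prod>i<Suc (Suc n). [:- a i, 1:]) = Polynomial.smult (- a (Suc n)) ?P + pCons 0 ?P"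
      by (subst prod.lessThan_Suc) (simp add: mult.commute del: prod.lessThan_Suc)
    then have "coeff (\<Prod>i<Suc (Suc n). [:- a i, 1:]) (Suc n) =
        - a (Suc n) * coeff ?P (Suc n) + coeff ?P n"
      by (simp del: prod.lessThan_Suc)
    then show ?case using Suc lead[of "Suc n"] by (simp del: prod.lessThan_Suc)
  qed simp
qed

text \<open>A permutation other than the identity moves at least two points, so its term contains at
  most \<open>m - 1\<close> diagonal entries and has degree below \<open>m\<close>; only the product
  of all diagonal entries contributes.\<close>

lemma coeff_char_poly_trace:
  fixes A :: "'a :: comm_ring_1 mat"
  assumes A: "A \<in> carrier_mat (Suc m) (Suc m)"
  shows "coeff (char_poly A) m = - mat_trace A"
proof -
  let ?n = "Suc m"
  let ?M = "char_poly_matrix A" and ?S = "{p. p permutes {0..<?n}}"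
  let ?t = "\<lambda>p. signof p * (\<Prod>i = 0..<?n. ?M $$ (i, p i))"
  have small: "coeff (?t p) m = 0" if p: "p permutes {0..<?n}" "p \<noteq> id" for p
  proof -
    from p(2) obtain i where i: "p i \<noteq> i" by (auto simp: fun_eq_iff)
    have i_n: "i < ?n" using i p(1) by (auto simp: permutes_def)
    have pi_n: "p i < ?n" using permutes_in_image[OF p(1), of i] i_n by simp
    have ppi: "p (p i) \<noteq> p i" using i permutes_inj[OF p(1)] by (auto dest: injD)
    have deg: "degree (?M $$ (j, p j)) \<le> (if j \<in> {0..<?n} - {i, p i} then 1 else 0)" if j: "j < ?n" for j
    proof -
      have pj: "p j < ?n" using permutes_in_image[OF p(1), of j] j by simp
      show ?thesis using i ppi j
        by (auto simp: char_poly_matrix_index[OF A j pj] intro: degree_diff_le)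
    qed
    have "degree (?t p) \<le> degree (\<Prod>i = 0..<?n. ?M $$ (i, p i))" by simp
    also have "\<dots> \<le> (\<Sum>j = 0..<?n. degree (?M $$ (j, p j)))"
      using degree_prod_sum_le[of "{0..<?n}" "\<lambda>j. ?M $$ (j, p j)"] by (simp add: o_def)
    also have "\<dots> \<le> (\<Sum>j = 0..<?n. if j \<in> {0..<?n} - {i, p i} then 1 else 0)"
      using deg by (intro sum_mono) auto
    also have "\<dots> = card ({0..<?n} - {i, p i})"
      by (subst sum.If_cases) (auto intro!: arg_cong[where f = card])
    also have "\<dots> = ?n - 2"
      using i i_n pi_n by (subst card_Diff_subset) auto
    also have "\<dots> < m" using i i_n pi_n by (cases m) auto
    finally show ?thesis by (rule coeff_eq_0)
  qed
  have "coeff (char_poly A) m = (\<Sum>p\<in>?S. coeff (?t p) m)"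
    unfolding char_poly_def using A by (subst det_def'[of _ ?n]) (auto simp: coeff_sum)
  also have "\<dots> = (\<Sum>p\<in>{id}. coeff (?t p) m)"
    using small by (intro sum.mono_neutral_right) (auto simp: finite_permutations permutes_id)
  also have "\<dots> = coeff (\<Prod>i<?n. ?M $$ (i, i)) m"
    by (simp add: atLeast0LessThan)
  also have "(\<Prod>i<?n. ?M $$ (i, i)) = (\<Prod>i<?n. [:- (A $$ (i, i)), 1:])"
    using A by (intro prod.cong) (auto simp: char_poly_matrix_index)
  also have "coeff \<dots> m = - mat_trace A"
    using A unfolding coeff_prod_linear by (simp add: mat_trace_def)
  finally show ?thesis .
qed

text \<open>In block form this is ((a, w), (c, D)). The border consists of vectors, so that
  \<open>w\<close> can range over \<open>carrier_vec m\<close> and \<open>c\<close> can serve as a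
  cyclic vector for \<open>D\<close>.\<close>

definition bordered :: "'a \<Rightarrow> 'a vec \<Rightarrow> 'a vec \<Rightarrow> 'a mat \<Rightarrow> 'a mat" where
  "bordered a w c D = mat (Suc (dim_row D)) (Suc (dim_row D)) (\<lambda>(i, j).
     if i = 0 then if j = 0 then a else w $ (j - 1)
     else if j = 0 then c $ (i - 1) else D $$ (i - 1, j - 1))"

lemma dim_bordered [simp]:
  "dim_row (bordered a w c D) = Suc (dim_row D)" "dim_col (bordered a w c D) = Suc (dim_row D)"
  by (simp_all add: bordered_def)

lemma bordered_carrier [simp]:
  "D \<in> carrier_mat m m \<Longrightarrow> bordered a w c D \<in> carrier_mat (Suc m) (Suc m)"
  by auto

lemma bordered_index [simp]:
  "bordered a w c D $$ (0, 0) = a"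
  "j < dim_row D \<Longrightarrow> bordered a w c D $$ (0, Suc j) = w $ j"
  "i < dim_row D \<Longrightarrow> bordered a w c D $$ (Suc i, 0) = c $ i"
  "i < dim_row D \<Longrightarrow> j < dim_row D \<Longrightarrow> bordered a w c D $$ (Suc i, Suc j) = D $$ (i, j)"
  by (simp_all add: bordered_def)

lemma eq_bordered:
  assumes "A \<in> carrier_mat (Suc m) (Suc m)"
  shows "A = bordered (A $$ (0, 0)) (vec m (\<lambda>j. A $$ (0, Suc j))) (vec m (\<lambda>i. A $$ (Suc i, 0)))
    (mat m m (\<lambda>(i, j). A $$ (Suc i, Suc j)))"
  using assms by (intro eq_matI) (auto simp: bordered_def)

lemma mat_trace_bordered: "mat_trace (bordered a w c D) = a + mat_trace D"
  unfolding mat_trace_def by (simp add: sum.lessThan_Suc_shift del: sum.lessThan_Suc)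

lemma char_poly_bordered_0:
  assumes D: "D \<in> carrier_mat m m"
  shows "char_poly (bordered a w (0\<^sub>v m) D) = [:- a, 1:] * char_poly (D :: 'a :: field mat)"
proof -
  let ?A = "mat 1 1 (\<lambda>_. a)" and ?W = "mat 1 m (\<lambda>(_, j). w $ j)"
  have "bordered a w (0\<^sub>v m) D = four_block_mat ?A ?W (0\<^sub>m m 1) D"
    using D by (intro eq_matI) (auto simp: bordered_def four_block_mat_def Let_def)
  also have "char_poly \<dots> = char_poly ?A * char_poly D"
    by (rule char_poly_four_block_zeros_col) (use D in auto)
  also have "char_poly ?A = [:- a, 1:]"
    by (subst char_poly_upper_triangular[of _ 1]) (auto simp: upper_triangular_def diag_mat_def)
  finally show ?thesis .
qed

lemma tail_mult_bordered:
  fixes D :: "'a :: comm_ring_1 mat"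
  assumes D: "D \<in> carrier_mat m m" and v: "v \<in> carrier_vec (Suc m)" and c: "c \<in> carrier_vec m"
  shows "vec m (\<lambda>i. (bordered a w c D *\<^sub>v v) $ Suc i) =
      v $ 0 \<cdot>\<^sub>v c + D *\<^sub>v vec m (\<lambda>i. v $ Suc i)"
proof -
  note B = bordered_carrier[OF D, of a w c]
  show "vec m (\<lambda>i. (bordered a w c D *\<^sub>v v) $ Suc i) = v $ 0 \<cdot>\<^sub>v c + D *\<^sub>v vec m (\<lambda>i. v $ Suc i)"
  proof (rule eq_vecI)
    fix i assume "i < dim_vec (v $ 0 \<cdot>\<^sub>v c + D *\<^sub>v vec m (\<lambda>i. v $ Suc i))"
    then have i: "i < m" using D by simp
    then have "vec m (\<lambda>i. (bordered a w c D *\<^sub>v v) $ Suc i) $ i = (bordered a w c D *\<^sub>v v) $ Suc i"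
      by (simp del: index_mult_mat_vec)
    also have "\<dots> = c $ i * v $ 0 + (\<Sum>j<m. D $$ (i, j) * v $ Suc j)"
      using D i by (subst mult_mat_vec_index_sum[OF B v])
        (simp_all add: sum.lessThan_Suc_shift del: sum.lessThan_Suc)
    also have "(\<Sum>j<m. D $$ (i, j) * v $ Suc j) = (D *\<^sub>v vec m (\<lambda>i. v $ Suc i)) $ i"
      using D i by (subst mult_mat_vec_index_sum[OF D]) auto
    finally show "vec m (\<lambda>i. (bordered a w c D *\<^sub>v v) $ Suc i) $ i =
        (v $ 0 \<cdot>\<^sub>v c + D *\<^sub>v vec m (\<lambda>i. v $ Suc i)) $ i"
      using D i carrier_vecD[OF c] by (simp add: mult.commute del: index_mult_mat_vec)
  qed (use D in auto)
qed

text \<open>Without their first coordinates, the Krylov vectors of the first unit vector are vectors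
  \<open>t k\<close> with \<open>t 1 = c\<close>, and \<open>t (Suc k)\<close> is \<open>D\<close>
  applied to \<open>t k\<close> plus a multiple of \<open>c\<close>. They therefore span the same
  space as \<open>c\<close>, \<open>D c\<close> and so on, whatever the first row \<open>w\<close>
  is.\<close>

lemma bordered_orthogonal_eq_0:
  fixes D :: "'a :: field mat"
  assumes D: "D \<in> carrier_mat m m" and c: "c \<in> carrier_vec m" and cyc: "cyclic D c"
    and x: "x \<in> carrier_vec (Suc m)"
      "\<And>k. x \<bullet> krylov (bordered a w c D) (unit_vec (Suc m) 0) k = 0"
  shows "x = 0\<^sub>v (Suc m)"
proof -
  define K where "K = krylov (bordered a w c D) (unit_vec (Suc m) 0)"
  define t where "t k = vec m (\<lambda>i. K k $ Suc i)" for k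
  define y where "y = vec m (\<lambda>i. x $ Suc i)"
  have K: "K k \<in> carrier_vec (Suc m)" for k
    unfolding K_def by (rule krylov_carrier) (use D in auto)
  have t: "t k \<in> carrier_vec m" for k by (simp add: t_def)
  have t_Suc: "t (Suc k) = K k $ 0 \<cdot>\<^sub>v c + D *\<^sub>v t k" for k
    using tail_mult_bordered[OF D K c, of a w k] unfolding t_def by (simp add: K_def)
  have "t 0 = 0\<^sub>v m" by (auto simp: t_def K_def unit_vec_def)
  then have t1: "t 1 = c"
    using t_Suc[of 0] D c by (simp add: K_def)
  have x0: "x $ 0 = 0"
    using x(2)[of 0] by (simp add: scalar_prod_unit[OF x(1)])
  have xK: "x \<bullet> K k = y \<bullet> t k" for k
    using x0 K t by (simp add: scalar_prod_sum[of _ "Suc m"] scalar_prod_sum[of _ m]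
      sum.lessThan_Suc_shift y_def t_def del: sum.lessThan_Suc)
  \<comment> \<open>All \<open>k\<close> are needed at once: \<open>D^(i+1) t_k\<close> is
    \<open>D^i t_(k+1)\<close> minus a multiple of \<open>D^i c\<close>, and \<open>c\<close> is
    \<open>t 1\<close>.\<close>
  have main: "y \<bullet> krylov D (t k) i = 0" for k i
  proof (induction i arbitrary: k)
    case 0
    then show ?case using xK x(2) by (simp add: K_def)
  next
    case (Suc i)
    have "y \<bullet> krylov D (t (Suc k)) i =
        y \<bullet> (K k $ 0 \<cdot>\<^sub>v krylov D c i + krylov D (D *\<^sub>v t k) i)"
      unfolding t_Suc using D c t by (simp add: krylov_add[of _ m] krylov_smult[of _ m])
    also have "\<dots> = K k $ 0 * (y \<bullet> krylov D c i) + y \<bullet> krylov D (D *\<^sub>v t k) i"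
      using D c t by (subst scalar_prod_add_distrib[of _ m]) (auto simp: y_def)
    finally show ?case
      using Suc.IH[of "Suc k"] Suc.IH[of 1] by (simp add: t1[unfolded One_nat_def] krylov_Suc2 del: krylov_Suc)
  qed
  have "y = 0\<^sub>v m"
    by (rule cyclic_orthogonal_eq_0[OF D c cyc]) (use main[of 1] t1 in \<open>auto simp: y_def\<close>)
  then have "x $ Suc i = 0" if "i < m" for i using that by (auto simp: y_def vec_eq_iff)
  then have "x $ i = 0" if "i < Suc m" for i using that x0 by (cases i) auto
  then show ?thesis using x(1) by (intro eq_vecI) auto
qed

text \<open>
  The map from first rows to characteristic polynomials is injective between sets of size \<open>q\<^bsup>m\<^esup>\<close>.
\<close>
theorem exists_bordered_char_poly:
  fixes D :: "'a :: {field, finite} mat"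
  assumes D: "D \<in> carrier_mat m m" and c: "c \<in> carrier_vec m" and cyc: "cyclic D c"
    and f: "degree f = Suc m" "monic f" "coeff f m = - (a + mat_trace D)"
  shows "\<exists>w \<in> carrier_vec m. char_poly (bordered a w c D) = f"
proof -
  let ?T = "{p :: 'a poly. degree p = Suc m \<and> monic p \<and> coeff p m = coeff f m}"
  let ?F = "\<lambda>w. char_poly (bordered a w c D)"
  \<comment> \<open>The coefficients of index \<open>m\<close> and \<open>Suc m\<close> are
    prescribed, so \<open>m\<close> free coefficients remain, as many as a first row has
    entries.\<close>
  have inj: "inj_on (\<lambda>p. vec m (coeff p)) ?T"
  proof (rule inj_onI, rule poly_eqI)
    fix p q i assume pq: "p \<in> ?T" "q \<in> ?T" "vec m (coeff p) = vec m (coeff q)"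
    consider "i < m" | "i = m" | "i = Suc m" | "i > Suc m" by linarith
    then show "coeff p i = coeff q i"
      using pq by cases (auto simp: vec_eq_iff coeff_eq_0)
  qed
  have sub: "(\<lambda>p. vec m (coeff p)) ` ?T \<subseteq> carrier_vec m" by auto
  have fin: "finite ?T" by (rule inj_on_finite[OF inj sub]) simp
  have card: "card ?T \<le> CARD('a) ^ m"
    using card_inj_on_le[OF inj sub] by (simp add: card_carrier_vec)
  have inj_F: "inj_on ?F (carrier_vec m)"
  proof (rule inj_onI)
    fix w w' assume w: "w \<in> carrier_vec m" "w' \<in> carrier_vec m" "?F w = ?F w'"
    have "bordered a w c D = bordered a w' c D"
    proof (rule eq_mat_if_char_poly_eq[of _ "Suc m" _ 0])
      show "x = 0\<^sub>v (Suc m)" if "x \<in> carrier_vec (Suc m)"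
        "\<And>k. x \<bullet> krylov (bordered a w c D) (unit_vec (Suc m) 0) k = 0" for x
        using bordered_orthogonal_eq_0[OF D c cyc that] .
    qed (use D w in \<open>auto simp: bordered_def\<close>)
    then have "w $ j = w' $ j" if "j < m" for j
      using D that by (metis bordered_index(2) carrier_matD(1))
    with w show "w = w'" by (intro eq_vecI) auto
  qed
  have "?F ` carrier_vec m \<subseteq> ?T"
  proof
    fix p assume "p \<in> ?F ` carrier_vec m"
    then obtain w where p: "p = ?F w" by blast
    note B = bordered_carrier[OF D, of a w c]
    from degree_monic_char_poly[OF B] coeff_char_poly_trace[OF B] f(3)
    show "p \<in> ?T" by (simp add: p mat_trace_bordered)
  qed
  from card_seteq[OF fin this] card have "?F ` carrier_vec m = ?T"
    by (simp add: card_image[OF inj_F] card_carrier_vec)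
  then show ?thesis using f by (metis (mono_tags, lifting) imageE mem_Collect_eq)
qed

lemma indep_unit_vec: "indep m (unit_vec m :: nat \<Rightarrow> 'a :: comm_ring_1 vec) m"
  unfolding indep_def
proof (intro allI impI)
  fix a :: "nat \<Rightarrow> 'a" and j
  assume a: "lin_comb m (unit_vec m) a m = 0\<^sub>v m" "j < m"
  have "lin_comb m (unit_vec m) a m $ j = a j"
    using a(2) by (simp add: lin_comb_def unit_vec_def if_distrib cong: if_cong)
  with a show "a j = 0" by simp
qed

text \<open>The first unit vector is cyclic for the nilpotent shift \<open>D\<close>, so pole
  placement produces \<open>f\<close>, with the corner \<open>a\<close> chosen to give the trace
  that \<open>f\<close> demands.\<close>

theorem exists_char_poly_eq:
  fixes f :: "'a :: {field, finite} poly"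
  assumes "degree f = Suc m" "monic f"
  shows "\<exists>A \<in> carrier_mat (Suc m) (Suc m). char_poly A = f"
proof -
  define D :: "'a mat" where "D = mat m m (\<lambda>(i, j). if i = Suc j then 1 else 0)"
  have D: "D \<in> carrier_mat m m" by (simp add: D_def)
  have "krylov D (unit_vec m 0) j = unit_vec m j" if "j < m" for j
    using that
  proof (induction j)
    case (Suc j)
    have "D *\<^sub>v unit_vec m j = unit_vec m (Suc j)"
      using Suc.prems D by (intro eq_vecI) (auto simp: D_def scalar_prod_unit[of _ m])
    then show ?case using Suc by simp
  qed simp
  then have "indep m (krylov D (unit_vec m 0)) m \<longleftrightarrow> indep m (unit_vec m :: nat \<Rightarrow> 'a vec) m"
    by (rule indep_cong)
  then have "cyclic D (unit_vec m 0)" using D by (simp add: cyclic_def indep_unit_vec)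
  from exists_bordered_char_poly[OF D unit_vec_carrier this assms, of "- coeff f m - mat_trace D"]
  show ?thesis using bordered_carrier[OF D] by (auto simp: algebra_simps)
qed

section \<open>Counting cyclic vectors\<close>

declare finite_carrier_mat [simp]

lemma indep_1:
  fixes p :: "nat \<Rightarrow> 'a :: field vec"
  assumes "p 0 \<in> carrier_vec n" "p 0 \<noteq> 0\<^sub>v n"
  shows "indep n p 1"
proof -
  have "lin_comb n p a 0 = 0\<^sub>v n" for a by (auto simp: lin_comb_def)
  then show ?thesis
    using indep_Suc[of n p 0] assms by (simp add: indep_def)
qed

lemma indep_eq_mat:
  fixes A B :: "'a :: field mat"
  assumes "A \<in> carrier_mat m n" "B \<in> carrier_mat m n" "indep n p n" "\<And>j. j < n \<Longrightarrow> p j \<in> carrier_vec n"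
    and eq: "\<And>j. j < n \<Longrightarrow> A *\<^sub>v p j = B *\<^sub>v p j"
  shows "A = B"
proof (rule mat_col_eqI)
  fix j assume "j < dim_col B"
  then have j: "j < n" using assms by simp
  obtain a where a: "unit_vec n j = lin_comb n p a n" using indep_span[OF assms(3) unit_vec_carrier] by blast
  have "A *\<^sub>v unit_vec n j = B *\<^sub>v unit_vec n j"
    unfolding a using assms by (simp add: mult_lin_comb[of _ m n] cong: lin_comb_cong)
  moreover have "M *\<^sub>v unit_vec n j = col M j" if "M \<in> carrier_mat m n" for M :: "'a mat"
    using that j by (intro eq_vecI) (auto simp: scalar_prod_unit[of _ n])
  ultimately show "col A j = col B j" using assms by simp
qed (use assms in auto)

text \<open>
  \<open>r\<close> is the number of columns, in an arbitrary basis, that determine an element of \<open>S\<close>. An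
  element \<open>y\<close> for which \<open>c\<close> is not cyclic for \<open>d - y\<close> is encoded by the Krylov vectors of \<open>c\<close> up
  to the first dependent one, the coefficients of the dependency, and the remaining columns.
\<close>
lemma card_not_cyclic_le:
  fixes c :: "'a :: {field, finite} vec"
  assumes S: "S \<subseteq> carrier_mat m m" and d: "d \<in> carrier_mat m m"
    and c: "c \<in> carrier_vec m" "c \<noteq> 0\<^sub>v m" and r: "m - 1 \<le> r" "r \<le> m"
    and det: "\<And>p y y'. indep m p m \<Longrightarrow> (\<And>j. j < m \<Longrightarrow> p j \<in> carrier_vec m) \<Longrightarrow> y \<in> S \<Longrightarrow> y' \<in> S \<Longrightarrow>
      (\<And>j. j < r \<Longrightarrow> y *\<^sub>v p j = y' *\<^sub>v p j) \<Longrightarrow> y = y'"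
  shows "card {y \<in> S. \<not> cyclic (d - y) c} \<le>
    (\<Sum>k\<in>{1..<m}. CARD('a) ^ (m * (k - 1)) * (CARD('a) ^ k * CARD('a) ^ (m * (r - k))))"
proof -
  define p where "p y = krylov (d - y) c" for y
  \<comment> \<open>\<open>B k\<close> collects the \<open>y\<close> whose Krylov sequence of
    \<open>c\<close> first becomes dependent at index \<open>k\<close>; \<open>k = 0\<close> is
    impossible as \<open>c\<close> is nonzero.\<close>
  define B where "B k = {y \<in> S. indep m (p y) k \<and> (\<exists>a. p y k = lin_comb m (p y) a k)}" for k
  have yc: "y \<in> carrier_mat m m" if "y \<in> S" for y using that S by blast
  have diff: "d - y \<in> carrier_mat m m" if "y \<in> S" for y
    using yc[OF that] by (rule minus_carrier_mat)
  have p_carrier: "p y j \<in> carrier_vec m" if "y \<in> S" for y j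
    unfolding p_def using diff[OF that] c by simp
  have finS: "finite S" using S by (rule finite_subset) simp
  have "{y \<in> S. \<not> cyclic (d - y) c} \<subseteq> (\<Union>k\<in>{1..<m}. B k)"
  proof
    fix y assume "y \<in> {y \<in> S. \<not> cyclic (d - y) c}"
    then have y: "y \<in> S" "\<not> indep m (p y) m"
      using diff[of y] by (auto simp: cyclic_def p_def)
    define L where "L = (LEAST L. \<not> indep m (p y) L)"
    have L: "\<not> indep m (p y) L" unfolding L_def by (rule LeastI) (rule y(2))
    have L2: "L \<le> m" unfolding L_def by (rule Least_le) (rule y(2))
    have L3: "indep m (p y) k" if "k < L" for k
      using not_less_Least[of k "\<lambda>L. \<not> indep m (p y) L"] that unfolding L_def by blast
    have "indep m (p y) 0" by (simp add: indep_def)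
    moreover have "indep m (p y) 1" using c by (intro indep_1) (simp_all add: p_def)
    ultimately have "L \<noteq> 0 \<and> L \<noteq> 1" using L by (intro conjI notI) simp_all
    then obtain k where k: "L = Suc k" "1 \<le> k" by (cases L) auto
    have "indep m (p y) k" using L3 k by simp
    moreover from this have "\<exists>a. p y k = lin_comb m (p y) a k"
      using indep_Suc[of m "p y" k] L k(1) p_carrier[OF y(1)] by blast
    ultimately have "y \<in> B k" using y(1) by (simp add: B_def)
    then show "y \<in> (\<Union>k\<in>{1..<m}. B k)" using k L2 by auto
  qed
  then have "card {y \<in> S. \<not> cyclic (d - y) c} \<le> card (\<Union>k\<in>{1..<m}. B k)"
    by (rule card_mono[rotated]) (use finS in \<open>auto simp: B_def\<close>)
  also have "\<dots> \<le> (\<Sum>k\<in>{1..<m}. card (B k))" by (rule card_UN_le) simp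
  also have "\<dots> \<le> (\<Sum>k\<in>{1..<m}. CARD('a) ^ (m * (k - 1)) * (CARD('a) ^ k * CARD('a) ^ (m * (r - k))))"
  proof (rule sum_mono)
    fix k assume "k \<in> {1..<m}"
    then have k: "1 \<le> k" "k < m" by auto
    \<comment> \<open>The choice refers to \<open>y\<close> only through the first \<open>k\<close>
      Krylov vectors, so two matrices that share these get the same basis \<open>e\<close>.\<close>
    define e where "e y = (SOME e. (\<forall>j<k. e j = p y j) \<and>
      (\<forall>j<m. e j \<in> carrier_vec m) \<and> indep m e m)" for y
    define \<alpha> where "\<alpha> y = (SOME a. p y k = lin_comb m (p y) a k)" for y
    \<comment> \<open>The Krylov vector of index 0 is \<open>c\<close> itself and is not recorded,
      hence \<open>k - 1\<close> columns. The coefficients \<open>\<alpha> y\<close> recover the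
      vector of index \<open>k\<close>, so \<open>y\<close> is known on
      \<open>e 0, ..., e (k - 1)\<close>, and \<open>r - k\<close> of the \<open>r\<close> deciding
      columns remain.\<close>
    define G where "G y = (mat m (k - 1) (\<lambda>(i, j). p y (Suc j) $ i), vec k (\<alpha> y),
      mat m (r - k) (\<lambda>(i, j). (y *\<^sub>v e y (k + j)) $ i))" for y
    have e: "\<forall>j<k. e y j = p y j" "\<And>j. j < m \<Longrightarrow> e y j \<in> carrier_vec m" "indep m (e y) m" if "y \<in> B k" for y
    proof -
      from that have "\<exists>e. (\<forall>j<k. e j = p y j) \<and> (\<forall>j<m. e j \<in> carrier_vec m) \<and> indep m e m"
        using k p_carrier by (intro exists_indep_extension) (auto simp: B_def)
      from someI_ex[OF this] show "\<forall>j<k. e y j = p y j" "\<And>j. j < m \<Longrightarrow> e y j \<in> carrier_vec m" "indep m (e y) m"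
        unfolding e_def by auto
    qed
    have \<alpha>: "p y k = lin_comb m (p y) (\<alpha> y) k" if "y \<in> B k" for y
      using that someI_ex[of "\<lambda>a. p y k = lin_comb m (p y) a k"] by (auto simp: B_def \<alpha>_def)
    have inj: "inj_on G (B k)"
    proof (rule inj_onI)
      fix y y' assume y: "y \<in> B k" "y' \<in> B k" "G y = G y'"
      then have yS: "y \<in> S" "y' \<in> S" by (auto simp: B_def)
      have G1: "mat m (k - 1) (\<lambda>(i, j). p y (Suc j) $ i) = mat m (k - 1) (\<lambda>(i, j). p y' (Suc j) $ i)"
        and G2: "vec k (\<alpha> y) = vec k (\<alpha> y')"
        and G3: "mat m (r - k) (\<lambda>(i, j). (y *\<^sub>v e y (k + j)) $ i) = mat m (r - k) (\<lambda>(i, j). (y' *\<^sub>v e y' (k + j)) $ i)"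
        using y(3) by (auto simp: G_def)
      have p_eq: "p y j = p y' j" if "j < k" for j
      proof (cases j)
        case 0
        then show ?thesis by (simp add: p_def)
      next
        case (Suc l)
        have "p y (Suc l) $ i = p y' (Suc l) $ i" if "i < m" for i
          using arg_cong[OF G1, of "\<lambda>M. M $$ (i, l)"] that \<open>j < k\<close> Suc by simp
        then show ?thesis unfolding Suc
          using p_carrier[OF yS(1), of "Suc l"] p_carrier[OF yS(2), of "Suc l"] by (intro eq_vecI) auto
      qed
      have e_eq: "e y = e y'"
        unfolding e_def using p_eq by (intro arg_cong[where f = Eps] ext) simp
      have "p y k = lin_comb m (p y') (\<alpha> y') k"
        unfolding \<alpha>[OF y(1)] using p_eq G2 by (intro lin_comb_cong) (auto simp: vec_eq_iff)
      then have pk: "p y k = p y' k" using \<alpha>[OF y(2)] by simp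
      show "y = y'"
      proof (rule det[OF e(3)[OF y(1)] e(2)[OF y(1)] yS])
        fix j assume j: "j < r"
        show "y *\<^sub>v e y j = y' *\<^sub>v e y j"
        proof (cases "j < k")
          case True
          then have "p y (Suc j) = p y' (Suc j)" using p_eq[of "Suc j"] pk by (cases "Suc j = k") auto
          then have "(d - y) *\<^sub>v p y j = (d - y') *\<^sub>v p y j"
            using p_eq[OF True] by (simp add: p_def)
          then have *: "d *\<^sub>v p y j - y *\<^sub>v p y j = d *\<^sub>v p y j - y' *\<^sub>v p y j"
            using d yc[OF yS(1)] yc[OF yS(2)] p_carrier[OF yS(1), of j]
            by (simp add: minus_mult_distrib_mat_vec[of _ m m])
          have "y *\<^sub>v p y j = y' *\<^sub>v p y j"
          proof (rule eq_vecI)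
            fix i assume "i < dim_vec (y' *\<^sub>v p y j)"
            then have "i < m" using yc[OF yS(2)] by simp
            then show "(y *\<^sub>v p y j) $ i = (y' *\<^sub>v p y j) $ i"
              using arg_cong[OF *, of "\<lambda>v. v $ i"] yc[OF yS(1)] yc[OF yS(2)]
              by (simp del: index_mult_mat_vec)
          qed (use yc[OF yS(1)] yc[OF yS(2)] in simp)
          then show ?thesis using e(1)[OF y(1)] True by simp
        next
          case False
          have "(y *\<^sub>v e y j) $ i = (y' *\<^sub>v e y' j) $ i" if "i < m" for i
            using arg_cong[OF G3, of "\<lambda>M. M $$ (i, j - k)"] that False j
            by (simp del: index_mult_mat_vec)
          then show ?thesis using yc[OF yS(1)] yc[OF yS(2)] e_eq
            by (intro eq_vecI) (simp_all del: index_mult_mat_vec)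
        qed
      qed
    qed
    have "card (B k) \<le> card (carrier_mat m (k - 1) \<times> carrier_vec k \<times> carrier_mat m (r - k) :: ('a mat \<times> 'a vec \<times> 'a mat) set)"
      by (rule card_inj_on_le[OF inj]) (auto simp: G_def)
    also have "\<dots> = CARD('a) ^ (m * (k - 1)) * (CARD('a) ^ k * CARD('a) ^ (m * (r - k)))"
      by (simp add: card_cartesian_product card_carrier_mat card_carrier_vec)
    finally show "card (B k) \<le> CARD('a) ^ (m * (k - 1)) * (CARD('a) ^ k * CARD('a) ^ (m * (r - k)))" .
  qed
  finally show ?thesis .
qed

lemma conj_inverse:
  fixes A P Q :: "'a :: comm_ring_1 mat"
  assumes "A \<in> carrier_mat n n" "P \<in> carrier_mat n n" "Q \<in> carrier_mat n n" "P * Q = 1\<^sub>m n"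
  shows "P * (Q * A * P) * Q = A"
proof -
  have "P * (Q * A * P) * Q = (P * Q) * A * (P * Q)"
    using assms(1-3) by (simp add: assoc_mult_mat[of _ n n _ n _ n] del: assms(4))
  then show ?thesis using assms by simp
qed

lemma conj_mult_vec:
  fixes A P Q :: "'a :: comm_ring_1 mat"
  assumes "A \<in> carrier_mat n n" "P \<in> carrier_mat n n" "Q \<in> carrier_mat n n" "v \<in> carrier_vec n"
  shows "(Q * A * P) *\<^sub>v v = Q *\<^sub>v (A *\<^sub>v (P *\<^sub>v v))"
  using assms by (simp add: assoc_mult_mat_vec[of _ n n _ n])

lemma similar_mat_conj:
  assumes "A \<in> carrier_mat n n" "P \<in> carrier_mat n n" "Q \<in> carrier_mat n n"
    "P * Q = 1\<^sub>m n" "Q * P = 1\<^sub>m n"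
  shows "similar_mat (Q * A * P) A"
  using assms by (intro similar_matI[of _ _ Q P n]) auto

lemma unit_vec_neq_0: "i < n \<Longrightarrow> unit_vec n i \<noteq> (0\<^sub>v n :: 'a :: field vec)"
  by (metis index_unit_vec(2) index_zero_vec(1) zero_neq_one)

text \<open>In the basis \<open>p\<close> only the last columns may differ. Transposition turns them
  into last rows, so \<open>eq_mat_if_char_poly_eq\<close> applies, and irreducibility makes the
  last unit vector cyclic.\<close>

lemma irreducible_char_poly_determined:
  fixes y y' :: "'a :: field mat"
  assumes h: "irreducible h" and y: "y \<in> carrier_mat m m" "char_poly y = h"
    and y': "y' \<in> carrier_mat m m" "char_poly y' = h"
    and p: "indep m p m" "\<And>j. j < m \<Longrightarrow> p j \<in> carrier_vec m"
    and eq: "\<And>j. j < m - 1 \<Longrightarrow> y *\<^sub>v p j = y' *\<^sub>v p j"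
  shows "y = y'"
proof (cases "m = 0")
  case True
  then show ?thesis using y y' by auto
next
  case False
  let ?P = "col_mat m p"
  from p have "det ?P \<noteq> 0" by (simp add: indep_det)
  from det_nonzero_inverse[OF col_mat_carrier this] obtain Q where
    Q: "Q \<in> carrier_mat m m" "?P * Q = 1\<^sub>m m" "Q * ?P = 1\<^sub>m m" by metis
  have cols: "col (Q * A * ?P) j = Q *\<^sub>v (A *\<^sub>v p j)" if "A \<in> carrier_mat m m" "j < m" for A j
  proof -
    have "col (Q * A * ?P) j = (Q * A) *\<^sub>v p j"
      using col_mult2[OF mult_carrier_mat[OF Q(1) that(1)] col_mat_carrier[of m p] that(2)] that(2) p(2)
      by (simp add: col_col_mat)
    also have "\<dots> = Q *\<^sub>v (A *\<^sub>v p j)"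
      by (rule assoc_mult_mat_vec) (use that Q p(2) in simp_all)
    finally show ?thesis .
  qed
  have QAP: "Q * A * ?P \<in> carrier_mat m m" if "A \<in> carrier_mat m m" for A
    by (rule mult_carrier_mat[OF mult_carrier_mat[OF Q(1) that] col_mat_carrier])
  let ?B = "transpose_mat (Q * y * ?P)" and ?B' = "transpose_mat (Q * y' * ?P)"
  have B: "?B \<in> carrier_mat m m" "?B' \<in> carrier_mat m m" using Q y y' by auto
  have cp: "char_poly (Q * A * ?P) = char_poly A" if "A \<in> carrier_mat m m" for A
    using similar_mat_conj[OF that col_mat_carrier Q(1) Q(2,3)] by (rule char_poly_similar)
  have cpB: "char_poly ?B = h" "char_poly ?B' = h"
    using y y' cp char_poly_transpose_mat[OF QAP[OF y(1)]] char_poly_transpose_mat[OF QAP[OF y'(1)]]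
    by simp_all
  have "?B = ?B'"
  proof (rule eq_mat_if_char_poly_eq[OF B])
    show "m - 1 < m" using False by simp
    show "?B $$ (i, j) = ?B' $$ (i, j)" if "i < m" "i \<noteq> m - 1" "j < m" for i j
    proof -
      have "?B $$ (i, j) = col (Q * y * ?P) i $ j" "?B' $$ (i, j) = col (Q * y' * ?P) i $ j"
        using that y y' Q by auto
      then show ?thesis using cols[OF y(1), of i] cols[OF y'(1), of i] eq[of i] that by simp
    qed
    show "x = 0\<^sub>v m" if "x \<in> carrier_vec m" "\<And>k. x \<bullet> krylov ?B (unit_vec m (m - 1)) k = 0" for x
    proof (rule cyclic_orthogonal_eq_0[OF B(1) unit_vec_carrier _ that])
      show "cyclic ?B (unit_vec m (m - 1))"
        by (rule irreducible_cyclic[OF B(1) unit_vec_carrier unit_vec_neq_0]) (use False h cpB(1) in auto)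
    qed
  qed (simp add: cpB)
  from arg_cong[OF this, of transpose_mat] have "Q * y * ?P = Q * y' * ?P" by simp
  then have "?P * (Q * y * ?P) * Q = ?P * (Q * y' * ?P) * Q" by (simp only:)
  then show ?thesis
    by (simp only: conj_inverse[OF y(1) col_mat_carrier Q(1,2)] conj_inverse[OF y'(1) col_mat_carrier Q(1,2)])
qed

text \<open>By the preceding lemma, applied to the unit vectors, the first \<open>m - 1\<close>
  columns determine such a matrix.\<close>

lemma card_irreducible_char_poly_le:
  fixes h :: "'a :: {field, finite} poly"
  assumes h: "irreducible h"
  shows "card {y \<in> carrier_mat m m. char_poly y = h} \<le> CARD('a) ^ (m * (m - 1))"
proof -
  let ?G = "\<lambda>y :: 'a mat. mat m (m - 1) (($$) y)"
  have "inj_on ?G {y \<in> carrier_mat m m. char_poly y = h}"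
  proof (rule inj_onI)
    fix y y' assume y: "y \<in> {y \<in> carrier_mat m m. char_poly y = h}"
      "y' \<in> {y \<in> carrier_mat m m. char_poly y = h}" "?G y = ?G y'"
    have "y *\<^sub>v unit_vec m j = y' *\<^sub>v unit_vec m j" if j: "j < m - 1" for j
    proof (rule eq_vecI)
      fix i assume "i < dim_vec (y' *\<^sub>v unit_vec m j)"
      then have "i < m" using y by auto
      then show "(y *\<^sub>v unit_vec m j) $ i = (y' *\<^sub>v unit_vec m j) $ i"
        using arg_cong[OF y(3), of "\<lambda>M. M $$ (i, j)"] j y(1,2) by (auto simp: scalar_prod_unit[of _ m])
    qed (use y in auto)
    then show "y = y'"
      using y h indep_unit_vec by (intro irreducible_char_poly_determined[of h y m y' "unit_vec m"]) auto
  qed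
  moreover have "?G ` {y \<in> carrier_mat m m. char_poly y = h} \<subseteq> carrier_mat m (m - 1)" by auto
  ultimately show ?thesis
    using card_inj_on_le[of ?G _ "carrier_mat m (m - 1)"] by (simp add: card_carrier_mat)
qed

text \<open>Conjugation by the map that sends the Krylov basis of \<open>A\<close> at a unit vector
  to \<open>p\<close> carries the Krylov sequence along. So every basis consists of the first
  \<open>m\<close> Krylov vectors of some conjugate of \<open>A\<close>.\<close>

lemma exists_char_poly_krylov_eq:
  fixes p :: "nat \<Rightarrow> 'a :: field vec"
  assumes A: "A \<in> carrier_mat m m" "irreducible (char_poly A)" and m: "0 < m"
    and p: "indep m p m" "\<And>j. j < m \<Longrightarrow> p j \<in> carrier_vec m"
  shows "\<exists>B \<in> carrier_mat m m. char_poly B = char_poly A \<and> (\<forall>j<m. krylov B (p 0) j = p j)"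
proof -
  let ?u = "unit_vec m 0 :: 'a vec"
  let ?K = "col_mat m (krylov A ?u)" and ?P = "col_mat m p"
  have kc: "krylov A ?u j \<in> carrier_vec m" for j using A by simp
  have "cyclic A ?u"
    by (rule irreducible_cyclic[OF A(1) unit_vec_carrier unit_vec_neq_0[OF m] A(2)])
  then have "det ?K \<noteq> 0" using A(1) by (simp add: cyclic_def indep_det)
  from det_nonzero_inverse[OF col_mat_carrier this] obtain L where
    L: "L \<in> carrier_mat m m" "?K * L = 1\<^sub>m m" "L * ?K = 1\<^sub>m m" by metis
  from p(1) have "det ?P \<noteq> 0" by (simp add: indep_det)
  from det_nonzero_inverse[OF col_mat_carrier this] obtain R where
    R: "R \<in> carrier_mat m m" "?P * R = 1\<^sub>m m" "R * ?P = 1\<^sub>m m" by metis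
  define U where "U = ?P * L"
  define V where "V = ?K * R"
  have U: "U \<in> carrier_mat m m" unfolding U_def by (rule mult_carrier_mat[OF col_mat_carrier L(1)])
  have V: "V \<in> carrier_mat m m" unfolding V_def by (rule mult_carrier_mat[OF col_mat_carrier R(1)])
  have inv: "(X * Y) * (Y' * X') = 1\<^sub>m m"
    if "X \<in> carrier_mat m m" "Y \<in> carrier_mat m m" "Y' \<in> carrier_mat m m" "X' \<in> carrier_mat m m"
      "Y * Y' = 1\<^sub>m m" "X * X' = 1\<^sub>m m" for X Y X' Y' :: "'a mat"
  proof -
    have "(X * Y) * (Y' * X') = X * (Y * (Y' * X'))"
      by (rule assoc_mult_mat) (use that in auto)
    also have "Y * (Y' * X') = (Y * Y') * X'"
      by (rule assoc_mult_mat[symmetric]) (use that in auto)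
    finally show ?thesis using that by simp
  qed
  have UV: "U * V = 1\<^sub>m m" unfolding U_def V_def
    by (rule inv[OF col_mat_carrier L(1) col_mat_carrier R(1) L(3) R(2)])
  have VU: "V * U = 1\<^sub>m m" unfolding U_def V_def
    by (rule inv[OF col_mat_carrier R(1) col_mat_carrier L(1) R(3) L(2)])
  have Uk: "U *\<^sub>v krylov A ?u j = p j" if "j < m" for j
  proof -
    have col: "col_mat m e *\<^sub>v unit_vec m j = e j" if "e j \<in> carrier_vec m" for e :: "nat \<Rightarrow> 'a vec"
      using that \<open>j < m\<close> by (intro eq_vecI) (auto simp: scalar_prod_unit[of _ m] col_mat_def)
    have "U *\<^sub>v krylov A ?u j = U *\<^sub>v (?K *\<^sub>v unit_vec m j)"
      by (simp only: col[OF kc])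
    also have "\<dots> = ?P *\<^sub>v (L *\<^sub>v (?K *\<^sub>v unit_vec m j))"
      unfolding U_def by (rule assoc_mult_mat_vec[OF col_mat_carrier L(1)]) (simp add: mult_mat_vec_carrier[OF col_mat_carrier])
    also have "L *\<^sub>v (?K *\<^sub>v unit_vec m j) = (L * ?K) *\<^sub>v unit_vec m j"
      by (rule assoc_mult_mat_vec[symmetric, OF L(1) col_mat_carrier]) simp
    also have "?P *\<^sub>v \<dots> = p j" using col[of p] p(2)[OF that] L(3) by simp
    finally show ?thesis .
  qed
  let ?B = "U * A * V"
  have B: "?B \<in> carrier_mat m m" by (rule mult_carrier_mat[OF mult_carrier_mat[OF U A(1)] V])
  have sim: "similar_mat ?B A" by (rule similar_mat_conj[OF A(1) V U VU UV])
  have "krylov ?B (p 0) j = p j" if "j < m" for j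
    using that
  proof (induction j)
    case (Suc j)
    have "krylov ?B (p 0) (Suc j) = ?B *\<^sub>v p j" using Suc by simp
    also have "\<dots> = U *\<^sub>v (A *\<^sub>v (V *\<^sub>v p j))"
      using p(2)[of j] Suc.prems by (intro conj_mult_vec[OF A(1) V U]) auto
    also have "V *\<^sub>v p j = V *\<^sub>v (U *\<^sub>v krylov A ?u j)" using Uk[of j] Suc.prems by simp
    also have "\<dots> = (V * U) *\<^sub>v krylov A ?u j"
      by (rule assoc_mult_mat_vec[symmetric, OF V U kc])
    also have "U *\<^sub>v (A *\<^sub>v \<dots>) = U *\<^sub>v krylov A ?u (Suc j)"
      unfolding VU using kc[of j] by simp
    also have "\<dots> = p (Suc j)" by (rule Uk[OF Suc.prems])
    finally show ?case .
  qed simp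
  with B char_poly_similar[OF sim] show ?thesis by blast
qed

text \<open>This is the bound of \<open>card_not_cyclic_le\<close> for \<open>r = m\<close>, the
  case of all matrices. For \<open>r = m - 1\<close>, the case of a fixed irreducible characteristic
  polynomial, the bound is smaller by the factor q^m.\<close>

definition excess :: "nat \<Rightarrow> nat \<Rightarrow> nat" where
  "excess q m = (\<Sum>k\<in>{1..<m}. q ^ (m * (k - 1)) * (q ^ k * q ^ (m * (m - k))))"

text \<open>Each summand is \<open>q^(m(m-1)) q^k\<close>, so the sum is geometric.\<close>

lemma excess_le:
  assumes q: "2 \<le> q"
  shows "(q - 1) * excess q m \<le> q ^ (m * m)"
proof -
  have "excess q m = (\<Sum>k\<in>{1..<m}. q ^ (m * (m - 1)) * q ^ k)"
    unfolding excess_def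
  proof (rule sum.cong)
    fix k assume k: "k \<in> {1..<m}"
    then have "m * (k - 1) + m * (m - k) = m * (m - 1)"
      by (auto simp: algebra_simps simp flip: distrib_left)
    then have "q ^ (m * (k - 1)) * q ^ (m * (m - k)) = q ^ (m * (m - 1))"
      by (simp flip: power_add)
    then show "q ^ (m * (k - 1)) * (q ^ k * q ^ (m * (m - k))) = q ^ (m * (m - 1)) * q ^ k"
      by (simp add: mult_ac)
  qed simp
  also have "\<dots> = q ^ (m * (m - 1)) * (\<Sum>k\<in>{1..<m}. q ^ k)" by (simp add: sum_distrib_left)
  finally have eq: "excess q m = q ^ (m * (m - 1)) * (\<Sum>k\<in>{1..<m}. q ^ k)" .
  have geo: "(q - 1) * (\<Sum>k<m. q ^ k) \<le> q ^ m"
  proof (induction m)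
    case (Suc m)
    have "(q - 1) * (\<Sum>k<Suc m. q ^ k) \<le> q ^ m + (q - 1) * q ^ m"
      using Suc by (simp add: algebra_simps)
    also have "\<dots> = q ^ Suc m" using q by (cases q) auto
    finally show ?case .
  qed simp
  have "(q - 1) * excess q m = q ^ (m * (m - 1)) * ((q - 1) * (\<Sum>k\<in>{1..<m}. q ^ k))"
    by (simp add: eq)
  also have "\<dots> \<le> q ^ (m * (m - 1)) * ((q - 1) * (\<Sum>k<m. q ^ k))"
    by (intro mult_left_mono sum_mono2) auto
  also have "\<dots> \<le> q ^ (m * (m - 1)) * q ^ m" by (intro mult_left_mono geo) simp
  also have "\<dots> = q ^ (m * m)" by (cases m) (simp_all add: algebra_simps flip: power_add)
  finally show ?thesis .
qed

text \<open>All but \<open>excess\<close> many matrices have the first unit vector as a cyclic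
  vector. Such a matrix is determined by its Krylov vectors of index 0 to \<open>m\<close>. The
  first \<open>m\<close> of them are also those of some matrix with characteristic polynomial
  \<open>h\<close>, which leaves one vector and hence the factor q^m.\<close>

lemma card_irreducible_char_poly_ge:
  fixes h :: "'a :: {field, finite} poly"
  assumes h: "irreducible h" "degree h = m" "monic h" and m: "0 < m"
  shows "CARD('a) ^ (m * m) \<le>
    CARD('a) ^ m * card {y \<in> carrier_mat m m. char_poly y = h} + excess CARD('a) m"
proof -
  let ?M = "carrier_mat m m :: 'a mat set" and ?c = "unit_vec m 0 :: 'a vec"
  let ?C = "{y \<in> ?M. char_poly y = h}" and ?z = "0\<^sub>m m m :: 'a mat"
  \<comment> \<open>With \<open>?z = 0\<close> cyclicity is asked of \<open>- y\<close>, the form to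
    which \<open>card_not_cyclic_le\<close> applies, here with \<open>r = m\<close>.\<close>
  let ?N = "{y \<in> ?M. \<not> cyclic (?z - y) ?c}" and ?Y = "{y \<in> ?M. cyclic (?z - y) ?c}"
  obtain A where A: "A \<in> ?M" "char_poly A = h"
    using exists_char_poly_eq[of h "m - 1"] h m by auto
  have "card ?N \<le> excess CARD('a) m"
    unfolding excess_def
    using m by (intro card_not_cyclic_le unit_vec_neq_0 indep_eq_mat[of _ m m]) auto
  moreover have "card ?Y \<le> card (?C \<times> (carrier_vec m :: 'a vec set))"
  proof (rule card_inj_on_le)
    define B where "B y = (SOME B. B \<in> ?M \<and> char_poly B = h \<and>
      (\<forall>j<m. krylov B ?c j = krylov (?z - y) ?c j))" for y
    let ?F = "\<lambda>y. (B y, krylov (?z - y) ?c m)"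
    have diff: "?z - y \<in> ?M" if "y \<in> ?M" for y using that by (rule minus_carrier_mat)
    have B: "B y \<in> ?M \<and> char_poly (B y) = h \<and> (\<forall>j<m. krylov (B y) ?c j = krylov (?z - y) ?c j)"
      if "y \<in> ?Y" for y
    proof -
      have "\<exists>B \<in> ?M. char_poly B = char_poly A \<and>
        (\<forall>j<m. krylov B (krylov (?z - y) ?c 0) j = krylov (?z - y) ?c j)"
        using that diff[of y] A h(1) m by (intro exists_char_poly_krylov_eq) (auto simp: cyclic_def)
      then have "\<exists>B. B \<in> ?M \<and> char_poly B = h \<and> (\<forall>j<m. krylov B ?c j = krylov (?z - y) ?c j)"
        using A(2) by auto
      from someI_ex[OF this] show ?thesis unfolding B_def .
    qed
    show "?F ` ?Y \<subseteq> ?C \<times> carrier_vec m"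
      using B diff by auto
    show "inj_on ?F ?Y"
    proof (rule inj_onI)
      fix y y' assume y: "y \<in> ?Y" "y' \<in> ?Y" "?F y = ?F y'"
      have y_carrier: "y \<in> ?M" "y' \<in> ?M" using y by auto
      have eq: "krylov (?z - y) ?c j = krylov (?z - y') ?c j" if "j \<le> m" for j
        using B[OF y(1)] B[OF y(2)] y(3) that by (cases "j = m") auto
      have "?z - y = ?z - y'"
      proof (rule indep_eq_mat[OF diff diff])
        show "indep m (krylov (?z - y) ?c) m" using y(1) diff[of y] by (auto simp: cyclic_def)
        show "(?z - y) *\<^sub>v krylov (?z - y) ?c j = (?z - y') *\<^sub>v krylov (?z - y) ?c j" if "j < m" for j
          using eq[of "Suc j"] eq[of j] that by simp
      qed (use y_carrier diff in auto)
      then have "(?z - y) $$ (i, j) = (?z - y') $$ (i, j)" for i j by simp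
      then show "y = y'" using y_carrier by (intro eq_matI) (metis carrier_matD index_minus_mat(1) index_zero_mat(1) diff_left_imp_eq)+
    qed
  qed simp
  moreover have "card ?M = card ?Y + card ?N"
    by (subst card_Un_disjoint[symmetric]) (auto intro: arg_cong[where f = card])
  ultimately show ?thesis
    by (simp add: card_carrier_mat card_carrier_vec card_cartesian_product mult.commute)
qed

text \<open>There are two losses, each of at most \<open>excess / q^m\<close>: in the lower bound
  for the number of matrices with characteristic polynomial \<open>h\<close>, and among these the
  ones for which \<open>c\<close> is not cyclic. As \<open>excess\<close> is at most
  \<open>q^(m m) / (q - 1)\<close>, both together lower q - 1 to q - 3, which is negative for q = 2
  and therefore a real number here.\<close>

theorem card_cyclic_diff_ge:
  fixes h :: "'a :: {field, finite} poly"
  assumes h: "irreducible h" "degree h = m" "monic h" and m: "0 < m"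
    and d: "d \<in> carrier_mat m m" and c: "c \<in> carrier_vec m" "c \<noteq> 0\<^sub>v m"
  defines "G \<equiv> card {y \<in> carrier_mat m m. char_poly y = h \<and> cyclic (d - y) c}"
  shows "(real CARD('a) - 3) * real CARD('a) ^ (m * (m - 1)) \<le> (real CARD('a) - 1) * real G"
proof -
  let ?q = "CARD('a)"
  let ?C = "{y \<in> carrier_mat m m. char_poly y = h}"
  let ?N = "{y \<in> ?C. \<not> cyclic (d - y) c}"
  have "card ?N \<le> (\<Sum>k\<in>{1..<m}. ?q ^ (m * (k - 1)) * (?q ^ k * ?q ^ (m * (m - 1 - k))))"
    using m by (intro card_not_cyclic_le d c irreducible_char_poly_determined[OF h(1)]) auto
  then have "?q ^ m * card ?N \<le> ?q ^ m * \<dots>" by (rule mult_left_mono) simp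
  also have "\<dots> = excess ?q m"
    unfolding excess_def sum_distrib_left
  proof (rule sum.cong)
    fix k assume k: "k \<in> {1..<m}"
    then have "m + m * (m - 1 - k) = m * (m - k)"
      by (metis Suc_diff_Suc atLeastLessThan_iff diff_Suc_eq_diff_pred mult_Suc_right)
    then have "?q ^ m * ?q ^ (m * (m - 1 - k)) = ?q ^ (m * (m - k))" by (simp flip: power_add)
    then show "?q ^ m * (?q ^ (m * (k - 1)) * (?q ^ k * ?q ^ (m * (m - 1 - k)))) =
        ?q ^ (m * (k - 1)) * (?q ^ k * ?q ^ (m * (m - k)))"
      by (simp add: mult_ac)
  qed simp
  finally have N: "?q ^ m * card ?N \<le> excess ?q m" .
  have "card ?C = G + card ?N"
    unfolding G_def
    by (subst card_Un_disjoint[symmetric]) (auto intro: arg_cong[where f = card])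
  with card_irreducible_char_poly_ge[OF h m] N
  have "?q ^ (m * m) \<le> ?q ^ m * G + 2 * excess ?q m" by (simp add: algebra_simps)
  then have "(?q - 1) * ?q ^ (m * m) \<le> (?q - 1) * (?q ^ m * G + 2 * excess ?q m)"
    by (rule mult_left_mono) simp
  also have "\<dots> \<le> (?q - 1) * (?q ^ m * G) + 2 * ?q ^ (m * m)"
    using excess_le[OF card_field_ge_2, of m, where ?'a1 = 'a] by (simp add: algebra_simps)
  finally have "real ((?q - 1) * ?q ^ (m * m)) \<le> real ((?q - 1) * (?q ^ m * G) + 2 * ?q ^ (m * m))"
    by (rule of_nat_mono)
  then have "(real ?q - 1) * real ?q ^ (m * m) \<le> (real ?q - 1) * (real ?q ^ m * real G) + 2 * real ?q ^ (m * m)"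
    using card_field_ge_2[where ?'a = 'a] by (simp add: of_nat_diff)
  moreover have "real ?q ^ (m * m) = real ?q ^ m * real ?q ^ (m * (m - 1))"
    using m by (cases m) (simp_all flip: power_add)
  ultimately have "real ?q ^ m * ((real ?q - 3) * real ?q ^ (m * (m - 1))) \<le> real ?q ^ m * ((real ?q - 1) * real G)"
    by (simp add: algebra_simps)
  then show ?thesis using card_field_ge_2[where ?'a = 'a] by (simp add: mult_le_cancel_left)
qed

text \<open>If every vector were mapped to a multiple of itself, the unit vectors would make
  \<open>z\<close> diagonal and the all-ones vector would make its diagonal constant.\<close>

lemma exists_non_eigenvector:
  fixes z :: "'a :: field mat"
  assumes z: "z \<in> carrier_mat n n" and ns: "\<not> scalar_mat n z"
  shows "\<exists>v \<in> carrier_vec n. \<forall>k. z *\<^sub>v v \<noteq> k \<cdot>\<^sub>v v"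
proof (rule ccontr)
  assume "\<not> ?thesis"
  then have eig: "\<exists>k. z *\<^sub>v v = k \<cdot>\<^sub>v v" if "v \<in> carrier_vec n" for v using that by blast
  have "\<forall>j. \<exists>k. z *\<^sub>v unit_vec n j = k \<cdot>\<^sub>v unit_vec n j" using eig by simp
  then obtain k where k: "\<And>j. z *\<^sub>v unit_vec n j = k j \<cdot>\<^sub>v unit_vec n j" by metis
  have ij: "z $$ (i, j) = (if i = j then k j else 0)" if "i < n" "j < n" for i j
    using arg_cong[OF k[of j], of "\<lambda>v. v $ i"] z that by (auto simp: scalar_prod_unit[of _ n])
  from eig[of "vec n (\<lambda>_. 1)"] obtain l where l: "z *\<^sub>v vec n (\<lambda>_. 1) = l \<cdot>\<^sub>v vec n (\<lambda>_. 1)" by auto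
  have "k i = l" if "i < n" for i
  proof -
    have "k i = (\<Sum>j<n. z $$ (i, j) * vec n (\<lambda>_. 1) $ j)" using that by (simp add: ij)
    also have "\<dots> = (z *\<^sub>v vec n (\<lambda>_. 1)) $ i"
      using z that by (subst mult_mat_vec_index_sum[of _ n n]) auto
    also have "\<dots> = l" unfolding l using that by simp
    finally show ?thesis .
  qed
  then have "z = l \<cdot>\<^sub>m 1\<^sub>m n" using z by (intro eq_matI) (auto simp: ij)
  with ns show False by (auto simp: scalar_mat_def)
qed

text \<open>A line parallel to a vector that is not an eigenvector contains at most two eigenvectors.\<close>
lemma card_eigenvectors_le:
  fixes z :: "'a :: {field, finite} mat"
  assumes z: "z \<in> carrier_mat n n" and ns: "\<not> scalar_mat n z"
  shows "CARD('a) * card {v \<in> carrier_vec n. \<exists>k. z *\<^sub>v v = k \<cdot>\<^sub>v v} \<le> 2 * CARD('a) ^ n"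
proof -
  let ?E = "{v \<in> carrier_vec n. \<exists>k. z *\<^sub>v v = k \<cdot>\<^sub>v v}"
  obtain v0 where v0: "v0 \<in> carrier_vec n" "\<And>k. z *\<^sub>v v0 \<noteq> k \<cdot>\<^sub>v v0"
    using exists_non_eigenvector[OF assms] by blast
  have v0_0: "v0 \<noteq> 0\<^sub>v n" using v0(2)[of 0] z by auto
  have three: False
    if a: "a \<in> ?E" and s: "s \<noteq> 0" "a + s \<cdot>\<^sub>v v0 \<in> ?E" and t: "t \<noteq> 0" "a + t \<cdot>\<^sub>v v0 \<in> ?E" and st: "s \<noteq> t" for a s t
  proof -
    have ac: "a \<in> carrier_vec n" using a by simp
    from a obtain k where k: "z *\<^sub>v a = k \<cdot>\<^sub>v a" by auto
    have rel: "\<exists>l. \<forall>i<n. (z *\<^sub>v v0) $ i = (l - k) / r * a $ i + l * v0 $ i"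
      if r: "r \<noteq> 0" "a + r \<cdot>\<^sub>v v0 \<in> ?E" for r
    proof -
      from r obtain l where l: "z *\<^sub>v (a + r \<cdot>\<^sub>v v0) = l \<cdot>\<^sub>v (a + r \<cdot>\<^sub>v v0)" by auto
      have "z *\<^sub>v (a + r \<cdot>\<^sub>v v0) = k \<cdot>\<^sub>v a + r \<cdot>\<^sub>v (z *\<^sub>v v0)"
        using z ac v0(1) k by (simp add: mult_add_distrib_mat_vec[of _ n n] mult_mat_vec[of _ n n])
      then have eq: "k \<cdot>\<^sub>v a + r \<cdot>\<^sub>v (z *\<^sub>v v0) = l \<cdot>\<^sub>v (a + r \<cdot>\<^sub>v v0)" using l by simp
      have "k * a $ i + r * (z *\<^sub>v v0) $ i = l * (a $ i + r * v0 $ i)" if "i < n" for i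
        using arg_cong[OF eq, of "\<lambda>v. v $ i"] that z ac v0(1)
        by (simp del: index_mult_mat_vec)
      then show ?thesis using r(1) by (intro exI[of _ l]) (auto simp: field_simps)
    qed
    from rel[OF s] obtain l where l: "\<And>i. i < n \<Longrightarrow> (z *\<^sub>v v0) $ i = (l - k) / s * a $ i + l * v0 $ i" by auto
    from rel[OF t] obtain l' where l': "\<And>i. i < n \<Longrightarrow> (z *\<^sub>v v0) $ i = (l' - k) / t * a $ i + l' * v0 $ i" by auto
    have nmul: False if "\<And>i. i < n \<Longrightarrow> (z *\<^sub>v v0) $ i = b * v0 $ i" for b
    proof -
      have "z *\<^sub>v v0 = b \<cdot>\<^sub>v v0" using that z v0(1) by (intro eq_vecI) (auto simp del: index_mult_mat_vec)
      with v0(2) show False by blast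
    qed
    \<comment> \<open>Comparing the two expressions for \<open>z v0\<close> yields a linear relation
      between \<open>a\<close> and \<open>v0\<close>. A nonzero \<open>\<alpha>\<close> makes
      \<open>a\<close>, and with it \<open>z v0\<close>, a multiple of \<open>v0\<close>; otherwise
      the three eigenvalues agree, with the same result.\<close>
    define \<alpha> where "\<alpha> = (l - k) / s - (l' - k) / t"
    have \<alpha>: "\<alpha> * a $ i = (l' - l) * v0 $ i" if "i < n" for i
      using l[OF that] l'[OF that] by (simp add: \<alpha>_def algebra_simps)
    have "\<alpha> = 0"
    proof (rule ccontr)
      assume "\<alpha> \<noteq> 0"
      define \<beta> where "\<beta> = (l' - l) / \<alpha>"
      have a: "a $ i = \<beta> * v0 $ i" if "i < n" for i
        using \<alpha>[OF that] \<open>\<alpha> \<noteq> 0\<close> by (simp add: \<beta>_def field_simps)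
      define \<gamma> where "\<gamma> = (l - k) / s"
      show False
        using l by (intro nmul[of "\<gamma> * \<beta> + l"]) (simp add: a \<gamma>_def[symmetric] algebra_simps)
    qed
    moreover have "l' = l"
    proof (rule ccontr)
      assume neq: "l' \<noteq> l"
      have "v0 $ i = 0" if "i < n" for i
      proof -
        have "(l' - l) * v0 $ i = 0" unfolding \<alpha>[OF that, symmetric] \<open>\<alpha> = 0\<close> by simp
        with neq show ?thesis by simp
      qed
      then have "v0 = 0\<^sub>v n" by (intro eq_vecI) (simp_all add: carrier_vecD[OF v0(1)])
      with v0_0 show False by contradiction
    qed
    ultimately have "(l - k) * (t - s) = 0" using s(1) t(1) by (simp add: \<alpha>_def field_simps)
    then have "l = k" using st by simp
    then show False using l by (intro nmul[of l]) simp
  qed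
  have two: "card {t. w - t \<cdot>\<^sub>v v0 \<in> ?E} \<le> 2" if w: "w \<in> carrier_vec n" for w
  proof (rule ccontr)
    assume "\<not> ?thesis"
    then have "3 \<le> card {t. w - t \<cdot>\<^sub>v v0 \<in> ?E}" by simp
    then obtain T where T: "T \<subseteq> {t. w - t \<cdot>\<^sub>v v0 \<in> ?E}" "card T = 3"
      by (rule obtain_subset_with_card_n)
    then obtain t1 t2 t3 where t: "T = {t1, t2, t3}" "t1 \<noteq> t2" "t1 \<noteq> t3" "t2 \<noteq> t3"
      by (auto simp: card_3_iff)
    have shift: "w - t' \<cdot>\<^sub>v v0 = (w - t1 \<cdot>\<^sub>v v0) + (t1 - t') \<cdot>\<^sub>v v0" for t'
      using w v0(1) by (intro eq_vecI) (auto simp: algebra_simps)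
    show False
      using three[of "w - t1 \<cdot>\<^sub>v v0" "t1 - t2" "t1 - t3"] T(1) t
      by (simp add: shift[of t2, symmetric] shift[of t3, symmetric])
  qed
  \<comment> \<open>Pairs \<open>(v, t)\<close> are counted by the point \<open>w = v + t v0\<close>
    on the line through \<open>v\<close>; this avoids choosing representatives of the lines.\<close>
  let ?S = "SIGMA w:carrier_vec n. {t. w - t \<cdot>\<^sub>v v0 \<in> ?E}"
  have "card (?E \<times> (UNIV :: 'a set)) \<le> card ?S"
  proof (rule card_inj_on_le)
    let ?f = "\<lambda>(v, t). (v + t \<cdot>\<^sub>v v0, t)"
    have cancel: "(v + t \<cdot>\<^sub>v v0) - t \<cdot>\<^sub>v v0 = v" if "v \<in> carrier_vec n" for v t
      using that v0(1) by (intro eq_vecI) auto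
    show "inj_on ?f (?E \<times> UNIV)"
    proof (rule inj_onI)
      fix x y assume xy: "x \<in> ?E \<times> UNIV" "y \<in> ?E \<times> UNIV" "?f x = ?f y"
      obtain v t where x: "x = (v, t)" by (cases x)
      obtain v' t' where y: "y = (v', t')" by (cases y)
      from xy(3) have t: "t = t'" and eq: "v + t \<cdot>\<^sub>v v0 = v' + t' \<cdot>\<^sub>v v0"
        unfolding x y by auto
      from xy(1,2) have vc: "v \<in> carrier_vec n" "v' \<in> carrier_vec n" unfolding x y by auto
      from arg_cong[OF eq[unfolded t], of "\<lambda>x. x - t' \<cdot>\<^sub>v v0"] have "v = v'"
        by (simp only: cancel[OF vc(1)] cancel[OF vc(2)])
      with t show "x = y" by (simp add: x y)
    qed
    show "?f ` (?E \<times> UNIV) \<subseteq> ?S" using v0(1) cancel by auto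
  qed simp
  also have "card ?S = (\<Sum>w\<in>carrier_vec n. card {t. w - t \<cdot>\<^sub>v v0 \<in> ?E})" by simp
  also have "\<dots> \<le> (\<Sum>w\<in>(carrier_vec n :: 'a vec set). 2)" by (rule sum_mono) (rule two)
  finally show ?thesis by (simp add: card_cartesian_product card_carrier_vec mult.commute)
qed

section \<open>Counting decompositions\<close>

text \<open>As \<open>l\<close> is not a root of \<open>h\<close>, the linear factor is coprime to
  \<open>h\<close>.\<close>

lemma dvd_linear_mult_cancel:
  fixes h :: "'a :: field poly"
  assumes h: "poly h l \<noteq> 0" and dvd: "h dvd [:- l, 1:] * s"
  shows "h dvd s"
proof -
  from dvd obtain w where w: "[:- l, 1:] * s = h * w" ..
  have "poly (h * w) l = 0" by (simp flip: w)
  with h have "[:- l, 1:] dvd w" by (simp add: poly_eq_0_iff_dvd)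
  then obtain w' where "w = [:- l, 1:] * w'" ..
  with w have "[:- l, 1:] * s = [:- l, 1:] * (h * w')" by (simp only: mult.left_commute)
  then have "s = h * w'" by (subst (asm) mult_left_cancel) auto
  then show ?thesis by simp
qed

lemma irreducible_degree_pos: "irreducible (h :: 'a :: field poly) \<Longrightarrow> 0 < degree h"
  by (rule ccontr) (auto simp: irreducible_def is_unit_iff_degree)

text \<open>The sum of an eigenvector \<open>u1\<close> for \<open>l\<close> and a nonzero vector
  \<open>u2\<close> killed by \<open>h(y)\<close> is cyclic: its annihilators are divisible by the
  coprime polynomials \<open>T - l\<close> and \<open>h\<close>, so the nonzero ones have degree at
  least \<open>Suc m\<close>.\<close>

lemma exists_cyclic_linear_times_irreducible:
  fixes y :: "'a :: field mat"
  assumes y: "y \<in> carrier_mat (Suc m) (Suc m)" and cp: "char_poly y = [:- l, 1:] * h"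
    and h: "irreducible h" "degree h = m" "poly h l \<noteq> 0"
  shows "\<exists>c \<in> carrier_vec (Suc m). cyclic y c"
proof -
  let ?n = "Suc m" and ?L = "[:- l, 1:] :: 'a poly"
  have m: "0 < m" using irreducible_degree_pos[OF h(1)] h(2) by simp
  have act_L: "poly_act y ?L v = y *\<^sub>v v + (- l) \<cdot>\<^sub>v v" if "v \<in> carrier_vec ?n" for v
    by (rule poly_act_linear[OF y that])
  have "eigenvalue y l" unfolding eigenvalue_root_char_poly[OF y] by (simp add: cp)
  then obtain u1 where u1: "u1 \<in> carrier_vec ?n" "u1 \<noteq> 0\<^sub>v ?n" "y *\<^sub>v u1 = l \<cdot>\<^sub>v u1"
    using y by (auto simp: eigenvalue_def eigenvector_def)
  have L_u1: "poly_act y ?L u1 = 0\<^sub>v ?n"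
    using u1 y by (simp add: act_L) (intro eq_vecI, auto)
  \<comment> \<open>By Cayley-Hamilton \<open>h(y)\<close> kills every value of
    \<open>y - l\<close>. If all these values were 0, \<open>y\<close> would be scalar and
    \<open>h\<close> the characteristic polynomial of \<open>l\<close> times the identity of size
    \<open>m\<close>, against \<open>h(l)\<close> being nonzero.\<close>
  have "\<exists>t \<in> carrier_vec ?n. poly_act y ?L t \<noteq> 0\<^sub>v ?n"
  proof (rule ccontr)
    assume "\<not> ?thesis"
    then have *: "poly_act y ?L (unit_vec ?n j) = 0\<^sub>v ?n" for j by simp
    have ij: "y $$ (i, j) = (if i = j then l else 0)" if "i < ?n" "j < ?n" for i j
    proof -
      have "y *\<^sub>v unit_vec ?n j + (- l) \<cdot>\<^sub>v unit_vec ?n j = 0\<^sub>v ?n"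
        using *[of j] by (simp add: act_L)
      from arg_cong[OF this, of "\<lambda>v. v $ i"] show ?thesis
        using that y by (auto simp: scalar_prod_unit[of _ ?n] split: if_splits)
    qed
    have "y = bordered l (0\<^sub>v m) (0\<^sub>v m) (l \<cdot>\<^sub>m 1\<^sub>m m)"
      using y by (intro eq_matI) (auto simp: ij bordered_def)
    then have "?L * h = ?L * char_poly (l \<cdot>\<^sub>m 1\<^sub>m m :: 'a mat)"
      using cp char_poly_bordered_0[of "l \<cdot>\<^sub>m 1\<^sub>m m :: 'a mat" m l "0\<^sub>v m"] by simp
    then have "h = char_poly (l \<cdot>\<^sub>m 1\<^sub>m m :: 'a mat)" by (subst (asm) mult_left_cancel) auto
    moreover have "eigenvector (l \<cdot>\<^sub>m 1\<^sub>m m :: 'a mat) (unit_vec m 0) l"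
      using unit_vec_neq_0[OF m, where ?'a = 'a]
      by (auto simp: eigenvector_def scalar_prod_unit[of _ m] intro!: eq_vecI)
    ultimately show False
      using eigenvalue_root_char_poly[of "l \<cdot>\<^sub>m 1\<^sub>m m :: 'a mat" m l] h(3)
      by (auto simp: eigenvalue_def)
  qed
  then obtain t where t: "t \<in> carrier_vec ?n" "poly_act y ?L t \<noteq> 0\<^sub>v ?n" by blast
  define u2 where "u2 = poly_act y ?L t"
  have u2: "u2 \<in> carrier_vec ?n" "u2 \<noteq> 0\<^sub>v ?n" using t y by (simp_all add: u2_def)
  have h_u2: "poly_act y h u2 = 0\<^sub>v ?n"
    using cayley_hamilton[OF y t(1)] unfolding cp u2_def
    by (simp only: mult.commute[of ?L] poly_act_mult[OF y t(1)])
  let ?c = "u1 + u2"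
  have zero: "poly_act y p (0\<^sub>v ?n) = 0\<^sub>v ?n" for p by (rule poly_act_zero_vec[OF y])
  have "p = 0" if p: "degree p < ?n" "poly_act y p ?c = 0\<^sub>v ?n" for p
  proof (rule ccontr)
    assume p0: "p \<noteq> 0"
    have split: "poly_act y (r * p) u1 + poly_act y (r * p) u2 = 0\<^sub>v ?n" for r
    proof -
      have "poly_act y (r * p) ?c = 0\<^sub>v ?n"
        using u1(1) u2(1) p(2) by (subst poly_act_mult[OF y]) (auto simp: zero)
      then show ?thesis by (simp only: poly_act_add_vec[OF y u1(1) u2(1)])
    qed
    have "poly_act y (?L * p) u1 = 0\<^sub>v ?n"
      unfolding mult.commute[of ?L] poly_act_mult[OF y u1(1)] L_u1 by (rule zero)
    with split[of ?L] have "poly_act y (?L * p) u2 = 0\<^sub>v ?n"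
      using y u2 by (simp add: poly_act_carrier[OF y])
    then have dvd1: "h dvd ?L * p"
      using poly_act_eq_0_iff_dvd[OF y u2 h(1) h_u2] by simp
    have "poly_act y (h * p) u2 = 0\<^sub>v ?n"
      unfolding mult.commute[of h] poly_act_mult[OF y u2(1)] h_u2 by (rule zero)
    with split[of h] have "poly_act y (h * p) u1 = 0\<^sub>v ?n"
      using y u1 by (simp add: poly_act_carrier[OF y])
    moreover have "irreducible ?L"
      using linear_irreducible\<^sub>d[of ?L] by simp
    ultimately have "?L dvd h * p"
      using poly_act_eq_0_iff_dvd[OF y u1(1,2) _ L_u1] by simp
    then have "poly p l = 0" using h(3) by (simp flip: poly_eq_0_iff_dvd)
    then obtain p' where p': "p = ?L * p'" by (auto simp: poly_eq_0_iff_dvd)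
    from dvd1 have "h dvd ?L * p'"
      unfolding p' by (rule dvd_linear_mult_cancel[OF h(3)])
    then have "h dvd p'" by (rule dvd_linear_mult_cancel[OF h(3)])
    moreover have p'0: "p' \<noteq> 0" using p0 p' by auto
    ultimately have "m \<le> degree p'" using dvd_imp_degree_le h(2) by blast
    moreover have "degree p = Suc (degree p')"
      using p'0 unfolding p' by (subst degree_mult_eq) auto
    ultimately show False using p(1) by simp
  qed
  then have "cyclic y ?c" using cyclic_iff_poly_act[OF y] by blast
  moreover have "?c \<in> carrier_vec ?n" using u1 u2 by simp
  ultimately show ?thesis by blast
qed

text \<open>Write an eigenvector as \<open>p(y) c\<close> with \<open>c\<close> cyclic and
  \<open>degree p <= m\<close>. The characteristic polynomial \<open>(T - l) h\<close> divides
  \<open>(T - l) p\<close>, so \<open>p\<close> is a constant multiple of \<open>h\<close>: the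
  eigenspace is the line through \<open>h(y) c\<close>.\<close>

lemma card_eigenvectors_simple:
  fixes y :: "'a :: {field, finite} mat"
  assumes y: "y \<in> carrier_mat (Suc m) (Suc m)" and cp: "char_poly y = [:- l, 1:] * h"
    and h: "irreducible h" "degree h = m" "monic h" "poly h l \<noteq> 0"
  shows "card {v \<in> carrier_vec (Suc m). v \<noteq> 0\<^sub>v (Suc m) \<and> y *\<^sub>v v = l \<cdot>\<^sub>v v} = CARD('a) - 1"
proof -
  let ?n = "Suc m" and ?L = "[:- l, 1:] :: 'a poly"
  let ?E = "{v \<in> carrier_vec ?n. v \<noteq> 0\<^sub>v ?n \<and> y *\<^sub>v v = l \<cdot>\<^sub>v v}"
  have h0: "h \<noteq> 0" using h(4) by auto
  obtain c where c: "c \<in> carrier_vec ?n" "cyclic y c"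
    using exists_cyclic_linear_times_irreducible[OF y cp h(1,2,4)] by blast
  have cyc: "p = 0" if "degree p < ?n" "poly_act y p c = 0\<^sub>v ?n" for p
    using c(2) that cyclic_iff_poly_act[OF y] by blast
  have act_L: "poly_act y ?L v = 0\<^sub>v ?n \<longleftrightarrow> y *\<^sub>v v = l \<cdot>\<^sub>v v" if v: "v \<in> carrier_vec ?n" for v
  proof -
    have "poly_act y ?L v = 0\<^sub>v ?n \<longleftrightarrow> (\<forall>i<?n. (y *\<^sub>v v) $ i - l * v $ i = 0)"
      using y v carrier_vecD[OF v]
      by (auto simp: poly_act_linear[OF y v] vec_eq_iff simp del: index_mult_mat_vec)
    then show ?thesis
      using y v carrier_vecD[OF v] by (auto simp: vec_eq_iff simp del: index_mult_mat_vec)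
  qed
  define u where "u = poly_act y h c"
  have u: "u \<in> carrier_vec ?n" unfolding u_def by (rule poly_act_carrier[OF y])
  have u0: "u \<noteq> 0\<^sub>v ?n" using cyc[of h] h(2) h0 unfolding u_def by auto
  have yu: "y *\<^sub>v u = l \<cdot>\<^sub>v u"
    using cayley_hamilton[OF y c(1)] act_L[OF u] unfolding cp u_def
    by (simp only: poly_act_mult[OF y c(1)])
  have smult_0: "k = 0" if "k \<cdot>\<^sub>v u = 0\<^sub>v ?n" for k
  proof -
    obtain i where i: "i < ?n" "u $ i \<noteq> 0" using u u0 by (metis carrier_vecD eq_vecI index_zero_vec)
    then show ?thesis using arg_cong[OF that, of "\<lambda>v. v $ i"] carrier_vecD[OF u] by simp
  qed
  have "?E = (\<lambda>k. k \<cdot>\<^sub>v u) ` (UNIV - {0})"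
  proof (intro equalityI subsetI)
    fix v assume v: "v \<in> ?E"
    then have vc: "v \<in> carrier_vec ?n" by simp
    from cyclic_span[OF y c(2) vc] obtain p where p: "degree p < ?n" "v = poly_act y p c" by auto
    \<comment> \<open>\<open>(T - l) p\<close> may have degree \<open>Suc m\<close>; subtracting a
      multiple of the characteristic polynomial brings it into the range where \<open>cyc\<close>
      applies.\<close>
    define r where "r = ?L * p - Polynomial.smult (coeff p m) (char_poly y)"
    note deg = degree_monic_char_poly[OF y]
    have "degree (?L * p) \<le> ?n"
      using degree_mult_le[of ?L p] p(1) by simp
    then have "degree r \<le> ?n"
      unfolding r_def using deg by (intro degree_diff_le) (auto intro: order.trans[OF degree_smult_le])
    moreover have "coeff r ?n = 0"
    proof -
      have "coeff p ?n = 0" using p(1) by (simp add: coeff_eq_0)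
      then show ?thesis unfolding r_def using deg by simp
    qed
    ultimately have deg_r: "degree r < ?n"
      by (metis eq_zero_or_degree_less zero_less_Suc degree_0)
    have "poly_act y (?L * p) c = 0\<^sub>v ?n"
      unfolding poly_act_mult[OF y c(1)] p(2)[symmetric] using v act_L[OF vc] by simp
    moreover have "poly_act y (?L * p) c = poly_act y r c + coeff p m \<cdot>\<^sub>v poly_act y (char_poly y) c"
      by (simp only: r_def flip: poly_act_add[OF y] poly_act_smult[OF y]) simp
    moreover have "coeff p m \<cdot>\<^sub>v poly_act y (char_poly y) c = 0\<^sub>v ?n"
      unfolding cayley_hamilton[OF y c(1)] by (intro eq_vecI) auto
    ultimately have "poly_act y r c = 0\<^sub>v ?n"
      using poly_act_carrier[OF y, of r c] by simp
    from cyc[OF deg_r this] have "?L * p = ?L * Polynomial.smult (coeff p m) h"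
      unfolding r_def cp by (simp only: mult_smult_right right_minus_eq)
    then have "p = Polynomial.smult (coeff p m) h" by (subst (asm) mult_left_cancel) auto
    then have "v = coeff p m \<cdot>\<^sub>v u"
      unfolding p(2) u_def by (metis poly_act_smult[OF y])
    moreover from this have "coeff p m \<noteq> 0" using v u by auto
    ultimately show "v \<in> (\<lambda>k. k \<cdot>\<^sub>v u) ` (UNIV - {0})" by blast
  next
    fix v assume "v \<in> (\<lambda>k. k \<cdot>\<^sub>v u) ` (UNIV - {0})"
    then obtain k where k: "v = k \<cdot>\<^sub>v u" "k \<noteq> 0" by blast
    have "y *\<^sub>v v = k \<cdot>\<^sub>v (y *\<^sub>v u)" unfolding k(1) by (rule mult_mat_vec[OF y u])
    also have "\<dots> = l \<cdot>\<^sub>v v" unfolding yu k(1) by (simp add: smult_smult_assoc mult.commute)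
    finally show "v \<in> ?E" using smult_0 k u by auto
  qed
  moreover have "inj_on (\<lambda>k. k \<cdot>\<^sub>v u) (UNIV - {0})"
  proof (rule inj_onI)
    fix k k' assume eq: "k \<cdot>\<^sub>v u = k' \<cdot>\<^sub>v u"
    have "(k - k') \<cdot>\<^sub>v u = 0\<^sub>v ?n"
    proof (rule eq_vecI)
      fix i assume "i < dim_vec (0\<^sub>v ?n :: 'a vec)"
      then show "((k - k') \<cdot>\<^sub>v u) $ i = 0\<^sub>v ?n $ i"
        using arg_cong[OF eq, of "\<lambda>v. v $ i"] carrier_vecD[OF u] by (simp add: left_diff_distrib)
    qed (use u in simp)
    from smult_0[OF this] show "k = k'" by simp
  qed
  ultimately show ?thesis by (simp add: card_image card_Diff_singleton)
qed

section \<open>Solutions with a prescribed eigenvector\<close>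

context
  fixes z :: "'a :: {field, finite} mat" and f h :: "'a poly" and l :: 'a and m :: nat
  assumes z: "z \<in> carrier_mat (Suc m) (Suc m)"
    and f: "irreducible f" "degree f = Suc m" "monic f"
    and h: "irreducible h" "degree h = m" "monic h" "poly h l \<noteq> 0"
    and tr: "coeff f m = l - mat_trace z - coeff h (m - 1)"
begin

text \<open>The assumption \<open>tr\<close> is the trace identity read off from coefficients:
  \<open>f\<close> has trace \<open>- coeff f m\<close> and \<open>h\<close> has trace
  \<open>- coeff h (m - 1)\<close>. By \<open>card_eigenvectors_simple\<close> a solution
  \<open>x\<close> lies in \<open>sols v\<close> for exactly q - 1 nonzero \<open>v\<close>.\<close>

definition sols :: "'a vec \<Rightarrow> 'a mat set" where
  "sols v = {x \<in> carrier_mat (Suc m) (Suc m). char_poly x = f \<and> char_poly (z - x) = [:- l, 1:] * h \<and>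
     (z - x) *\<^sub>v v = l \<cdot>\<^sub>v v}"

text \<open>
  In a basis starting with \<open>v\<close>, \<open>z - x\<close> has first column \<open>(l, 0)\<close> and its lower right block \<open>y\<close>
  determines \<open>x\<close>; conversely, \<open>y\<close> occurs as soon as the vector \<open>c\<close> in the first column of \<open>z\<close> is
  cyclic for \<open>d - y\<close>.
\<close>
lemma card_sols:
  assumes v: "v \<in> carrier_vec (Suc m)" "v \<noteq> 0\<^sub>v (Suc m)"
  shows "card (sols v) \<le> card {y \<in> carrier_mat m m. char_poly y = h}"
    and "(\<And>k. z *\<^sub>v v \<noteq> k \<cdot>\<^sub>v v) \<Longrightarrow>
      (real CARD('a) - 3) * real CARD('a) ^ (m * (m - 1)) \<le> (real CARD('a) - 1) * real (card (sols v))"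
proof -
  let ?n = "Suc m"
  have m: "0 < m" using irreducible_degree_pos[OF h(1)] h(2) by simp
  obtain e where e: "e 0 = v" "\<forall>j<?n. e j \<in> carrier_vec ?n" "indep ?n e ?n"
    using exists_indep_extension[of ?n "\<lambda>_. v" 1] indep_1[of "\<lambda>_. v" ?n] v by auto
  define P where "P = col_mat ?n e"
  have P: "P \<in> carrier_mat ?n ?n" by (simp add: P_def)
  have "det P \<noteq> 0" using e(3) by (simp add: indep_det P_def)
  from det_nonzero_inverse[OF P this] obtain Q where
    Q: "Q \<in> carrier_mat ?n ?n" "P * Q = 1\<^sub>m ?n" "Q * P = 1\<^sub>m ?n" by metis
  let ?e = "unit_vec ?n 0 :: 'a vec"
  have Pe: "P *\<^sub>v ?e = v"
    using v(1) e(1) by (intro eq_vecI) (auto simp: P_def col_mat_def scalar_prod_unit[of _ ?n])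
  have Qv: "Q *\<^sub>v v = ?e"
    unfolding Pe[symmetric] using Q(3) assoc_mult_mat_vec[OF Q(1) P unit_vec_carrier, of 0] by simp
  define cj where "cj A = Q * A * P" for A
  have cj: "cj A \<in> carrier_mat ?n ?n" if "A \<in> carrier_mat ?n ?n" for A
    unfolding cj_def by (rule mult_carrier_mat[OF mult_carrier_mat[OF Q(1) that] P])
  have cj_inv: "P * cj A * Q = A" if "A \<in> carrier_mat ?n ?n" for A
    unfolding cj_def by (rule conj_inverse[OF that P Q(1,2)])
  have cj_inv': "cj (P * A * Q) = A" if "A \<in> carrier_mat ?n ?n" for A
    unfolding cj_def by (rule conj_inverse[OF that Q(1) P Q(3)])
  have cj_sim: "similar_mat (cj A) A" if "A \<in> carrier_mat ?n ?n" for A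
    unfolding cj_def by (rule similar_mat_conj[OF that P Q(1-3)])
  have cj_cp: "char_poly (cj A) = char_poly A" if "A \<in> carrier_mat ?n ?n" for A
    using char_poly_similar[OF cj_sim[OF that]] .
  have cj_diff: "cj (A - B) = cj A - cj B" if "A \<in> carrier_mat ?n ?n" "B \<in> carrier_mat ?n ?n" for A B
    unfolding cj_def mult_minus_distrib_mat[OF Q(1) that]
    by (rule minus_mult_distrib_mat) (use that Q(1) P in auto)
  have cj_e: "cj A *\<^sub>v ?e = Q *\<^sub>v (A *\<^sub>v v)" if "A \<in> carrier_mat ?n ?n" for A
    unfolding cj_def using conj_mult_vec[OF that P Q(1) unit_vec_carrier] Pe by simp
  have col0: "(A *\<^sub>v ?e) $ i = A $$ (i, 0)" if "A \<in> carrier_mat ?n ?n" "i < ?n" for A i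
    using that by (simp add: scalar_prod_unit[of _ ?n])
  define Z where "Z = cj z"
  have Z: "Z \<in> carrier_mat ?n ?n" unfolding Z_def by (rule cj[OF z])
  define c where "c = vec m (\<lambda>i. Z $$ (Suc i, 0))"
  define d where "d = mat m m (\<lambda>(i, j). Z $$ (Suc i, Suc j))"
  have c: "c \<in> carrier_vec m" and d: "d \<in> carrier_mat m m" by (simp_all add: c_def d_def)
  define blk where "blk x = mat m m (\<lambda>(i, j). cj (z - x) $$ (Suc i, Suc j))" for x
  have blk: "blk x \<in> carrier_mat m m" for x by (simp add: blk_def)
  have zx: "z - x \<in> carrier_mat ?n ?n" if "x \<in> carrier_mat ?n ?n" for x
    using that by (rule minus_carrier_mat)
  have cj_zx: "cj (z - x) = Z - cj x" if "x \<in> carrier_mat ?n ?n" for x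
    unfolding Z_def by (rule cj_diff[OF z that])
  have first_col: "cj (z - x) $$ (i, 0) = (if i = 0 then l else 0)"
    if x: "x \<in> carrier_mat ?n ?n" "(z - x) *\<^sub>v v = l \<cdot>\<^sub>v v" and i: "i < ?n" for x i
  proof -
    have "cj (z - x) *\<^sub>v ?e = l \<cdot>\<^sub>v ?e"
      unfolding cj_e[OF zx[OF x(1)]] x(2) mult_mat_vec[OF Q(1) v(1)] Qv ..
    then show ?thesis using col0[OF cj[OF zx[OF x(1)]] i] i by (cases "i = 0") simp_all
  qed
  have blk_cp: "char_poly (blk x) = h" if x: "x \<in> sols v" for x
  proof -
    have xs: "x \<in> carrier_mat ?n ?n" "char_poly (z - x) = [:- l, 1:] * h" "(z - x) *\<^sub>v v = l \<cdot>\<^sub>v v"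
      using x by (auto simp: sols_def)
    have "cj (z - x) = bordered l (vec m (\<lambda>j. cj (z - x) $$ (0, Suc j))) (0\<^sub>v m) (blk x)"
    proof (subst eq_bordered[OF cj[OF zx[OF xs(1)]]])
      have "vec m (\<lambda>i. cj (z - x) $$ (Suc i, 0)) = 0\<^sub>v m"
        using first_col[OF xs(1,3)] by (intro eq_vecI) auto
      then show "bordered (cj (z - x) $$ (0, 0)) (vec m (\<lambda>j. cj (z - x) $$ (0, Suc j)))
          (vec m (\<lambda>i. cj (z - x) $$ (Suc i, 0))) (mat m m (\<lambda>(i, j). cj (z - x) $$ (Suc i, Suc j)))
        = bordered l (vec m (\<lambda>j. cj (z - x) $$ (0, Suc j))) (0\<^sub>v m) (blk x)"
        using first_col[OF xs(1,3), of 0] by (simp add: blk_def)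
    qed
    then have "[:- l, 1:] * h = [:- l, 1:] * char_poly (blk x)"
      using cj_cp[OF zx[OF xs(1)]] xs(2) char_poly_bordered_0[OF blk] by metis
    then show ?thesis by (subst (asm) mult_left_cancel) auto
  qed
  have inj: "inj_on blk (sols v)"
  proof (rule inj_onI)
    fix x x' assume x: "x \<in> sols v" "x' \<in> sols v" and eq: "blk x = blk x'"
    have xc: "x \<in> carrier_mat ?n ?n" "x' \<in> carrier_mat ?n ?n" using x by (auto simp: sols_def)
    have ev: "(z - x) *\<^sub>v v = l \<cdot>\<^sub>v v" "(z - x') *\<^sub>v v = l \<cdot>\<^sub>v v" using x by (auto simp: sols_def)
    have cp: "char_poly (cj x) = f" "char_poly (cj x') = f"
      using x cj_cp[OF xc(1)] cj_cp[OF xc(2)] by (auto simp: sols_def)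
    \<comment> \<open>The first column of \<open>cj (z - x)\<close> and its block are known, so only
      the first row of \<open>cj x\<close> is open; the characteristic polynomial \<open>f\<close>
      settles it.\<close>
    have rows: "cj x $$ (i, j) = cj x' $$ (i, j)" if ij: "i < ?n" "i \<noteq> 0" "j < ?n" for i j
    proof -
      have "cj (z - x) $$ (i, j) = cj (z - x') $$ (i, j)"
      proof (cases j)
        case 0
        then show ?thesis using first_col[OF xc(1) ev(1) ij(1)] first_col[OF xc(2) ev(2) ij(1)] by simp
      next
        case (Suc k)
        obtain i' where i': "i = Suc i'" using ij(2) by (cases i) auto
        have "blk x $$ (i', k) = blk x' $$ (i', k)" by (simp add: eq)
        then show ?thesis using ij Suc i' by (simp add: blk_def)
      qed
      then show ?thesis
        unfolding cj_zx[OF xc(1)] cj_zx[OF xc(2)] using ij cj[OF xc(1)] cj[OF xc(2)] by simp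
    qed
    have "cj x = cj x'"
    proof (rule eq_mat_if_char_poly_eq[OF cj[OF xc(1)] cj[OF xc(2)] zero_less_Suc rows])
      show "w = 0\<^sub>v ?n" if "w \<in> carrier_vec ?n" "\<And>k. w \<bullet> krylov (cj x) ?e k = 0" for w
      proof (rule cyclic_orthogonal_eq_0[OF cj[OF xc(1)] unit_vec_carrier _ that])
        show "cyclic (cj x) ?e"
          by (rule irreducible_cyclic[OF cj[OF xc(1)] unit_vec_carrier unit_vec_neq_0])
            (simp_all add: cp f(1))
      qed
    qed (simp_all add: cp)
    then have "P * cj x * Q = P * cj x' * Q" by (simp only:)
    then show "x = x'" by (simp only: cj_inv[OF xc(1)] cj_inv[OF xc(2)])
  qed
  show "card (sols v) \<le> card {y \<in> carrier_mat m m. char_poly y = h}"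
    by (rule card_inj_on_le[OF inj]) (use blk blk_cp in auto)
  have onto: "y \<in> blk ` sols v" if y: "y \<in> carrier_mat m m" "char_poly y = h" "cyclic (d - y) c" for y
  proof -
    let ?a = "Z $$ (0, 0)" and ?D = "d - y"
    have D: "?D \<in> carrier_mat m m" by (rule minus_carrier_mat[OF y(1)])
    have trZ: "mat_trace z = ?a + mat_trace d"
    proof -
      have "mat_trace z = mat_trace Z"
        unfolding Z_def using mat_trace_similar[OF cj_sim[OF z]] by simp
      also have "\<dots> = ?a + mat_trace d"
        using eq_bordered[OF Z] mat_trace_bordered by (metis d_def)
      finally show ?thesis .
    qed
    have trD: "mat_trace ?D = mat_trace d - mat_trace y"
      using y(1) d by (simp add: mat_trace_def sum_subtractf)
    have "coeff h (m - 1) = - mat_trace y"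
      using coeff_char_poly_trace[of y "m - 1"] y m by simp
    \<comment> \<open>The trace condition enters here: the corner and the block of the matrix to be
      built already fix the coefficient of index \<open>m\<close>.\<close>
    then have "coeff f m = - ((?a - l) + mat_trace ?D)"
      using tr trZ trD by simp
    from exists_bordered_char_poly[OF D c y(3) f(2,3) this] obtain w where
      w: "w \<in> carrier_vec m" "char_poly (bordered (?a - l) w c ?D) = f" by blast
    define X where "X = bordered (?a - l) w c ?D"
    have X: "X \<in> carrier_mat ?n ?n" unfolding X_def by (rule bordered_carrier[OF D])
    define x where "x = P * X * Q"
    have x: "x \<in> carrier_mat ?n ?n" unfolding x_def by (rule mult_carrier_mat[OF mult_carrier_mat[OF P X] Q(1)])
    have cjx: "cj x = X" unfolding x_def by (rule cj_inv'[OF X])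
    let ?w = "vec m (\<lambda>j. Z $$ (0, Suc j)) - w"
    have ZX: "Z - X = bordered l ?w (0\<^sub>v m) y"
      using Z D y(1) w(1) by (intro eq_matI) (auto simp: X_def bordered_def c_def d_def)
    have czx: "cj (z - x) = bordered l ?w (0\<^sub>v m) y"
      unfolding cj_zx[OF x] cjx by (rule ZX)
    have "char_poly x = f" using cj_cp[OF x] cjx w(2) by (simp add: X_def)
    moreover have "char_poly (z - x) = [:- l, 1:] * h"
      using cj_cp[OF zx[OF x]] czx char_poly_bordered_0[OF y(1), of l ?w] y(2) by simp
    moreover have "(z - x) *\<^sub>v v = l \<cdot>\<^sub>v v"
    proof -
      have "cj (z - x) *\<^sub>v ?e = l \<cdot>\<^sub>v ?e"
      proof (rule eq_vecI)
        fix i assume "i < dim_vec (l \<cdot>\<^sub>v ?e)"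
        then have i: "i < ?n" by simp
        have "(cj (z - x) *\<^sub>v ?e) $ i = cj (z - x) $$ (i, 0)" by (rule col0[OF cj[OF zx[OF x]] i])
        also have "\<dots> = (l \<cdot>\<^sub>v ?e) $ i" unfolding czx using i y(1) by (cases i) auto
        finally show "(cj (z - x) *\<^sub>v ?e) $ i = (l \<cdot>\<^sub>v ?e) $ i" .
      qed (use cj[OF zx[OF x]] in simp)
      then have "Q *\<^sub>v ((z - x) *\<^sub>v v) = l \<cdot>\<^sub>v ?e" by (simp only: cj_e[OF zx[OF x]])
      then have "P *\<^sub>v (Q *\<^sub>v ((z - x) *\<^sub>v v)) = l \<cdot>\<^sub>v (P *\<^sub>v ?e)"
        by (simp only: mult_mat_vec[OF P unit_vec_carrier])
      moreover have "P *\<^sub>v (Q *\<^sub>v ((z - x) *\<^sub>v v)) = (z - x) *\<^sub>v v"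
        using assoc_mult_mat_vec[OF P Q(1) mult_mat_vec_carrier[OF zx[OF x] v(1)]] Q(2)
          mult_mat_vec_carrier[OF zx[OF x] v(1)] by simp
      ultimately show ?thesis by (simp only: Pe)
    qed
    moreover have "blk x = y"
      using y(1) unfolding blk_def czx by (intro eq_matI) auto
    ultimately show ?thesis using x by (auto simp: sols_def)
  qed
  assume ne: "\<And>k. z *\<^sub>v v \<noteq> k \<cdot>\<^sub>v v"
  \<comment> \<open>In the basis starting with \<open>v\<close>, a vanishing \<open>c\<close> says
    that \<open>v\<close> is an eigenvector of \<open>z\<close>.\<close>
  have c0: "c \<noteq> 0\<^sub>v m"
  proof
    assume c0: "c = 0\<^sub>v m"
    have "Z *\<^sub>v ?e = Z $$ (0, 0) \<cdot>\<^sub>v ?e"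
    proof (rule eq_vecI)
      fix i assume "i < dim_vec (Z $$ (0, 0) \<cdot>\<^sub>v ?e)"
      then have i: "i < ?n" by simp
      have "Z $$ (Suc k, 0) = 0" if "k < m" for k
        using arg_cong[OF c0, of "\<lambda>v. v $ k"] that by (simp add: c_def)
      then show "(Z *\<^sub>v ?e) $ i = (Z $$ (0, 0) \<cdot>\<^sub>v ?e) $ i"
        unfolding col0[OF Z i] using i by (cases i) auto
    qed (use Z in simp)
    then have "Q *\<^sub>v (z *\<^sub>v v) = Z $$ (0, 0) \<cdot>\<^sub>v ?e" unfolding Z_def by (simp only: cj_e[OF z])
    then have "P *\<^sub>v (Q *\<^sub>v (z *\<^sub>v v)) = Z $$ (0, 0) \<cdot>\<^sub>v (P *\<^sub>v ?e)"
      by (simp only: mult_mat_vec[OF P unit_vec_carrier])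
    moreover have "P *\<^sub>v (Q *\<^sub>v (z *\<^sub>v v)) = z *\<^sub>v v"
      using assoc_mult_mat_vec[OF P Q(1) mult_mat_vec_carrier[OF z v(1)]] Q(2)
        mult_mat_vec_carrier[OF z v(1)] by simp
    ultimately have "z *\<^sub>v v = Z $$ (0, 0) \<cdot>\<^sub>v v" by (simp only: Pe)
    with ne show False by blast
  qed
  let ?G = "{y \<in> carrier_mat m m. char_poly y = h \<and> cyclic (d - y) c}"
  have fin: "finite (sols v)"
    by (rule finite_subset[of _ "carrier_mat ?n ?n"]) (auto simp: sols_def)
  have "card ?G \<le> card (blk ` sols v)"
    by (rule card_mono) (use fin onto in auto)
  also have "\<dots> \<le> card (sols v)" by (rule card_image_le[OF fin])
  finally have "(real CARD('a) - 1) * real (card ?G) \<le> (real CARD('a) - 1) * real (card (sols v))"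
    using card_field_ge_2[where ?'a = 'a] by (intro mult_left_mono) auto
  with card_cyclic_diff_ge[OF h(1-3) m d c c0]
  show "(real CARD('a) - 3) * real CARD('a) ^ (m * (m - 1)) \<le> (real CARD('a) - 1) * real (card (sols v))"
    by linarith
qed

end

text \<open>Matrices with cyclic vectors and the same characteristic polynomial are similar, and
  \<open>exists_char_poly_eq\<close> makes the set nonempty.\<close>

lemma conj_class_char_poly:
  fixes p :: "'a :: {field, finite} poly"
  assumes p: "degree p = Suc m" "monic p"
    and cyc: "\<And>A. A \<in> carrier_mat (Suc m) (Suc m) \<Longrightarrow> char_poly A = p \<Longrightarrow>
      \<exists>c \<in> carrier_vec (Suc m). cyclic A c"
  shows "conj_class (Suc m) {A \<in> carrier_mat (Suc m) (Suc m). char_poly A = p}"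
proof -
  obtain A where A: "A \<in> carrier_mat (Suc m) (Suc m)" "char_poly A = p"
    using exists_char_poly_eq[OF p] by blast
  have "similar_mat B A" if B: "B \<in> carrier_mat (Suc m) (Suc m)" "char_poly B = p" for B
    using cyc[OF A] cyc[OF B] similar_mat_if_cyclic[OF B(1) A(1)] A(2) B(2) by auto
  then have "{B \<in> carrier_mat (Suc m) (Suc m). char_poly B = p} =
      {B \<in> carrier_mat (Suc m) (Suc m). similar_mat B A}"
    using A(2) char_poly_similar by auto
  with A(1) show ?thesis unfolding conj_class_def by blast
qed

theorem card_decompositions:
  fixes z :: "'a :: {field, finite} mat" and f h :: "'a poly" and l :: 'a
  assumes z: "z \<in> carrier_mat (Suc m) (Suc m)" "\<not> scalar_mat (Suc m) z"
    and f: "irreducible f" "degree f = Suc m" "monic f"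
    and h: "irreducible h" "degree h = m" "monic h" "poly h l \<noteq> 0"
    and tr: "coeff f m = l - mat_trace z - coeff h (m - 1)"
  defines "N \<equiv> card {x \<in> carrier_mat (Suc m) (Suc m). char_poly x = f \<and> char_poly (z - x) = [:- l, 1:] * h}"
  shows "\<bar>real N - real CARD('a) ^ m\<^sup>2\<bar> \<le> 42 * real CARD('a) ^ (m\<^sup>2 - 1)"
proof -
  let ?n = "Suc m" and ?q = "real CARD('a)"
  let ?S = "sols z f h l m" and ?V = "carrier_vec ?n - {0\<^sub>v ?n} :: 'a vec set"
  let ?N = "{x \<in> carrier_mat ?n ?n. char_poly x = f \<and> char_poly (z - x) = [:- l, 1:] * h}"
  note ctx = z(1) f h tr
  note sols_def = sols_def[OF ctx]
  have m: "0 < m" using irreducible_degree_pos[OF h(1)] h(2) by simp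
  have q: "2 \<le> ?q" using card_field_ge_2[where ?'a = 'a] by simp
  have finS: "finite (?S v)" for v
    by (rule finite_subset[of _ "carrier_mat ?n ?n"]) (auto simp: sols_def)
  have finN: "finite ?N"
    by (rule finite_subset[of _ "carrier_mat ?n ?n"]) auto
  have "(CARD('a) - 1) * N = (\<Sum>x\<in>?N. card {v \<in> ?V. x \<in> ?S v})"
  proof -
    have "card {v \<in> ?V. x \<in> ?S v} = CARD('a) - 1" if x: "x \<in> ?N" for x
    proof -
      have "{v \<in> ?V. x \<in> ?S v} = {v \<in> carrier_vec ?n. v \<noteq> 0\<^sub>v ?n \<and> (z - x) *\<^sub>v v = l \<cdot>\<^sub>v v}"
        using x by (auto simp: sols_def)
      also have "card \<dots> = CARD('a) - 1"
        using x by (intro card_eigenvectors_simple[OF _ _ h]) (auto intro: minus_carrier_mat)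
      finally show ?thesis .
    qed
    then show ?thesis by (simp add: N_def)
  qed
  also have "\<dots> = (\<Sum>v\<in>?V. card {x \<in> ?N. x \<in> ?S v})"
    by (rule sum_multicount_gen) (use finN in \<open>auto simp: finite_Diff\<close>)
  also have "\<dots> = (\<Sum>v\<in>?V. card (?S v))"
    by (intro sum.cong refl arg_cong[where f = card]) (auto simp: sols_def)
  finally have "real ((CARD('a) - 1) * N) = real (\<Sum>v\<in>?V. card (?S v))" by (simp only:)
  then have sum: "(?q - 1) * real N = (\<Sum>v\<in>?V. real (card (?S v)))"
    using q by (simp add: of_nat_diff)
  define M where "M = ?q ^ (m * (m - 1))"
  have M: "0 < M" using q by (simp add: M_def)
  have m2: "?q ^ m\<^sup>2 = M * ?q ^ m"
    unfolding M_def power2_eq_square using m by (cases m) (simp_all add: algebra_simps flip: power_add)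
  have m2': "?q ^ m\<^sup>2 = ?q * ?q ^ (m\<^sup>2 - 1)"
    using m by (cases "m\<^sup>2") auto
  have cardV: "real (card ?V) \<le> ?q * ?q ^ m"
  proof -
    have "card ?V \<le> card (carrier_vec ?n :: 'a vec set)" by (rule card_mono) auto
    then have "card ?V \<le> CARD('a) ^ ?n" by (simp only: card_carrier_vec)
    then have "real (card ?V) \<le> real (CARD('a) ^ ?n)" by (simp only: of_nat_le_iff)
    then show ?thesis by simp
  qed
  \<comment> \<open>At most q^n vectors contribute at most \<open>M\<close> solutions each.\<close>
  have upper: "(?q - 1) * real N \<le> ?q * ?q ^ m\<^sup>2"
  proof -
    have "real (card (?S v)) \<le> M" if "v \<in> ?V" for v
    proof -
      have "card (?S v) \<le> CARD('a) ^ (m * (m - 1))"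
        using card_sols(1)[OF ctx, of v] card_irreducible_char_poly_le[OF h(1), of m] that by auto
      then have "real (card (?S v)) \<le> real (CARD('a) ^ (m * (m - 1)))" by (simp only: of_nat_le_iff)
      then show ?thesis by (simp add: M_def)
    qed
    then have "(?q - 1) * real N \<le> (\<Sum>v\<in>?V. M)" unfolding sum by (rule sum_mono)
    also have "\<dots> = real (card ?V) * M" by simp
    also have "\<dots> \<le> (?q * ?q ^ m) * M" using cardV M by (intro mult_right_mono) auto
    finally show ?thesis by (simp add: m2 mult_ac)
  qed
  \<comment> \<open>At least \<open>(q - 2) q^m\<close> vectors are not eigenvectors of
    \<open>z\<close>, and each contributes at least \<open>M (q - 3) / (q - 1)\<close> solutions.
    Multiplying the two estimates requires q - 3 to be nonnegative.\<close>
  have lower: "(?q - 3) * ((?q - 2) * ?q ^ m\<^sup>2) \<le> (?q - 1) * ((?q - 1) * real N)" if q3: "3 \<le> ?q"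
  proof -
    let ?E = "{v \<in> carrier_vec ?n. \<exists>k. z *\<^sub>v v = k \<cdot>\<^sub>v v}"
    have 0: "z *\<^sub>v 0\<^sub>v ?n = 0 \<cdot>\<^sub>v 0\<^sub>v ?n" using z(1) by auto
    then have sub: "carrier_vec ?n - ?E \<subseteq> ?V" by auto
    have E: "real (card ?E) \<le> 2 * ?q ^ m"
    proof -
      have "real (CARD('a) * card ?E) \<le> real (2 * CARD('a) ^ ?n)"
        using card_eigenvectors_le[OF z] by (simp only: of_nat_le_iff)
      then have "?q * real (card ?E) \<le> ?q * (2 * ?q ^ m)" by (simp add: mult_ac)
      then show ?thesis using q by (simp add: mult_le_cancel_left)
    qed
    have "card (carrier_vec ?n - ?E) = card (carrier_vec ?n :: 'a vec set) - card ?E"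
      by (rule card_Diff_subset) (auto intro: finite_subset[of _ "carrier_vec ?n"])
    moreover have "card ?E \<le> card (carrier_vec ?n :: 'a vec set)" by (rule card_mono) auto
    ultimately have "real (card (carrier_vec ?n - ?E)) = ?q ^ ?n - real (card ?E)"
      by (simp add: of_nat_diff card_carrier_vec)
    with E have num: "(?q - 2) * ?q ^ m \<le> real (card (carrier_vec ?n - ?E))"
      by (simp add: algebra_simps)
    have "(?q - 3) * ((?q - 2) * ?q ^ m\<^sup>2) = ((?q - 2) * ?q ^ m) * ((?q - 3) * M)"
      by (simp add: m2 mult_ac)
    also have "\<dots> \<le> real (card (carrier_vec ?n - ?E)) * ((?q - 3) * M)"
      using q3 M by (intro mult_right_mono num) auto
    also have "\<dots> = (\<Sum>v\<in>carrier_vec ?n - ?E. (?q - 3) * M)" by simp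
    also have "\<dots> \<le> (\<Sum>v\<in>carrier_vec ?n - ?E. (?q - 1) * real (card (?S v)))"
    proof (rule sum_mono)
      fix v assume v: "v \<in> carrier_vec ?n - ?E"
      with sub have "v \<noteq> 0\<^sub>v ?n" by auto
      with v show "(?q - 3) * M \<le> (?q - 1) * real (card (?S v))"
        unfolding M_def by (intro card_sols(2)[OF ctx]) auto
    qed
    also have "\<dots> \<le> (\<Sum>v\<in>?V. (?q - 1) * real (card (?S v)))"
      using q by (intro sum_mono2 sub) auto
    also have "\<dots> = (?q - 1) * ((?q - 1) * real N)" by (simp add: sum sum_distrib_left)
    finally show ?thesis .
  qed
  define R where "R = ?q ^ (m\<^sup>2 - 1)"
  have R: "0 < R" using q by (simp add: R_def)
  \<comment> \<open>The quotient \<open>q^2 / (q - 1)\<close> is \<open>q + 1 + 1 / (q - 1)\<close>,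
    hence at most \<open>q + 2\<close>.\<close>
  have up: "real N \<le> ?q * R + 2 * R"
  proof -
    have "(?q - 1) * real N \<le> ?q * (?q * R)" using upper by (simp add: m2' R_def)
    also have "\<dots> \<le> (?q - 1) * (?q * R + 2 * R)"
      using q R by (simp add: algebra_simps)
    finally show ?thesis using q by (simp add: mult_le_cancel_left)
  qed
  \<comment> \<open>For q <= 42 the bound is not positive. For larger q, clearing denominators in
    \<open>q (q - 2) (q - 3) / (q - 1)^2 >= q - 42\<close> leaves the quadratic below, times
    \<open>R\<close>.\<close>
  have low: "?q * R - 42 * R \<le> real N"
  proof (cases "?q \<le> 42")
    case True
    then have "?q * R - 42 * R \<le> 0" using R by (simp add: mult_le_cancel_right)
    then show ?thesis by (rule order.trans) simp
  next
    case False
    have "((?q - 1) * (?q - 1)) * (?q * R - 42 * R) \<le> (?q - 3) * ((?q - 2) * (?q * R))"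
    proof -
      have "0 \<le> R * (39 * (?q * ?q) - 79 * ?q + 42)"
      proof (intro mult_nonneg_nonneg)
        have "42 * ?q \<le> ?q * ?q" using False by (intro mult_right_mono) linarith+
        then show "0 \<le> 39 * (?q * ?q) - 79 * ?q + 42" using q by linarith
      qed (use R in simp)
      then show ?thesis by (simp add: algebra_simps)
    qed
    also have "\<dots> \<le> (?q - 1) * ((?q - 1) * real N)"
      using lower False by (simp add: m2' R_def)
    finally have "((?q - 1) * (?q - 1)) * (?q * R - 42 * R) \<le> ((?q - 1) * (?q - 1)) * real N"
      by (simp only: mult.assoc)
    then show ?thesis by (rule mult_left_le_imp_le) (use False in simp)
  qed
  show ?thesis using up low R unfolding m2' R_def[symmetric] abs_le_iff by linarith
qed

section \<open>Choosing polynomials with matching traces\<close>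

lemma coeff_linear_mult:
  assumes "degree h = m" "monic (h :: 'a :: field poly)" "0 < m"
  shows "coeff ([:- l, 1:] * h) m = coeff h (m - 1) - l"
  using assms by (cases m) auto

lemma irreducible_no_root:
  fixes p :: "'a :: field poly"
  assumes p: "irreducible p" and deg: "degree p \<noteq> 1"
  shows "poly p r \<noteq> 0"
proof
  assume "poly p r = 0"
  then obtain s where s: "p = [:- r, 1:] * s" by (auto simp: poly_eq_0_iff_dvd)
  from irreducibleD[OF p s] have "is_unit s" by (auto simp: is_unit_iff_degree)
  then have "s \<noteq> 0" "degree s = 0" by (auto simp: is_unit_iff_degree)
  then have "degree p = 1" unfolding s by (subst degree_mult_eq) auto
  with deg show False by contradiction
qed

lemma irreducible_quadratic:
  fixes p :: "'a :: field poly"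
  assumes deg: "degree p = 2" and root: "\<And>r. poly p r \<noteq> 0"
  shows "irreducible p"
proof -
  have "irreducible\<^sub>d p"
  proof (rule irreducible\<^sub>dI)
    fix a b assume "degree a > 0" "degree a < degree p" "p = a * b"
    then have "degree a = 1" using deg by simp
    moreover from this have "coeff a 1 \<noteq> 0" by (metis degree_0 leading_coeff_0_iff zero_neq_one)
    ultimately have "poly a (- coeff a 0 / coeff a 1) = 0" by (simp add: poly_altdef)
    with root[of "- coeff a 0 / coeff a 1"] \<open>p = a * b\<close> show False by simp
  qed (use deg in simp)
  then show ?thesis by simp
qed

text \<open>
  Suitable \<open>a\<close> and \<open>b\<close> exist unless \<open>2 = 0\<close> and \<open>f\<close> has trace \<open>t\<close>. In characteristic 2 the trace
  of an irreducible quadratic polynomial is nonzero, and rescaling the variable changes it.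
\<close>
lemma exists_quadratic_factors:
  fixes t :: "'a :: {field, finite}"
  assumes ex: "\<not> (CARD('a) = 2 \<and> t = 1)"
  shows "\<exists>(f :: 'a poly) a b. irreducible f \<and> degree f = 2 \<and> monic f \<and> a \<noteq> b \<and> coeff f 1 = a + b - t"
proof -
  obtain f :: "'a poly" where f: "monic f" "degree f = 2" "irreducible f"
    using exists_monic_irreducible_poly[of 2, where ?'a = 'a] by (meson zero_less_numeral)
  define e b where "e = coeff f 1" and "b = coeff f 0"
  have f_eq: "poly f x = x * x + e * x + b" for x
    using f(1,2) by (simp add: poly_altdef e_def b_def numeral_2_eq_2 atMost_Suc algebra_simps)
  show ?thesis
  proof (cases "\<forall>a. a + a = e + t")
    \<comment> \<open>The elements \<open>a\<close> and \<open>e + t - a\<close> have the required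
      sum and are distinct unless \<open>a + a = e + t\<close>.\<close>
    case False
    then obtain a where "a + a \<noteq> e + t" by blast
    then have "a \<noteq> e + t - a" by (metis diff_add_cancel)
    then show ?thesis
      using f by (intro exI[of _ f] exI[of _ a] exI[of _ "e + t - a"]) (simp add: e_def)
  next
    case True
    \<comment> \<open>Taking \<open>a = 0\<close> gives \<open>e + t = 0\<close>, and then every
      \<open>a + a\<close> vanishes.\<close>
    then have et: "e + t = 0" and two: "x + x = 0" for x :: 'a
      by (metis add_0)+
    have neg: "- x = x" for x :: 'a using two[of x] by (simp add: eq_neg_iff_add_eq_0 flip: minus_equation_iff)
    \<comment> \<open>In characteristic 2 squaring is bijective on a finite field, so
      \<open>T^2 + b\<close> always has a root.\<close>
    have e0: "e \<noteq> 0"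
    proof
      assume e0: "e = 0"
      have "inj (\<lambda>x :: 'a. x * x)"
      proof (rule injI)
        fix x y :: 'a assume "x * x = y * y"
        then have "(x - y) * (x + y) = 0" by (simp add: algebra_simps)
        then show "x = y" using neg[of y] by (auto simp: eq_neg_iff_add_eq_0[symmetric])
      qed
      then have "surj (\<lambda>x :: 'a. x * x)" by (rule finite_UNIV_inj_surj[rotated]) simp
      then obtain r where "b = r * r" by (metis surjD)
      then have "poly f r = 0" using e0 two[of "r * r"] by (simp add: f_eq)
      with irreducible_no_root[OF f(3)] f(2) show False by simp
    qed
    have te: "t = e" using et neg[of e] by (metis add_eq_0_iff)
    \<comment> \<open>Over the field with two elements \<open>e\<close>, and hence \<open>t\<close>,
      would be 1, the excluded case.\<close>
    have "\<exists>c :: 'a. c \<notin> {0, 1}"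
    proof (rule ccontr)
      assume *: "\<not> ?thesis"
      then have "UNIV = {0, 1 :: 'a}" by blast
      then have "CARD('a) = card {0, 1 :: 'a}" by simp
      with ex te e0 * show False by auto
    qed
    then obtain c :: 'a where c: "c \<noteq> 0" "c \<noteq> 1" by blast
    \<comment> \<open>This is \<open>c^2 f(T / c)\<close>: still irreducible, but with linear
      coefficient \<open>c e\<close>, which differs from \<open>e\<close>. As \<open>t = e\<close>,
      the pair \<open>e (c + 1)\<close> and 0 fits, and it is distinct since \<open>c\<close> is not
      1.\<close>
    define p where "p = [:c * c * b, c * e, 1:]"
    have "poly p r \<noteq> 0" for r
    proof
      assume "poly p r = 0"
      moreover have "poly p r = c * c * poly f (r / c)"
        using c(1) by (simp add: p_def f_eq field_simps)
      ultimately have "poly f (r / c) = 0" using c(1) by simp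
      with irreducible_no_root[OF f(3)] f(2) show False by simp
    qed
    then have "irreducible p" by (rule irreducible_quadratic[rotated]) (simp add: p_def)
    moreover have "e * (c + 1) \<noteq> 0" using e0 c(2) neg[of 1] by (auto simp: add_eq_0_iff2)
    ultimately show ?thesis
      using te by (intro exI[of _ p] exI[of _ "e * (c + 1)"] exI[of _ 0])
        (simp add: p_def algebra_simps)
  qed
qed

text \<open>For \<open>m > 1\<close> an irreducible \<open>h\<close> has no root, so
  \<open>l\<close> may be whatever the trace condition dictates. For \<open>m = 1\<close> it must
  avoid the root of \<open>h\<close>, which is the problem of two distinct linear factors solved in
  \<open>exists_quadratic_factors\<close>.\<close>

lemma exists_polys:
  fixes t :: "'a :: {field, finite}"
  assumes m: "0 < m" and ex: "\<not> (m = 1 \<and> CARD('a) = 2 \<and> t = 1)"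
  shows "\<exists>(f :: 'a poly) h l. irreducible f \<and> degree f = Suc m \<and> monic f \<and>
    irreducible h \<and> degree h = m \<and> monic h \<and> poly h l \<noteq> 0 \<and> coeff f m = l - t - coeff h (m - 1)"
proof (cases "m = 1")
  case True
  with ex obtain f :: "'a poly" and a b where f: "irreducible f" "degree f = 2" "monic f" "a \<noteq> b" "coeff f 1 = a + b - t"
    using exists_quadratic_factors[of t] by auto
  have "irreducible [:- b, 1:]" using linear_irreducible\<^sub>d[of "[:- b, 1:]"] by simp
  with f True show ?thesis
    by (intro exI[of _ f] exI[of _ "[:- b, 1:]"] exI[of _ a]) (simp add: numeral_2_eq_2)
next
  case False
  obtain f :: "'a poly" where f: "monic f" "degree f = Suc m" "irreducible f"
    using exists_monic_irreducible_poly[of "Suc m"] by blast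
  obtain h :: "'a poly" where h: "monic h" "degree h = m" "irreducible h"
    using exists_monic_irreducible_poly[OF m] by blast
  have "poly h l \<noteq> 0" for l by (rule irreducible_no_root[OF h(3)]) (use False h(2) in simp)
  with f h show ?thesis
    by (intro exI[of _ f] exI[of _ h] exI[of _ "coeff f m + t + coeff h (m - 1)"]) simp
qed

theorem corollary1p3:
  fixes z :: "'a :: {field, finite} mat" and n q :: nat and t :: 'a
  assumes "q = CARD('a)"
    and "n \<ge> 2"
    and "z \<in> carrier_mat n n"
    and "\<not> scalar_mat n z"
    and "t = mat_trace z"
    and "\<not> (n = 2 \<and> q = 2 \<and> t = 1)"
  shows "\<exists>X Y :: 'a mat set.
           conj_class n X \<and> conj_class n Y \<and>
           irreducible (class_char_poly X) \<and> degree (class_char_poly X) = n \<and>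
           (\<exists>(c :: 'a) (h :: 'a poly).
              class_char_poly Y = [:- c, 1:] * h \<and>
              irreducible h \<and> degree h = n - 1 \<and> poly h c \<noteq> 0) \<and>
           mat_trace z = class_trace X + class_trace Y \<and>
           \<bar>real (num_sum_reps X Y z) - real q ^ ((n - 1)\<^sup>2)\<bar>
             \<le> 42 * real q ^ ((n - 1)\<^sup>2 - 1)"
proof -
  define m where "m = n - 1"
  have n: "n = Suc m" and m: "0 < m" using assms(2) by (simp_all add: m_def)
  note z = assms(3,4)[unfolded n]
  obtain f h :: "'a poly" and l where
    f: "irreducible f" "degree f = Suc m" "monic f" and
    h: "irreducible h" "degree h = m" "monic h" "poly h l \<noteq> 0" and
    tr: "coeff f m = l - mat_trace z - coeff h (m - 1)"
    using exists_polys[OF m, of "mat_trace z"] assms n by auto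
  define g where "g = [:- l, 1:] * h"
  have h0: "h \<noteq> 0" using h(4) by auto
  have g: "degree g = Suc m" "monic g"
  proof -
    show "degree g = Suc m"
      unfolding g_def by (subst degree_mult_eq) (use h0 h(2) in auto)
    show "monic g" unfolding g_def by (subst lead_coeff_mult) (use h(3) in simp)
  qed
  let ?M = "carrier_mat (Suc m) (Suc m)"
  define X where "X = {A \<in> ?M. char_poly A = f}"
  define Y where "Y = {A \<in> ?M. char_poly A = g}"
  have X: "conj_class (Suc m) X"
    unfolding X_def
  proof (rule conj_class_char_poly[OF f(2,3)])
    fix A :: "'a mat" assume "A \<in> ?M" "char_poly A = f"
    then have "cyclic A (unit_vec (Suc m) 0)"
      using f(1) by (intro irreducible_cyclic[of _ "Suc m"] unit_vec_neq_0) auto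
    then show "\<exists>c \<in> carrier_vec (Suc m). cyclic A c" by (intro bexI[of _ "unit_vec (Suc m) 0"]) auto
  qed
  have Y: "conj_class (Suc m) Y"
    unfolding Y_def
    by (rule conj_class_char_poly[OF g], rule exists_cyclic_linear_times_irreducible)
      (use h in \<open>auto simp: g_def\<close>)
  obtain A B where A: "A \<in> X" and B: "B \<in> Y"
    using conj_class_nonempty[OF X] conj_class_nonempty[OF Y] by blast
  have AB: "A \<in> ?M" "char_poly A = f" "B \<in> ?M" "char_poly B = g"
    using A B by (auto simp: X_def Y_def)
  have cX: "class_char_poly X = f" using class_char_poly_eq[OF X A] AB by simp
  have cY: "class_char_poly Y = [:- l, 1:] * h" using class_char_poly_eq[OF Y B] AB by (simp add: g_def)
  have "class_trace X = - coeff f m"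
    using class_trace_eq[OF X A] coeff_char_poly_trace[OF AB(1)] AB(2) by simp
  moreover have "class_trace Y = - coeff g m"
    using class_trace_eq[OF Y B] coeff_char_poly_trace[OF AB(3)] AB(4) by simp
  moreover have "coeff g m = coeff h (m - 1) - l"
    unfolding g_def by (rule coeff_linear_mult[OF h(2,3) m])
  ultimately have trace: "mat_trace z = class_trace X + class_trace Y" using tr by simp
  have num: "num_sum_reps X Y z = card {x \<in> ?M. char_poly x = f \<and> char_poly (z - x) = [:- l, 1:] * h}"
    unfolding num_sum_reps_def
  proof (rule bij_betw_same_card[of fst], rule bij_betw_byWitness[where f' = "\<lambda>x. (x, z - x)"])
    have diff: "x + y - x = y" "x + (z - x) = z" "z - x \<in> ?M" if "x \<in> ?M" "y \<in> ?M" for x y :: "'a mat"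
      using that z(1) by (auto intro!: eq_matI)
    show "\<forall>a\<in>{(x, y). x \<in> X \<and> y \<in> Y \<and> x + y = z}. (fst a, z - fst a) = a"
      using diff(1) by (auto simp: X_def Y_def)
    show "fst ` {(x, y). x \<in> X \<and> y \<in> Y \<and> x + y = z} \<subseteq> {x \<in> ?M. char_poly x = f \<and> char_poly (z - x) = [:- l, 1:] * h}"
      using diff(1) by (auto simp: X_def Y_def g_def)
    show "(\<lambda>x. (x, z - x)) ` {x \<in> ?M. char_poly x = f \<and> char_poly (z - x) = [:- l, 1:] * h}
        \<subseteq> {(x, y). x \<in> X \<and> y \<in> Y \<and> x + y = z}"
      using diff(2,3) z(1) by (auto simp: X_def Y_def g_def)
  qed simp
  have "\<bar>real (num_sum_reps X Y z) - real q ^ m\<^sup>2\<bar> \<le> 42 * real q ^ (m\<^sup>2 - 1)"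
    unfolding num assms(1) by (rule card_decompositions[OF z f h tr])
  then show ?thesis
    using X Y cX cY f h trace unfolding n by (intro exI[of _ X] exI[of _ Y]) auto
qed

end
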